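(* Let $\alpha>0$, $n\in\mathbb N$ and $k\in\{1,\ldots,n\}$ with $\alpha n>1$. Then $$ \tilde{\mathbf J}_{n,k}\Big(\frac{\alpha+n-1}{2}\Big)=\binom nk\int_{-\pi/2}^{\pi/2}\tilde c_{\frac{\alpha n}{2}}(\cos x)^{\alpha n-2}\Big(\frac12+i\int_0^x\tilde c_{\frac{\alpha+1}{2}}(\cos y)^{-\alpha}dy\Big)^{n-k}dx. $$
   Context: For $d\in\mathbb N$ and $\beta>d/2$ the $d$-dimensional beta' distribution has density $\tilde f_{d,\beta}(x)=\tilde c_{d,\beta}(1+\|x\|^2)^{-\beta}$, $x\in\mathbb R^d$, with $\tilde c_{d,\beta}=\Gamma(\beta)/(\pi^{d/2}\Gamma(\beta-\frac d2))$. Write $\tilde c_\beta:=\tilde c_{1,\beta}=\Gamma(\beta)/(\sqrt\pi\,\Gamma(\beta-\frac12))$. The internal angle $\beta(F,T)$ of a simplex $T\subset\mathbb R^d$ at a face $F$ is $\lim_{r\downarrow0}\mathrm{Vol}_d(B_r(z)\cap T)/\mathrm{Vol}_d(B_r(z))$, $z$ in the relative interior of $F$. For $n\ge2$, $\beta>\frac{n-1}{2}$ and $\tilde X_1,\ldots,\tilde X_n$ i.i.d. in $\mathbb R^{n-1}$ with density $\tilde f_{n-1,\beta}$, $\tilde{\mathbf J}_{n,k}(\beta)=\binom nk\,\mathbb E\,\beta([\tilde X_1,\ldots,\tilde X_k],[\tilde X_1,\ldots,\tilde X_n])$, $k\in\{1,\ldots,n\}$; by convention $\tilde{\mathbf J}_{n,n}(\beta)=1$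 for all $n\in\mathbb N$. Here $i=\sqrt{-1}$. *)

theory Defs
  imports "HOL-Analysis.Analysis"
begin

text \<open>Points of R^d are represented as functions nat => real, with the coordinates
  0..d-1 relevant; Lebesgue measure on R^d is the product measure over {..<d}.\<close>

definition lebesgue_d :: "nat \<Rightarrow> (nat \<Rightarrow> real) measure" where
  "lebesgue_d d = PiM {..<d} (\<lambda>_. lborel)"

definition norm_d :: "nat \<Rightarrow> (nat \<Rightarrow> real) \<Rightarrow> real" where
  "norm_d d x = sqrt (\<Sum>i<d. (x i)\<^sup>2)"

definition ball_d :: "nat \<Rightarrow> (nat \<Rightarrow> real) \<Rightarrow> real \<Rightarrow> (nat \<Rightarrow> real) set" where
  "ball_d d z r = {x \<in> space (lebesgue_d d). norm_d d (\<lambda>i. x i - z i) < r}"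

definition simplex_d :: "nat \<Rightarrow> (nat \<Rightarrow> nat \<Rightarrow> real) \<Rightarrow> nat set \<Rightarrow> (nat \<Rightarrow> real) set" where
  "simplex_d d X S = {y \<in> space (lebesgue_d d). \<exists>w. (\<forall>j\<in>S. 0 \<le> w j) \<and> (\<Sum>j\<in>S. w j) = 1
        \<and> (\<forall>i<d. y i = (\<Sum>j\<in>S. w j * X j i))}"

definition angle_at :: "nat \<Rightarrow> (nat \<Rightarrow> real) \<Rightarrow> (nat \<Rightarrow> real) set \<Rightarrow> real" where
  "angle_at d z T = Lim (at_right 0)
     (\<lambda>r. measure (lebesgue_d d) (ball_d d z r \<inter> T) / measure (lebesgue_d d) (ball_d d z r))"

text \<open>Internal angle of the simplex [X j : j in S] at its face [X j : j in K], evaluated at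
  the barycentre of the face (a point of its relative interior).\<close>
definition internal_angle :: "nat \<Rightarrow> (nat \<Rightarrow> nat \<Rightarrow> real) \<Rightarrow> nat set \<Rightarrow> nat set \<Rightarrow> real" where
  "internal_angle d X K S =
     angle_at d (\<lambda>i. (\<Sum>j\<in>K. X j i) / real (card K)) (simplex_d d X S)"

definition c_tilde_d :: "nat \<Rightarrow> real \<Rightarrow> real" where
  "c_tilde_d d \<beta> = Gamma \<beta> / (pi powr (real d / 2) * Gamma (\<beta> - real d / 2))"

definition c_tilde :: "real \<Rightarrow> real" where
  "c_tilde \<beta> = Gamma \<beta> / (sqrt pi * Gamma (\<beta> - 1/2))"

definition f_tilde :: "nat \<Rightarrow> real \<Rightarrow> (nat \<Rightarrow> real) \<Rightarrow> real" where
  "f_tilde d \<beta> x = c_tilde_d d \<beta> * (1 + (norm_d d x)\<^sup>2) powr (- \<beta>)"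

definition beta'_distr :: "nat \<Rightarrow> real \<Rightarrow> (nat \<Rightarrow> real) measure" where
  "beta'_distr d \<beta> = density (lebesgue_d d) (\<lambda>x. ennreal (f_tilde d \<beta> x))"

text \<open>J tilde_{n,k}(beta); the i.i.d. points are X 0, ..., X (n-1) in R^(n-1), the face
  is spanned by X 0, ..., X (k-1). Convention: J_{n,n} = 1.\<close>
definition J_tilde :: "nat \<Rightarrow> nat \<Rightarrow> real \<Rightarrow> real" where
  "J_tilde n k \<beta> = (if k = n then 1 else
     real (n choose k) *
     (\<integral>X. internal_angle (n - 1) X {..<k} {..<n}
        \<partial>(PiM {..<n} (\<lambda>_. beta'_distr (n - 1) \<beta>))))"

end

theory Submission
  imports Defs "HOL-Probability.Probability" "HOL-Real_Asymp.Real_Asymp" "Jordan_Normal_Form.Char_Poly"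
begin

text \<open>
  The beta' law is a mixture of centred Gaussian laws: a point is $G_j / \sqrt{2 v_j}$ with $G_j$ standard
  normal and $v_j$ gamma distributed with parameter $\alpha/2$. A vector $g$ lies in the tangent cone of the
  simplex at the face spanned by the first $k$ points iff the unique weights $w$ with $\sum_j w_j = 0$ and
  $\sum_j w_j X_j = g$ are nonnegative for $j \ge k$. For $g$ uniform in the ball and given $v$, rotation
  invariance of $G$ shows that the density of $w$ depends only on $\sum_j w_j^2 / v_j$; so the expected angle
  is the probability that $w_j \ge 0$ for $j \ge k$, where the $w_j$ are independent centred Gaussians of
  variance $2 v_j$ conditioned to have sum $0$. This conditional probability is homogeneous of degree $0$ in
  $v$, so averaging over $v$ may be carried out with the extra weight $(\sum_j v_j)^{-1/2}$, which is the
  density at $0$ of $\sum_j w_j$ up to a constant. Fourier inversion at $0$ then gives the integral over $t$ of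
  the product of the one-dimensional transforms $E e^{i t w}$ (for $j < k$) and $E 1_{w \ge 0} e^{i t w}$ (for
  $j \ge k$), and $t = \tan x$ is the integral of the theorem.
\<close>

section \<open>Half-line Gaussian transforms\<close>

text \<open>Given \<open>v\<close>, the vector sum_j w_j X_j is centred Gaussian with covariance
  sum_j w_j^2 / (2 v_j) times the identity; hence the quadratic form. The density of the weights is
  not Gaussian, since it is divided by the volume of the unit ball in weight coordinates, which
  depends on all points. But any two functions of the form give the cone the same share of their
  mass, so a Gaussian may replace it. The remaining obstacle is the conditioning on sum zero: its
  normalizer involves all v_j together, and the average over \<open>v\<close> would not factor over
  j. The weight (sum_j v_j)^(-1/2) cancels this normalizer. It does no harm because for independent
  gamma variables of a common scale the sum is independent of the direction, on which alone the
  conditional probability depends. The reciprocal of its mean, up to sqrt pi, is the leading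
  constant of the theorem. Jacobians of linear maps in several dimensions are never evaluated: they
  enter as unknown constants that cancel or, for reflections, equal 1. The variance 2v in
  \<open>gdens\<close> makes the full-line transform exp(-v t^2), whose gamma average is a plain
  power of 1 + t^2.\<close>

definition gdens :: "real \<Rightarrow> real \<Rightarrow> real" where
  "gdens v w = exp (- w\<^sup>2 / (4 * v)) / sqrt (4 * pi * v)"

text \<open>Restricted characteristic function of a centred Gaussian of variance 2v. The sets of
  interest are the whole line, for vertices of the face, and the half-line \<open>{0..}\<close>, for
  the other vertices.\<close>

definition gchar :: "real set \<Rightarrow> real \<Rightarrow> real \<Rightarrow> complex" where
  "gchar A v t = (\<integral>w. complex_of_real (indicator A w * gdens v w) * iexp (t * w) \<partial>lborel)"

lemma gdens_measurable [measurable]: "gdens v \<in> borel_measurable borel"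
  unfolding gdens_def by measurable

lemma gdens_nonneg: "0 < v \<Longrightarrow> 0 \<le> gdens v w"
  by (simp add: gdens_def)

lemma gdens_eq_normal_density: "0 < v \<Longrightarrow> gdens v w = normal_density 0 (sqrt (2 * v)) w"
  by (simp add: gdens_def normal_density_def mult_ac)

lemma integrable_gdens_moment: "0 < v \<Longrightarrow> integrable lborel (\<lambda>w. gdens v w * w ^ m)"
  using integrable_normal_moment[of "sqrt (2 * v)" 0 m] by (simp add: gdens_eq_normal_density)

lemma integrable_gdens: "0 < v \<Longrightarrow> integrable lborel (gdens v)"
  using integrable_gdens_moment[of v 0] by simp

lemma integral_gdens: "0 < v \<Longrightarrow> (\<integral>w. gdens v w \<partial>lborel) = 1"
  by (simp add: gdens_eq_normal_density)

lemma integrable_gchar: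
  assumes "0 < v" "A \<in> sets borel"
  shows "integrable lborel (\<lambda>w. complex_of_real (indicator A w * gdens v w) * iexp (t * w))"
proof (rule Bochner_Integration.integrable_bound[OF integrable_gdens[OF assms(1)]])
  show "(\<lambda>w. complex_of_real (indicator A w * gdens v w) * iexp (t * w)) \<in> borel_measurable lborel"
    using assms by measurable
  show "AE w in lborel. norm (complex_of_real (indicator A w * gdens v w) * iexp (t * w)) \<le> norm (gdens v w)"
    by (auto simp: norm_mult indicator_def)
qed

lemma norm_gchar_le_1:
  assumes v: "0 < v" and A [measurable]: "A \<in> sets borel"
  shows "norm (gchar A v t) \<le> 1"
proof -
  have "norm (gchar A v t) \<le> (\<integral>w. norm (complex_of_real (indicator A w * gdens v w) * iexp (t * w)) \<partial>lborel)"
    unfolding gchar_def by (rule integral_norm_bound)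
  also have "\<dots> \<le> (\<integral>w. gdens v w \<partial>lborel)"
    using gdens_nonneg[OF v]
    by (intro integral_mono integrable_norm integrable_gchar integrable_gdens v) (auto simp: norm_mult indicator_def)
  finally show ?thesis using integral_gdens[OF v] by simp
qed

lemma gchar_UNIV:
  assumes v: "0 < v"
  shows "gchar UNIV v t = complex_of_real (exp (- (v * t\<^sup>2)))"
proof -
  define \<sigma> where "\<sigma> = sqrt (2 * v)"
  have \<sigma>: "0 < \<sigma>" "\<sigma>\<^sup>2 = 2 * v" using v by (auto simp: \<sigma>_def)
  have "gchar UNIV v t = \<bar>\<sigma>\<bar> *\<^sub>R (\<integral>x. complex_of_real (indicator UNIV (0 + \<sigma> * x) * gdens v (0 + \<sigma> * x)) * iexp (t * (0 + \<sigma> * x)) \<partial>lborel)"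
    unfolding gchar_def using \<sigma> by (intro lborel_integral_real_affine) auto
  also have "\<dots> = (\<integral>x. std_normal_density x *\<^sub>R iexp (t * \<sigma> * x) \<partial>lborel)"
  proof -
    have "\<sigma> * gdens v (\<sigma> * x) = std_normal_density x" for x
    proof -
      have "sqrt (4 * pi * v) = \<sigma> * sqrt (2 * pi)"
        unfolding \<sigma>_def real_sqrt_mult[symmetric] by (simp add: mult_ac)
      then show ?thesis using \<sigma> v by (simp add: gdens_def std_normal_density_def power_mult_distrib)
    qed
    then have "\<sigma> *\<^sub>R (complex_of_real (gdens v (\<sigma> * x)) * iexp (t * (\<sigma> * x))) = std_normal_density x *\<^sub>R iexp (t * \<sigma> * x)" for x
      by (simp add: scaleR_conv_of_real mult.assoc[symmetric] flip: of_real_mult)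
    then show ?thesis using \<sigma> by (simp flip: integral_scaleR_right)
  qed
  also have "\<dots> = char std_normal_distribution (t * \<sigma>)"
    unfolding char_def by (subst integral_density) auto
  also have "\<dots> = complex_of_real (exp (- (v * t\<^sup>2)))"
    by (simp add: char_std_normal_distribution power_mult_distrib \<sigma> mult.commute)
  finally show ?thesis .
qed

text \<open>As a function of t, exp(-v t^2) is a multiple of \<open>gdens\<close> with the dual
  parameter 1/(4v), so this is \<open>gchar_UNIV\<close> with the two variables exchanged.\<close>

lemma integral_gauss_iexp:
  assumes v: "0 < v"
  shows "(\<integral>t. complex_of_real (exp (- (v * t\<^sup>2))) * iexp (s * t) \<partial>lborel) = complex_of_real (sqrt (pi / v) * exp (- s\<^sup>2 / (4 * v)))"
proof -
  define u where "u = 1 / (4 * v)"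
  have u: "0 < u" using v by (simp add: u_def)
  have "exp (- (v * t\<^sup>2)) = sqrt (pi / v) * gdens u t" for t
    using v by (simp add: gdens_def u_def mult.commute)
  then have "(\<integral>t. complex_of_real (exp (- (v * t\<^sup>2))) * iexp (s * t) \<partial>lborel) = complex_of_real (sqrt (pi / v)) * gchar UNIV u s"
    unfolding gchar_def by (subst integral_mult_right_zero[symmetric]) (simp add: mult.assoc)
  then show ?thesis using u by (simp add: gchar_UNIV u_def)
qed

lemma integrable_half_moment:
  "0 < v \<Longrightarrow> integrable lborel (\<lambda>w. complex_of_real (indicator {0..} w * (gdens v w * w ^ m)) * iexp (t * w))"
  by (rule Bochner_Integration.integrable_bound[OF integrable_gdens_moment[of v m]])
     (auto simp: norm_mult norm_power abs_mult power_abs indicator_def)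

text \<open>Integration by parts, from \<open>w * gdens v w = - 2 * v * gdens v' w\<close>.\<close>

lemma gchar_half_first_moment:
  assumes v: "0 < v"
  shows "(\<integral>w. complex_of_real (indicator {0..} w * (gdens v w * w)) * iexp (t * w) \<partial>lborel) =
    complex_of_real (2 * v * gdens v 0) + 2 * v * \<i> * t * gchar {0..} v t"
proof -
  define f where "f w = complex_of_real (gdens v w * w) * iexp (t * w) - 2 * v * \<i> * t * (complex_of_real (gdens v w) * iexp (t * w))" for w
  define F where "F w = - (2 * v) * complex_of_real (gdens v w) * iexp (t * w)" for w
  have i1: "integrable lborel (\<lambda>w. complex_of_real (gdens v w * w) * iexp (t * w))"
    by (rule Bochner_Integration.integrable_bound[OF integrable_gdens_moment[OF v, of 1]])
       (auto simp: norm_mult)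
  have i0: "integrable lborel (\<lambda>w. complex_of_real (gdens v w) * iexp (t * w))"
    using integrable_gchar[OF v, of UNIV t] by simp
  have dg: "(gdens v has_real_derivative - (w / (2 * v)) * gdens v w) (at w)" for w
    unfolding gdens_def using v by (auto intro!: derivative_eq_intros simp: field_simps)
  have dF: "(F has_vector_derivative f w) (at w)" for w
  proof -
    have "((\<lambda>w. iexp (t * w)) has_vector_derivative (\<i> * t * iexp (t * w))) (at w)"
    proof -
      have "((\<lambda>z. exp (\<i> * (t * z))) has_field_derivative (\<i> * t * exp (\<i> * (t * complex_of_real w)))) (at (of_real w))"
        by (auto intro!: derivative_eq_intros)
      then show ?thesis using has_vector_derivative_real_field by fastforce
    qed
    moreover have "((\<lambda>w. complex_of_real (gdens v w)) has_vector_derivative complex_of_real (- (w / (2 * v)) * gdens v w)) (at w)"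
      using dg[of w] by (rule has_vector_derivative_of_real)
    ultimately have "((\<lambda>w. complex_of_real (gdens v w) * iexp (t * w)) has_vector_derivative
       complex_of_real (gdens v w) * (\<i> * t * iexp (t * w)) + complex_of_real (- (w / (2 * v)) * gdens v w) * iexp (t * w)) (at w)"
      by (intro has_vector_derivative_mult)
    then have "((\<lambda>w. - (2 * v) * (complex_of_real (gdens v w) * iexp (t * w))) has_vector_derivative
       - (2 * v) * (complex_of_real (gdens v w) * (\<i> * t * iexp (t * w)) + complex_of_real (- (w / (2 * v)) * gdens v w) * iexp (t * w))) (at w)"
      by (rule has_vector_derivative_mult_right)
    moreover have "- (2 * v) * (complex_of_real (gdens v w) * (\<i> * t * iexp (t * w)) + complex_of_real (- (w / (2 * v)) * gdens v w) * iexp (t * w)) = f w"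
      using v by (simp add: f_def field_simps)
    ultimately show ?thesis by (simp add: F_def[abs_def] mult.assoc)
  qed
  have intf: "integrable lborel f" unfolding f_def
    by (intro Bochner_Integration.integrable_diff integrable_mult_right i1 i0)
  have contf: "isCont f w" for w
    unfolding f_def gdens_def using v by (auto intro!: continuous_intros)
  have lim0: "((F \<circ> real_of_ereal) \<longlongrightarrow> F 0) (at_right (0::ereal))"
  proof -
    have "isCont F 0" using dF[of 0] by (rule has_vector_derivative_continuous)
    then have "(F \<longlongrightarrow> F 0) (at_right 0)" by (simp add: continuous_at filterlim_at_split)
    then show ?thesis unfolding zero_ereal_def by (simp only: ereal_tendsto_simps1)
  qed
  have liminf: "((F \<circ> real_of_ereal) \<longlongrightarrow> 0) (at_left \<infinity>)"
  proof -
    have "((\<lambda>w. exp (- w\<^sup>2 / (4 * v)) / sqrt (4 * pi * v)) \<longlongrightarrow> 0) at_top"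
      using v by real_asymp
    then have "(gdens v \<longlongrightarrow> 0) at_top" by (simp add: gdens_def[abs_def])
    then have "((\<lambda>w. 2 * v * gdens v w) \<longlongrightarrow> 2 * v * 0) at_top" by (intro tendsto_intros)
    moreover have "norm (F w) = 2 * v * gdens v w" for w
      using v gdens_nonneg[OF v, of w] by (simp add: F_def norm_mult)
    ultimately have "((\<lambda>w. norm (F w)) \<longlongrightarrow> 0) at_top" by simp
    then have "(F \<longlongrightarrow> 0) at_top" by (simp add: tendsto_norm_zero_iff)
    then show ?thesis by (simp add: ereal_tendsto_simps)
  qed
  have "(LBINT w=0..\<infinity>. f w) = 0 - F 0"
    by (rule interval_integral_FTC_integrable[OF _ dF contf _ lim0 liminf])
       (use intf in \<open>auto simp: set_integrable_def intro!: integrable_mult_indicator\<close>)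
  moreover have "(LBINT w=0..\<infinity>. f w) = (\<integral>w. indicator {0..} w *\<^sub>R f w \<partial>lborel)"
  proof -
    have "(LBINT w=0..\<infinity>. f w) = (\<integral>w. indicator {0<..} w *\<^sub>R f w \<partial>lborel)"
      by (simp add: interval_lebesgue_integral_def set_lebesgue_integral_def zero_ereal_def einterval_eq)
    also have "\<dots> = (\<integral>w. indicator {0..} w *\<^sub>R f w \<partial>lborel)"
      by (intro integral_cong_AE) (use intf AE_lborel_singleton[of 0] in \<open>auto simp: indicator_def elim!: eventually_mono\<close>)
    finally show ?thesis .
  qed
  moreover have "(\<integral>w. indicator {0..} w *\<^sub>R f w \<partial>lborel) =
    (\<integral>w. complex_of_real (indicator {0..} w * (gdens v w * w)) * iexp (t * w) \<partial>lborel) - 2 * v * \<i> * t * gchar {0..} v t"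
  proof -
    have "(\<integral>w. indicator {0..} w *\<^sub>R f w \<partial>lborel) = (\<integral>w. complex_of_real (indicator {0..} w * (gdens v w * w)) * iexp (t * w)
      - 2 * v * \<i> * t * (complex_of_real (indicator {0..} w * gdens v w) * iexp (t * w)) \<partial>lborel)"
      by (intro Bochner_Integration.integral_cong) (auto simp: f_def indicator_def)
    also have "\<dots> = (\<integral>w. complex_of_real (indicator {0..} w * (gdens v w * w)) * iexp (t * w) \<partial>lborel) -
      (\<integral>w. 2 * v * \<i> * t * (complex_of_real (indicator {0..} w * gdens v w) * iexp (t * w)) \<partial>lborel)"
    proof (intro Bochner_Integration.integral_diff integrable_mult_right integrable_gchar v)
      show "integrable lborel (\<lambda>w. complex_of_real (indicator {0..} w * (gdens v w * w)) * iexp (t * w))"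
        using integrable_half_moment[OF v, of 1] by simp
    qed auto
    finally show ?thesis by (simp add: gchar_def)
  qed
  ultimately show ?thesis by (simp add: F_def algebra_simps)
qed


text \<open>Solving \<open>gchar_half_first_moment\<close> for the transform leaves a difference of
  two terms, each of size at most \<open>2 * v * gdens v 0\<close>. The decay is only 1/|t| because
  of the jump of the indicator at 0; it is the source of the integrability in t of the averaged
  products.\<close>

lemma norm_gchar_half_le:
  assumes v: "0 < v" and t: "t \<noteq> 0"
  shows "norm (gchar {0..} v t) \<le> 1 / (sqrt v * \<bar>t\<bar>)"
proof -
  let ?m = "\<lambda>t. (\<integral>w. complex_of_real (indicator {0..} w * (gdens v w * w)) * iexp (t * w) \<partial>lborel)"
  have int: "integrable lborel (\<lambda>w. complex_of_real (indicator {0..} w * (gdens v w * w)) * iexp (t * w))" for t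
    using integrable_half_moment[OF v, of 1] by simp
  have "norm (?m t) \<le> (\<integral>w. norm (complex_of_real (indicator {0..} w * (gdens v w * w)) * iexp (t * w)) \<partial>lborel)"
    by (rule integral_norm_bound)
  also have "\<dots> = (\<integral>w. indicator {0..} w * (gdens v w * w) \<partial>lborel)"
    using gdens_nonneg[OF v] by (intro Bochner_Integration.integral_cong) (auto simp: norm_mult indicator_def)
  \<comment> \<open>The moment identity at t = 0 computes the first absolute moment, since its term
    with the transform carries the factor t.\<close>
  also have "\<dots> = 2 * v * gdens v 0"
  proof -
    have "complex_of_real (\<integral>w. indicator {0..} w * (gdens v w * w) \<partial>lborel) = ?m 0"
      by (simp flip: integral_complex_of_real)
    also have "\<dots> = complex_of_real (2 * v * gdens v 0)"
      using gchar_half_first_moment[OF v, of 0] by simp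
    finally show ?thesis by (simp only: of_real_eq_iff)
  qed
  finally have m: "norm (?m t) \<le> 2 * v * gdens v 0" .
  have "2 * v * \<bar>t\<bar> * norm (gchar {0..} v t) = norm (2 * v * \<i> * t * gchar {0..} v t)"
    using v by (simp add: norm_mult)
  also have "2 * v * \<i> * t * gchar {0..} v t = ?m t - complex_of_real (2 * v * gdens v 0)"
    unfolding gchar_half_first_moment[OF v] by simp
  also have "norm \<dots> \<le> norm (?m t) + norm (complex_of_real (2 * v * gdens v 0))" by (rule norm_triangle_ineq4)
  also have "norm (complex_of_real (2 * v * gdens v 0)) = 2 * v * gdens v 0"
    using v gdens_nonneg[OF v, of 0] by (simp add: norm_mult)
  finally have "2 * v * \<bar>t\<bar> * norm (gchar {0..} v t) \<le> 2 * v * (2 * gdens v 0)" using m by simp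
  then have "\<bar>t\<bar> * norm (gchar {0..} v t) \<le> 2 * gdens v 0"
    using v by (simp only: mult.assoc) simp
  also have "2 * gdens v 0 \<le> 1 / sqrt v"
  proof -
    have "2 * gdens v 0 = 1 / (sqrt pi * sqrt v)"
      by (simp add: gdens_def real_sqrt_mult)
    also have "\<dots> \<le> 1 / (1 * sqrt v)"
      using v pi_gt3 by (intro divide_left_mono mult_right_mono) auto
    finally show ?thesis by simp
  qed
  finally show ?thesis using v t by (simp add: field_simps)
qed

text \<open>Differentiation under the integral with an explicit remainder: |exp(ihw) - 1 - ihw| is
  at most (hw)^2 / 2, so the second moment \<open>C\<close> bounds the error by C h^2 / 2.\<close>

lemma gchar_half_has_derivative:
  assumes v: "0 < v"
  shows "(gchar {0..} v has_vector_derivative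
    (\<i> * (\<integral>w. complex_of_real (indicator {0..} w * (gdens v w * w)) * iexp (t * w) \<partial>lborel))) (at t)"
proof -
  let ?m = "\<integral>w. complex_of_real (indicator {0..} w * (gdens v w * w)) * iexp (t * w) \<partial>lborel"
  let ?F = "gchar {0..} v"
  define C where "C = (\<integral>w. gdens v w * w\<^sup>2 \<partial>lborel)"
  have C: "0 \<le> C" unfolding C_def using gdens_nonneg[OF v] by (intro integral_nonneg_AE) auto
  have i0: "integrable lborel (\<lambda>w. complex_of_real (indicator {0..} w * gdens v w) * iexp (t * w))" for t
    by (rule integrable_gchar[OF v]) auto
  have i1: "integrable lborel (\<lambda>w. complex_of_real (indicator {0..} w * (gdens v w * w)) * iexp (t * w))"
    using integrable_half_moment[OF v, of 1] by simp
  have bound: "norm (?F (t + h) - ?F t - complex_of_real h * (\<i> * ?m)) \<le> C / 2 * h\<^sup>2" for h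
  proof -
    let ?g = "\<lambda>w. complex_of_real (indicator {0..} w * gdens v w) * iexp ((t + h) * w)
        - complex_of_real (indicator {0..} w * gdens v w) * iexp (t * w)
        - complex_of_real h * (\<i> * (complex_of_real (indicator {0..} w * (gdens v w * w)) * iexp (t * w)))"
    have ig: "integrable lborel ?g" by (intro Bochner_Integration.integrable_diff integrable_mult_right i0 i1)
    have eq: "?F (t + h) - ?F t - complex_of_real h * (\<i> * ?m) = (\<integral>w. ?g w \<partial>lborel)"
    proof -
      have "(\<integral>w. ?g w \<partial>lborel) = (\<integral>w. complex_of_real (indicator {0..} w * gdens v w) * iexp ((t + h) * w)
          - complex_of_real (indicator {0..} w * gdens v w) * iexp (t * w) \<partial>lborel)
        - (\<integral>w. complex_of_real h * (\<i> * (complex_of_real (indicator {0..} w * (gdens v w * w)) * iexp (t * w))) \<partial>lborel)"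
        by (rule Bochner_Integration.integral_diff) (intro Bochner_Integration.integrable_diff integrable_mult_right i0 i1)+
      also have "(\<integral>w. complex_of_real (indicator {0..} w * gdens v w) * iexp ((t + h) * w)
          - complex_of_real (indicator {0..} w * gdens v w) * iexp (t * w) \<partial>lborel) = ?F (t + h) - ?F t"
        unfolding gchar_def by (rule Bochner_Integration.integral_diff[OF i0 i0])
      also have "(\<integral>w. complex_of_real h * (\<i> * (complex_of_real (indicator {0..} w * (gdens v w * w)) * iexp (t * w))) \<partial>lborel)
        = complex_of_real h * (\<i> * ?m)"
        by (simp only: integral_mult_right_zero)
      finally show ?thesis by simp
    qed
    have "norm (?F (t + h) - ?F t - complex_of_real h * (\<i> * ?m)) \<le> (\<integral>w. norm (?g w) \<partial>lborel)"
      unfolding eq by (rule integral_norm_bound)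
    also have "\<dots> \<le> (\<integral>w. h\<^sup>2 / 2 * (gdens v w * w\<^sup>2) \<partial>lborel)"
    proof (rule integral_mono)
      fix w
      have geq: "?g w = complex_of_real (indicator {0..} w * gdens v w) * iexp (t * w) * (iexp (h * w) - (1 + \<i> * (h * w)))"
      proof -
        have alg: "a * (p * q) - a * p - complex_of_real h * (\<i> * (a * w * p)) = a * p * (q - (1 + \<i> * (h * w)))" for a p q :: complex
          by (simp add: algebra_simps)
        have "iexp ((t + h) * w) = iexp (t * w) * iexp (h * w)"
          by (simp add: distrib_left distrib_right exp_add)
        then show ?thesis
          using alg[of "complex_of_real (indicator {0..} w * gdens v w)" "iexp (t * w)" "iexp (h * w)"]
          by (simp only: of_real_mult mult.assoc)
      qed
      have "norm (iexp (h * w) - (1 + \<i> * (h * w))) \<le> (h * w)\<^sup>2 / 2"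
        using iexp_approx1[of "h * w" 1] by (simp add: numeral_2_eq_2)
      then have "indicator {0..} w * gdens v w * norm (iexp (h * w) - (1 + \<i> * (h * w))) \<le>
          indicator {0..} w * gdens v w * ((h * w)\<^sup>2 / 2)"
        using gdens_nonneg[OF v, of w] by (intro mult_left_mono) auto
      moreover have "norm (?g w) = indicator {0..} w * gdens v w * norm (iexp (h * w) - (1 + \<i> * (h * w)))"
        unfolding geq using gdens_nonneg[OF v, of w] by (simp add: norm_mult)
      ultimately have "norm (?g w) \<le> indicator {0..} w * gdens v w * ((h * w)\<^sup>2 / 2)" by (simp only:)
      also have "\<dots> \<le> gdens v w * ((h * w)\<^sup>2 / 2)"
        using gdens_nonneg[OF v, of w] by (auto simp: indicator_def)
      finally show "norm (?g w) \<le> h\<^sup>2 / 2 * (gdens v w * w\<^sup>2)" by (simp add: power_mult_distrib mult_ac)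
    qed (intro integrable_norm ig integrable_mult_right integrable_gdens_moment v)+
    finally show ?thesis by (simp add: C_def mult.commute)
  qed
  have "((\<lambda>h. norm (?F (t + h) - ?F t - complex_of_real h * (\<i> * ?m)) / norm h) \<longlongrightarrow> 0) (at 0)"
  proof (rule tendsto_sandwich[where f = "\<lambda>_. 0" and h = "\<lambda>h. C / 2 * \<bar>h\<bar>"])
    show "\<forall>\<^sub>F h in at 0. norm (?F (t + h) - ?F t - complex_of_real h * (\<i> * ?m)) / norm h \<le> C / 2 * \<bar>h\<bar>"
    proof (rule eventually_at_filter[THEN iffD2], rule always_eventually, intro allI impI)
      fix h :: real assume "h \<noteq> 0"
      then show "norm (?F (t + h) - ?F t - complex_of_real h * (\<i> * ?m)) / norm h \<le> C / 2 * \<bar>h\<bar>"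
        using bound[of h] by (simp add: divide_le_eq power2_eq_square mult.assoc)
    qed
    show "((\<lambda>h. C / 2 * \<bar>h\<bar>) \<longlongrightarrow> 0) (at 0)" by (auto intro!: tendsto_eq_intros)
  qed auto
  then show ?thesis
    unfolding has_vector_derivative_def has_derivative_at
    by (intro conjI bounded_linear_scaleR_left) (simp only: scaleR_conv_of_real)
qed

lemma gchar_half_0: "0 < v \<Longrightarrow> gchar {0..} v 0 = 1 / 2"
proof -
  assume v: "0 < v"
  have "has_bochner_integral lborel (\<lambda>x::real. indicator {0..} x *\<^sub>R exp (- x\<^sup>2)) (sqrt pi / 2)"
    by (rule gaussian_moment_0)
  then have "(\<integral>x. indicator {0..} x * exp (- (x :: real)\<^sup>2) \<partial>lborel) = sqrt pi / 2"
    by (simp add: has_bochner_integral_iff)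
  moreover have "(\<integral>w. indicator {0..} w * gdens v w \<partial>lborel) =
      \<bar>2 * sqrt v\<bar> *\<^sub>R (\<integral>x. indicator {0..} (0 + 2 * sqrt v * x) * gdens v (0 + 2 * sqrt v * x) \<partial>lborel)"
    using v by (intro lborel_integral_real_affine) auto
  moreover have "\<dots> = (\<integral>x. 1 / sqrt pi * (indicator {0..} x * exp (- x\<^sup>2)) \<partial>lborel)"
  proof -
    have "2 * sqrt v * (indicator {0..} (2 * sqrt v * x) * gdens v (2 * sqrt v * x)) = 1 / sqrt pi * (indicator {0..} x * exp (- x\<^sup>2))" for x
    proof -
      have "indicator {0..} (2 * sqrt v * x) = (indicator {0..} x :: real)"
        using v by (auto simp: indicator_def zero_le_mult_iff)
      moreover have "2 * sqrt v * gdens v (2 * sqrt v * x) = 1 / sqrt pi * exp (- x\<^sup>2)"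
        using v by (simp add: gdens_def real_sqrt_mult power_mult_distrib)
      ultimately show ?thesis by (metis (no_types, lifting) mult.left_commute)
    qed
    then show ?thesis using v by (simp flip: integral_mult_right_zero)
  qed
  ultimately have "(\<integral>w. indicator {0..} w * gdens v w \<partial>lborel) = 1 / 2" by simp
  then have "complex_of_real (\<integral>w. indicator {0..} w * gdens v w \<partial>lborel) = complex_of_real (1 / 2)"
    by (rule arg_cong)
  then show ?thesis by (simp add: gchar_def flip: integral_complex_of_real)
qed

text \<open>With \<open>gchar_half_first_moment\<close> the derivative formula becomes the linear
  equation F' = i sqrt(v/pi) - 2 v t F. The integrating factor exp(v t^2) and the start value F(0) =
  1/2 solve it; the imaginary part is a Dawson type integral.\<close>

lemma gchar_half:
  assumes v: "0 < v"
  shows "gchar {0..} v t = complex_of_real (exp (- (v * t\<^sup>2))) *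
    (1 / 2 + \<i> * complex_of_real (sqrt (v / pi) * (LBINT s=0..t. exp (v * s\<^sup>2))))"
proof -
  let ?F = "gchar {0..} v"
  define f where "f s = \<i> * complex_of_real (sqrt (v / pi) * exp (v * s\<^sup>2))" for s
  have g0: "2 * v * gdens v 0 = sqrt (v / pi)"
    using v by (simp add: gdens_def real_sqrt_mult real_sqrt_divide field_simps flip: power2_eq_square)
  have d: "((\<lambda>s. complex_of_real (exp (v * s\<^sup>2)) * ?F s) has_vector_derivative f s) (at s within A)" for s A
  proof -
    have "((\<lambda>s. exp (v * s\<^sup>2)) has_field_derivative 2 * v * s * exp (v * s\<^sup>2)) (at s)"
      by (auto intro!: derivative_eq_intros)
    then have "((\<lambda>s. complex_of_real (exp (v * s\<^sup>2))) has_vector_derivative complex_of_real (2 * v * s * exp (v * s\<^sup>2))) (at s)"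
      by (rule has_vector_derivative_of_real)
    from has_vector_derivative_mult[OF this gchar_half_has_derivative[OF v]]
    have "((\<lambda>s. complex_of_real (exp (v * s\<^sup>2)) * ?F s) has_vector_derivative
      complex_of_real (exp (v * s\<^sup>2)) * (\<i> * (complex_of_real (2 * v * gdens v 0) + 2 * v * \<i> * s * ?F s)) +
      complex_of_real (2 * v * s * exp (v * s\<^sup>2)) * ?F s) (at s)"
      unfolding gchar_half_first_moment[OF v] by simp
    moreover have "complex_of_real (exp (v * s\<^sup>2)) * (\<i> * (complex_of_real (2 * v * gdens v 0) + 2 * v * \<i> * s * ?F s)) +
      complex_of_real (2 * v * s * exp (v * s\<^sup>2)) * ?F s = f s"
      unfolding g0 f_def by (simp add: algebra_simps)
    ultimately show ?thesis by (auto intro: has_vector_derivative_at_within)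
  qed
  have "(LBINT s=0..t. f s) = complex_of_real (exp (v * t\<^sup>2)) * ?F t - complex_of_real (exp (v * 0\<^sup>2)) * ?F 0"
    unfolding zero_ereal_def
  proof (rule interval_integral_FTC_finite)
    show "continuous_on {min 0 t..max 0 t} f" unfolding f_def by (auto intro!: continuous_intros)
  qed (rule d)
  moreover have "(LBINT s=0..t. f s) = \<i> * complex_of_real (sqrt (v / pi) * (LBINT s=0..t. exp (v * s\<^sup>2)))"
    unfolding f_def by (simp add: interval_lebesgue_integral_mult_right interval_lebesgue_integral_of_real)
  ultimately have eq: "complex_of_real (exp (v * t\<^sup>2)) * ?F t = 1 / 2 + \<i> * complex_of_real (sqrt (v / pi) * (LBINT s=0..t. exp (v * s\<^sup>2)))"
    by (simp add: gchar_half_0[OF v] algebra_simps)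
  have "?F t = complex_of_real (exp (- (v * t\<^sup>2)) * exp (v * t\<^sup>2)) * ?F t"
    by (simp add: mult_exp_exp)
  also have "\<dots> = complex_of_real (exp (- (v * t\<^sup>2))) * (complex_of_real (exp (v * t\<^sup>2)) * ?F t)"
    by (simp only: of_real_mult mult.assoc)
  finally show ?thesis unfolding eq .
qed

section \<open>Translation invariant measures\<close>

lemma (in sigma_finite_measure) sigma_finite_cover:
  "\<exists>A::nat \<Rightarrow> 'a set. range A \<subseteq> sets M \<and> (\<Union>i. A i) = space M \<and> (\<forall>i. emeasure M (A i) \<noteq> \<infinity>)"
proof (rule sigma_finite)
  fix A :: "nat \<Rightarrow> 'a set"
  assume "range A \<subseteq> sets M" "(\<Union>i. A i) = space M" "\<And>i. emeasure M (A i) \<noteq> \<infinity>"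
  then show ?thesis by (intro exI[of _ A]) auto
qed

text \<open>\<open>pl\<close> and \<open>mi\<close> stand for addition and negation. They are
  parameters because the points are extensional functions, on which the pointwise operations have to
  be restricted to the index set. \<open>pl_cancel\<close> reads -(y + x) + y = -x.\<close>

locale translation_group = sigma_finite_measure M for M :: "'a measure" +
  fixes pl :: "'a \<Rightarrow> 'a \<Rightarrow> 'a" and mi :: "'a \<Rightarrow> 'a"
  assumes pl_measurable [measurable]: "(\<lambda>p. pl (fst p) (snd p)) \<in> M \<Otimes>\<^sub>M M \<rightarrow>\<^sub>M M"
    and mi_measurable [measurable]: "mi \<in> M \<rightarrow>\<^sub>M M"
    and distr_pl: "x \<in> space M \<Longrightarrow> distr M M (pl x) = M"
    and pl_comm: "x \<in> space M \<Longrightarrow> y \<in> space M \<Longrightarrow> pl x y = pl y x"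
    and pl_cancel: "x \<in> space M \<Longrightarrow> y \<in> space M \<Longrightarrow> pl (mi (pl y x)) y = mi x"
    and mi_mi: "x \<in> space M \<Longrightarrow> mi (mi x) = x"
    and space_nonnull: "emeasure M (space M) \<noteq> 0"
begin

lemma pl_measurable': "f \<in> N \<rightarrow>\<^sub>M M \<Longrightarrow> g \<in> N \<rightarrow>\<^sub>M M \<Longrightarrow> (\<lambda>x. pl (f x) (g x)) \<in> N \<rightarrow>\<^sub>M M"
  using measurable_compose[OF measurable_Pair[of f N M g M] pl_measurable] by simp

lemma mi_in_space: "x \<in> space M \<Longrightarrow> mi x \<in> space M"
  using measurable_space[OF mi_measurable] .

lemma nn_integral_translate:
  assumes [measurable]: "f \<in> borel_measurable M" and x: "x \<in> space M"
  shows "(\<integral>\<^sup>+y. f (pl x y) \<partial>M) = (\<integral>\<^sup>+y. f y \<partial>M)"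
proof -
  have [measurable]: "pl x \<in> M \<rightarrow>\<^sub>M M" by (intro pl_measurable') (use x in auto)
  have "(\<integral>\<^sup>+y. f (pl x y) \<partial>M) = (\<integral>\<^sup>+y. f y \<partial>distr M M (pl x))"
    by (rule nn_integral_distr[symmetric]) auto
  then show ?thesis using distr_pl[OF x] by simp
qed

text \<open>Computing \<open>\<integral>\<integral> 1\<^sub>A(x) 1\<^sub>B(y - x)\<close> in both orders of integration gives the uniqueness of
  translation invariant measures.\<close>

lemma invariant_measure_swap:
  assumes N: "sigma_finite_measure N" and sets_N: "sets N = sets M"
    and inv: "\<And>x. x \<in> space M \<Longrightarrow> distr N N (pl x) = N"
    and [measurable]: "A \<in> sets M" "B \<in> sets M"
  shows "emeasure N A * emeasure M B = emeasure M A * emeasure N (mi -` B \<inter> space M)"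
proof -
  interpret N: sigma_finite_measure N by fact
  interpret P: pair_sigma_finite N M by standard
  have [measurable_cong]: "sets N = sets M" by fact
  have sp: "space N = space M" using sets_N by (rule sets_eq_imp_space_eq)
  note [measurable (raw)] = pl_measurable'
  have mB [measurable]: "mi -` B \<inter> space M \<in> sets N"
    using measurable_sets[OF mi_measurable] by (simp add: sets_N)
  have "emeasure N A * emeasure M B = (\<integral>\<^sup>+x. \<integral>\<^sup>+y. indicator A x * indicator B y \<partial>M \<partial>N)"
    by (simp add: nn_integral_cmult nn_integral_multc)
  also have "\<dots> = (\<integral>\<^sup>+x. \<integral>\<^sup>+y. indicator A x * indicator B (pl (mi x) y) \<partial>M \<partial>N)"
    by (intro nn_integral_cong nn_integral_translate[symmetric, where f = "\<lambda>y. indicator A _ * indicator B y"])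
       (auto simp: sp mi_in_space)
  also have "\<dots> = (\<integral>\<^sup>+y. \<integral>\<^sup>+x. indicator A x * indicator B (pl (mi x) y) \<partial>N \<partial>M)"
    by (rule P.Fubini'[symmetric]) measurable
  \<comment> \<open>Shifting x by y under N turns -x + y into -x, so the second indicator no longer
    depends on y.\<close>
  also have "\<dots> = (\<integral>\<^sup>+y. \<integral>\<^sup>+x. indicator A (pl y x) * indicator B (mi x) \<partial>N \<partial>M)"
  proof (rule nn_integral_cong)
    fix y assume y: "y \<in> space M"
    have [measurable]: "pl y \<in> M \<rightarrow>\<^sub>M M" by (intro pl_measurable') (use y in auto)
    have "(\<integral>\<^sup>+x. indicator A x * indicator B (pl (mi x) y) \<partial>N) =
      (\<integral>\<^sup>+x. indicator A x * indicator B (pl (mi x) y) \<partial>distr N N (pl y))"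
      using inv[OF y] by simp
    also have "\<dots> = (\<integral>\<^sup>+x. indicator A (pl y x) * indicator B (pl (mi (pl y x)) y) \<partial>N)"
      by (rule nn_integral_distr) (use y in measurable)
    also have "\<dots> = (\<integral>\<^sup>+x. indicator A (pl y x) * indicator B (mi x) \<partial>N)"
      by (intro nn_integral_cong) (use y in \<open>auto simp: pl_cancel sp\<close>)
    finally show "(\<integral>\<^sup>+x. indicator A x * indicator B (pl (mi x) y) \<partial>N) = \<dots>" .
  qed
  also have "\<dots> = (\<integral>\<^sup>+x. \<integral>\<^sup>+y. indicator A (pl y x) * indicator B (mi x) \<partial>M \<partial>N)"
    by (rule P.Fubini') measurable
  also have "\<dots> = (\<integral>\<^sup>+x. emeasure M A * indicator B (mi x) \<partial>N)"
  proof (rule nn_integral_cong)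
    fix x assume "x \<in> space N"
    then have x: "x \<in> space M" by (simp add: sp)
    have [measurable]: "(\<lambda>y. pl y x) \<in> M \<rightarrow>\<^sub>M M" by (intro pl_measurable') (use x in auto)
    have "(\<integral>\<^sup>+y. indicator A (pl y x) * indicator B (mi x) \<partial>M) =
      (\<integral>\<^sup>+y. indicator A (pl y x) \<partial>M) * indicator B (mi x)"
      by (rule nn_integral_multc) measurable
    also have "(\<integral>\<^sup>+y. indicator A (pl y x) \<partial>M) = (\<integral>\<^sup>+y. indicator A (pl x y) \<partial>M)"
      by (intro nn_integral_cong) (use x in \<open>auto simp: pl_comm\<close>)
    also have "\<dots> = emeasure M A"
      using nn_integral_translate[of "indicator A" x] x by simp
    finally show "(\<integral>\<^sup>+y. indicator A (pl y x) * indicator B (mi x) \<partial>M) =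
      emeasure M A * indicator B (mi x)" .
  qed
  also have "\<dots> = emeasure M A * (\<integral>\<^sup>+x. indicator (mi -` B \<inter> space M) x \<partial>N)"
    by (subst nn_integral_cmult[symmetric]) (auto intro!: nn_integral_cong simp: sp split: split_indicator)
  also have "\<dots> = emeasure M A * emeasure N (mi -` B \<inter> space M)"
    by (subst nn_integral_indicator) measurable
  finally show ?thesis .
qed

text \<open>Z has the same measure as each of its translates. Averaging over the translations by
  \<open>e t\<close> with t in [0,1] and exchanging the integrals leaves the measure of the set of t
  with e t + y in Z, which vanishes for every y.\<close>

lemma null_set_if_null_on_lines:
  fixes e :: "real \<Rightarrow> 'a"
  assumes [measurable]: "Z \<in> sets M" "e \<in> borel \<rightarrow>\<^sub>M M"
    and line: "\<And>y. y \<in> space M \<Longrightarrow> AE t in lborel. pl (e t) y \<notin> Z"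
  shows "emeasure M Z = 0"
proof -
  interpret P: pair_sigma_finite lborel M by standard
  note [measurable (raw)] = pl_measurable'
  have e: "e t \<in> space M" for t using measurable_space[OF assms(2)] by simp
  have "emeasure M Z * emeasure lborel {0..1::real} =
      (\<integral>\<^sup>+t. \<integral>\<^sup>+y. indicator Z y * indicator {0..1::real} t \<partial>M \<partial>lborel)"
    by (simp add: nn_integral_cmult_indicator nn_integral_multc)
  also have "\<dots> = (\<integral>\<^sup>+t. \<integral>\<^sup>+y. indicator Z (pl (e t) y) * indicator {0..1} t \<partial>M \<partial>lborel)"
    by (intro nn_integral_cong nn_integral_translate[symmetric, where f = "\<lambda>y. indicator Z y * indicator {0..1} _"])
       (auto simp: e)
  also have "\<dots> = (\<integral>\<^sup>+y. \<integral>\<^sup>+t. indicator Z (pl (e t) y) * indicator {0..1} t \<partial>lborel \<partial>M)"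
    by (rule P.Fubini'[symmetric]) measurable
  also have "\<dots> = (\<integral>\<^sup>+y. 0 \<partial>M)"
  proof (rule nn_integral_cong)
    fix y assume y: "y \<in> space M"
    show "(\<integral>\<^sup>+t. indicator Z (pl (e t) y) * indicator {0..1} t \<partial>lborel) = 0"
      using line[OF y] by (subst nn_integral_0_iff_AE) (use y in \<open>auto simp: indicator_def elim: eventually_mono\<close>)
  qed
  finally show ?thesis by simp
qed

end

locale translation_iso = M: translation_group M plM miM + N: translation_group N plN miN
  for M :: "'a measure" and plM miM and N :: "'b measure" and plN miN +
  fixes L :: "'a \<Rightarrow> 'b" and K :: "'b \<Rightarrow> 'a"
  assumes L_measurable [measurable]: "L \<in> M \<rightarrow>\<^sub>M N"
    and K_measurable [measurable]: "K \<in> N \<rightarrow>\<^sub>M M"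
    and K_L: "x \<in> space M \<Longrightarrow> K (L x) = x"
    and L_K: "z \<in> space N \<Longrightarrow> L (K z) = z"
    and L_pl: "x \<in> space M \<Longrightarrow> y \<in> space M \<Longrightarrow> L (plM x y) = plN (L x) (L y)"
begin

text \<open>Uniqueness of translation invariant measures: the image of M under L is invariant on N,
  hence a multiple of N. The factor stands in for the inverse Jacobian determinant and is left
  unspecified; positivity and finiteness suffice for cancelling it.\<close>

lemma emeasure_vimage_proportional:
  obtains c where "0 < c" "c < \<infinity>"
    "\<And>A. A \<in> sets N \<Longrightarrow> emeasure M (L -` A \<inter> space M) = c * emeasure N A"
proof -
  define \<mu> where "\<mu> = distr M N L"
  have sets_\<mu> [measurable_cong, simp]: "sets \<mu> = sets N" and space_\<mu> [simp]: "space \<mu> = space N"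
    by (simp_all add: \<mu>_def)
  \<comment> \<open>Sigma-finiteness of the image \<open>\<mu>\<close> is not automatic; it is
    inherited because the image of \<open>\<mu>\<close> under K is M again.\<close>
  have "distr \<mu> M K = distr M M (K \<circ> L)"
    unfolding \<mu>_def by (rule distr_distr) auto
  also have "\<dots> = distr M M (\<lambda>x. x)"
    by (rule distr_cong) (auto simp: K_L)
  finally have "distr \<mu> M K = distr M M (\<lambda>x. x)" .
  then have "sigma_finite_measure (distr \<mu> M K)"
    using M.sigma_finite_measure_axioms by (simp add: distr_id2)
  then have sf: "sigma_finite_measure \<mu>" by (rule sigma_finite_measure_distr) simp
  have inv: "distr \<mu> \<mu> (plN y) = \<mu>" if y: "y \<in> space N" for y
  proof -
    have [measurable]: "plN y \<in> N \<rightarrow>\<^sub>M N" by (intro N.pl_measurable') (use y in auto)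
    have Ky: "K y \<in> space M" using y by (rule measurable_space[OF K_measurable])
    have [measurable]: "plM (K y) \<in> M \<rightarrow>\<^sub>M M" by (intro M.pl_measurable') (use Ky in auto)
    have "distr \<mu> \<mu> (plN y) = distr M N (\<lambda>x. plN y (L x))"
      unfolding \<mu>_def by (subst distr_distr) (auto intro!: distr_cong)
    also have "\<dots> = distr M N (\<lambda>x. L (plM (K y) x))"
      by (intro distr_cong) (use y Ky in \<open>auto simp: L_pl L_K\<close>)
    also have "\<dots> = distr (distr M M (plM (K y))) N L"
      by (subst distr_distr) (auto simp: comp_def)
    also have "\<dots> = \<mu>" by (simp add: M.distr_pl[OF Ky] \<mu>_def)
    finally show ?thesis .
  qed
  \<comment> \<open>\<open>\<nu>\<close> is the reflection of \<open>\<mu>\<close>. The swap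
    identity then reads \<mu>(A) N(B) = N(A) \<nu>(B), and a single suitable B determines the factor
    as c = \<nu>(B) / N(B).\<close>
  define \<nu> where "\<nu> = distr \<mu> N miN"
  have [simp, measurable_cong]: "sets \<nu> = sets N" "space \<nu> = space N" by (simp_all add: \<nu>_def)
  have "distr \<nu> N miN = distr \<mu> N (miN \<circ> miN)"
    unfolding \<nu>_def by (rule distr_distr) auto
  also have "\<dots> = distr \<mu> \<mu> (\<lambda>x. x)"
    by (rule distr_cong) (auto simp: N.mi_mi)
  finally have "distr \<nu> N miN = distr \<mu> \<mu> (\<lambda>x. x)" .
  then have "sigma_finite_measure (distr \<nu> N miN)" using sf by (simp add: distr_id2)
  then have sf': "sigma_finite_measure \<nu>" by (rule sigma_finite_measure_distr) simp
  have swap: "emeasure \<mu> A * emeasure N B = emeasure N A * emeasure \<nu> B"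
    if "A \<in> sets N" "B \<in> sets N" for A B
    using N.invariant_measure_swap[OF sf sets_\<mu> inv that] that by (simp add: \<nu>_def emeasure_distr)
  obtain C :: "nat \<Rightarrow> _" where C: "range C \<subseteq> sets N" "(\<Union>i. C i) = space N" "\<And>i. emeasure N (C i) \<noteq> \<infinity>"
    using N.sigma_finite_cover by blast
  obtain D :: "nat \<Rightarrow> _" where D: "range D \<subseteq> sets N" "(\<Union>i. D i) = space N" "\<And>i. emeasure \<nu> (D i) \<noteq> \<infinity>"
    using sigma_finite_measure.sigma_finite_cover[OF sf'] by auto
  \<comment> \<open>The set B has to be non-null for N and of finite measure for both N and
    \<open>\<nu>\<close>; an intersection of members of the two covers provides it.\<close>
  have "\<exists>i j. emeasure N (C i \<inter> D j) \<noteq> 0"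
  proof (rule ccontr)
    assume "\<not> ?thesis"
    then have "(\<Union>i. \<Union>j. C i \<inter> D j) \<in> null_sets N"
      using C(1) D(1) by (intro null_sets_UN) (auto simp: null_sets_def)
    moreover have "(\<Union>i. \<Union>j. C i \<inter> D j) = space N" using C(2) D(2) by auto
    ultimately show False using N.space_nonnull by auto
  qed
  then obtain i j where ij: "emeasure N (C i \<inter> D j) \<noteq> 0" by auto
  define B where "B = C i \<inter> D j"
  have B [measurable]: "B \<in> sets N" using C(1) D(1) by (auto simp: B_def)
  have N_B: "emeasure N B \<noteq> 0" "emeasure N B \<noteq> \<infinity>"
    using ij emeasure_mono[of B "C i" N] C by (auto simp: B_def top_unique)
  have \<nu>_B: "emeasure \<nu> B \<noteq> \<infinity>"
    using emeasure_mono[of B "D j" \<nu>] D by (auto simp: B_def top_unique)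
  define c where "c = emeasure \<nu> B / emeasure N B"
  have \<mu>_eq: "emeasure \<mu> A = c * emeasure N A" if A: "A \<in> sets N" for A
  proof -
    have "emeasure \<mu> A = emeasure \<mu> A * emeasure N B / emeasure N B"
      using N_B by (simp add: ennreal_divide_times mult_divide_eq_ennreal)
    also have "\<dots> = emeasure N A * emeasure \<nu> B / emeasure N B"
      by (simp only: swap[OF A B])
    also have "\<dots> = c * emeasure N A"
      by (simp add: c_def ennreal_times_divide mult.commute)
    finally show ?thesis .
  qed
  have "emeasure \<mu> (space N) \<noteq> 0"
  proof -
    have "emeasure \<mu> (space N) = emeasure M (space M)"
      unfolding \<mu>_def by (subst emeasure_distr) (auto intro!: arg_cong[where f="emeasure M"] dest: measurable_space[OF L_measurable])
    then show ?thesis using M.space_nonnull by simp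
  qed
  then have "c \<noteq> 0" using \<mu>_eq[of "space N"] by auto
  moreover have "c \<noteq> \<infinity>" using N_B \<nu>_B by (auto simp: c_def ennreal_divide_eq_top_iff)
  ultimately show thesis
    using \<mu>_eq by (intro that[of c]) (auto simp: \<mu>_def emeasure_distr top.not_eq_extremum zero_less_iff_neq_zero)
qed

lemma nn_integral_comp_proportional:
  obtains c where "0 < c" "c < \<infinity>"
    "\<And>f. f \<in> borel_measurable N \<Longrightarrow> (\<integral>\<^sup>+x. f (L x) \<partial>M) = c * (\<integral>\<^sup>+y. f y \<partial>N)"
proof -
  obtain c where c: "0 < c" "c < \<infinity>"
    "\<And>A. A \<in> sets N \<Longrightarrow> emeasure M (L -` A \<inter> space M) = c * emeasure N A"
    by (rule emeasure_vimage_proportional) blast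
  have "distr M N L = scale_measure c N"
    by (rule measure_eqI) (auto simp: emeasure_distr c)
  then have "(\<integral>\<^sup>+x. f (L x) \<partial>M) = c * (\<integral>\<^sup>+y. f y \<partial>N)" if "f \<in> borel_measurable N" for f
    using that nn_integral_distr[OF L_measurable, of f] by (simp add: nn_integral_scale_measure)
  with c show thesis by (intro that) auto
qed

end

text \<open>Applying L twice to a set of positive finite measure m gives m = c c m for the
  proportionality factor c, so c = 1. In this way reflections are seen to preserve the measure
  without a determinant.\<close>

lemma (in translation_group) nn_integral_involution:
  assumes L [measurable]: "L \<in> M \<rightarrow>\<^sub>M M" and LL: "\<And>x. x \<in> space M \<Longrightarrow> L (L x) = x"
    and L_pl: "\<And>x y. x \<in> space M \<Longrightarrow> y \<in> space M \<Longrightarrow> L (pl x y) = pl (L x) (L y)"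
    and f: "f \<in> borel_measurable M"
  shows "(\<integral>\<^sup>+x. f (L x) \<partial>M) = (\<integral>\<^sup>+x. f x \<partial>M)"
proof -
  interpret I: translation_iso M pl mi M pl mi L L
    by unfold_locales (use assms in auto)
  obtain c where c: "0 < c" "c < \<infinity>"
    "\<And>f. f \<in> borel_measurable M \<Longrightarrow> (\<integral>\<^sup>+x. f (L x) \<partial>M) = c * (\<integral>\<^sup>+y. f y \<partial>M)"
    by (rule I.nn_integral_comp_proportional) blast
  obtain C :: "nat \<Rightarrow> _" where C: "range C \<subseteq> sets M" "(\<Union>i. C i) = space M" "\<And>i. emeasure M (C i) \<noteq> \<infinity>"
    using sigma_finite_cover by blast
  have "\<exists>i. emeasure M (C i) \<noteq> 0"
  proof (rule ccontr)
    assume "\<not> ?thesis"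
    then have "(\<Union>i. C i) \<in> null_sets M"
      using C(1) by (intro null_sets_UN) (auto simp: null_sets_def)
    then show False using space_nonnull C(2) by auto
  qed
  then obtain i where i: "emeasure M (C i) \<noteq> 0" by auto
  have Ci [measurable]: "C i \<in> sets M" using C by auto
  define m where "m = emeasure M (C i)"
  have "m = (\<integral>\<^sup>+x. indicator (C i) (L (L x)) \<partial>M)"
    by (subst nn_integral_cong[where v = "indicator (C i)"]) (auto simp: LL m_def)
  also have "\<dots> = c * (\<integral>\<^sup>+x. indicator (C i) (L x) \<partial>M)" by (rule c(3)) measurable
  also have "(\<integral>\<^sup>+x. indicator (C i) (L x) \<partial>M) = c * m" by (subst c(3)) (auto simp: m_def)
  finally have eq: "m = c * (c * m)" .
  obtain c' where c': "c = ennreal c'" "c' > 0" using c by (cases c) auto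
  obtain m' where m': "m = ennreal m'" "m' > 0"
    using i C(3)[of i] by (cases m) (auto simp: m_def zero_less_iff_neq_zero)
  have "ennreal m' = ennreal c' * (ennreal c' * ennreal m')"
    using eq unfolding c'(1) m'(1) .
  also have "\<dots> = ennreal (c' * (c' * m'))" using c' m' by (simp add: ennreal_mult')
  finally have "m' = c' * (c' * m')" using c' m' by (subst (asm) ennreal_inj) auto
  then have "c' * c' = 1" using m'(2) by (metis mult.assoc mult_cancel_right2 less_irrefl)
  then have "c' = 1" using c' by (auto simp: power2_eq_square[symmetric] power2_eq_1_iff)
  then show ?thesis using c(3)[OF f] c' by simp
qed

lemma translation_group_lborel: "translation_group (lborel :: real measure) (+) uminus"
proof
  show "distr lborel lborel ((+) x) = lborel" for x :: real
    using lborel_distr_plus[of x] by (simp cong: distr_cong)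
  show "emeasure (lborel :: real measure) (space lborel) \<noteq> 0" by simp
  show "(\<lambda>p. fst p + snd p) \<in> lborel \<Otimes>\<^sub>M lborel \<rightarrow>\<^sub>M (lborel :: real measure)" by measurable
  show "uminus \<in> lborel \<rightarrow>\<^sub>M (lborel :: real measure)" by simp
qed auto

text \<open>Invariance is tested on boxes, where it reduces to the factors. The lemma serves on two
  levels: for the coordinates of one point and for the tuple of all points.\<close>

lemma translation_group_PiM:
  fixes I :: "'i set"
  assumes "translation_group M pl mi" and I: "finite I"
  shows "translation_group (PiM I (\<lambda>_. M)) (\<lambda>x y. \<lambda>i\<in>I. pl (x i) (y i)) (\<lambda>x. \<lambda>i\<in>I. mi (x i))"
proof -
  interpret M: translation_group M pl mi by fact
  interpret P: product_sigma_finite "\<lambda>_::'i. M" by standard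
  interpret F: finite_product_sigma_finite "\<lambda>_::'i. M" I by standard fact
  note [measurable (raw)] = M.pl_measurable'
  let ?P = "PiM I (\<lambda>_. M)"
  show ?thesis
  proof
    show "(\<lambda>p. \<lambda>i\<in>I. pl (fst p i) (snd p i)) \<in> ?P \<Otimes>\<^sub>M ?P \<rightarrow>\<^sub>M ?P" by measurable
    show "(\<lambda>x. \<lambda>i\<in>I. mi (x i)) \<in> ?P \<rightarrow>\<^sub>M ?P" by measurable
    show "emeasure ?P (space ?P) \<noteq> 0"
      using M.space_nonnull I by (simp add: space_PiM P.emeasure_PiM)
  next
    fix x assume x: "x \<in> space ?P"
    have [measurable]: "pl (x i) \<in> M \<rightarrow>\<^sub>M M" if "i \<in> I" for i
      by (intro M.pl_measurable' measurable_const) (use x that in \<open>auto simp: space_PiM\<close>)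
    have [measurable]: "(\<lambda>y. \<lambda>i\<in>I. pl (x i) (y i)) \<in> ?P \<rightarrow>\<^sub>M ?P"
    proof (rule measurable_restrict)
      fix i assume "i \<in> I"
      then show "(\<lambda>y. pl (x i) (y i)) \<in> ?P \<rightarrow>\<^sub>M M"
        by (intro measurable_compose[OF measurable_component_singleton]) auto
    qed
    have "?P = distr ?P ?P (\<lambda>y. \<lambda>i\<in>I. pl (x i) (y i))"
    proof (rule P.PiM_eqI[symmetric, OF I])
      fix A assume A: "\<And>i. i \<in> I \<Longrightarrow> A i \<in> sets M"
      have "(\<lambda>y. \<lambda>i\<in>I. pl (x i) (y i)) -` (Pi\<^sub>E I A) \<inter> space ?P = Pi\<^sub>E I (\<lambda>i. pl (x i) -` A i \<inter> space M)"
        by (auto simp: space_PiM PiE_def Pi_def extensional_def)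
      then have "emeasure (distr ?P ?P (\<lambda>y. \<lambda>i\<in>I. pl (x i) (y i))) (Pi\<^sub>E I A) =
        (\<Prod>i\<in>I. emeasure M (pl (x i) -` A i \<inter> space M))"
        using A I by (subst emeasure_distr) (auto intro!: P.emeasure_PiM sets_PiM_I_finite measurable_sets[of _ M M])
      also have "\<dots> = (\<Prod>i\<in>I. emeasure (distr M M (pl (x i))) (A i))"
        by (intro prod.cong refl emeasure_distr[symmetric]) (use A in auto)
      also have "\<dots> = (\<Prod>i\<in>I. emeasure M (A i))"
        by (intro prod.cong refl, subst M.distr_pl) (use x in \<open>auto simp: space_PiM\<close>)
      finally show "emeasure (distr ?P ?P (\<lambda>y. \<lambda>i\<in>I. pl (x i) (y i))) (Pi\<^sub>E I A) = (\<Prod>i\<in>I. emeasure M (A i))" .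
    qed simp
    then show "distr ?P ?P (\<lambda>y. \<lambda>i\<in>I. pl (x i) (y i)) = ?P" by simp
  qed (auto simp: space_PiM PiE_iff M.pl_cancel M.mi_mi intro!: M.pl_comm extensionalityI[of _ I] restrict_ext)
qed

section \<open>Weights and the tangent cone\<close>

text \<open>The vectors \<open>wsum d X w\<close> with \<open>w\<close> in \<open>face_cone d k\<close> form the tangent cone of the simplex at the face
  spanned by \<open>X 0, \<dots>, X (k - 1)\<close>: \<open>w i\<close> is the weight of \<open>X (Suc i)\<close>, and \<open>full_weight\<close> adds the weight of
  \<open>X 0\<close>, which is free because \<open>1 \<le> k\<close>.\<close>

definition full_weight :: "nat \<Rightarrow> (nat \<Rightarrow> real) \<Rightarrow> nat \<Rightarrow> real" where
  "full_weight d w j = (case j of 0 \<Rightarrow> - (\<Sum>i<d. w i) | Suc i \<Rightarrow> w i)"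

definition wsum :: "nat \<Rightarrow> (nat \<Rightarrow> nat \<Rightarrow> real) \<Rightarrow> (nat \<Rightarrow> real) \<Rightarrow> nat \<Rightarrow> real" where
  "wsum d X w = (\<lambda>i\<in>{..<d}. \<Sum>j<Suc d. full_weight d w j * X j i)"

definition face_cone :: "nat \<Rightarrow> nat \<Rightarrow> (nat \<Rightarrow> real) set" where
  "face_cone d k = {w \<in> space (lebesgue_d d). \<forall>j<d. k \<le> Suc j \<longrightarrow> 0 \<le> w j}"

text \<open>The columns are the edges from \<open>X 0\<close>, so this is the determinant of the
  linear map \<open>wsum d X\<close> in the free weights. It is nonzero exactly when the points are
  affinely independent.\<close>

definition edge_det :: "nat \<Rightarrow> (nat \<Rightarrow> nat \<Rightarrow> real) \<Rightarrow> real" where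
  "edge_det d X = Determinant.det (mat d d (\<lambda>(i, j). X (Suc j) i - X 0 i))"

section \<open>Coordinates, weights and Lebesgue measure\<close>

lemma full_weight_simps [simp]:
  "full_weight d w 0 = - (\<Sum>i<d. w i)" "full_weight d w (Suc i) = w i"
  by (simp_all add: full_weight_def)

lemma sum_full_weight: "(\<Sum>j<Suc d. full_weight d w j) = 0"
  by (simp add: sum.lessThan_Suc_shift del: sum.lessThan_Suc)

lemma wsum_nth: "i < d \<Longrightarrow> wsum d X w i = (\<Sum>j<d. w j * (X (Suc j) i - X 0 i))"
  by (simp add: wsum_def sum.lessThan_Suc_shift sum_subtractf sum_distrib_right right_diff_distrib
      del: sum.lessThan_Suc)

lemma space_lebesgue_d: "space (lebesgue_d d) = {..<d} \<rightarrow>\<^sub>E UNIV"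
  by (simp add: lebesgue_d_def space_PiM)

lemma lebesgue_d_eqI:
  "x \<in> space (lebesgue_d d) \<Longrightarrow> y \<in> space (lebesgue_d d) \<Longrightarrow> (\<And>i. i < d \<Longrightarrow> x i = y i) \<Longrightarrow> x = y"
  by (rule extensionalityI[of _ "{..<d}"]) (auto simp: space_lebesgue_d PiE_def)

abbreviation add_d :: "nat \<Rightarrow> (nat \<Rightarrow> real) \<Rightarrow> (nat \<Rightarrow> real) \<Rightarrow> nat \<Rightarrow> real" where
  "add_d d \<equiv> \<lambda>x y. \<lambda>i\<in>{..<d}. x i + y i"

abbreviation neg_d :: "nat \<Rightarrow> (nat \<Rightarrow> real) \<Rightarrow> nat \<Rightarrow> real" where
  "neg_d d \<equiv> \<lambda>x. \<lambda>i\<in>{..<d}. - x i"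

abbreviation points :: "nat \<Rightarrow> (nat \<Rightarrow> nat \<Rightarrow> real) measure" where
  "points d \<equiv> PiM {..<Suc d} (\<lambda>_. lebesgue_d d)"

abbreviation add_points :: "nat \<Rightarrow> (nat \<Rightarrow> nat \<Rightarrow> real) \<Rightarrow> (nat \<Rightarrow> nat \<Rightarrow> real) \<Rightarrow> nat \<Rightarrow> nat \<Rightarrow> real" where
  "add_points d \<equiv> \<lambda>X Y. \<lambda>j\<in>{..<Suc d}. \<lambda>i\<in>{..<d}. X j i + Y j i"

abbreviation neg_points :: "nat \<Rightarrow> (nat \<Rightarrow> nat \<Rightarrow> real) \<Rightarrow> nat \<Rightarrow> nat \<Rightarrow> real" where
  "neg_points d \<equiv> \<lambda>X. \<lambda>j\<in>{..<Suc d}. \<lambda>i\<in>{..<d}. - X j i"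

interpretation lebesgue_d: translation_group "lebesgue_d d" "add_d d" "neg_d d" for d
  unfolding lebesgue_d_def by (rule translation_group_PiM[OF translation_group_lborel]) simp

interpretation points: translation_group "points d" "add_points d" "neg_points d" for d
  by (rule translation_group_PiM[OF lebesgue_d.translation_group_axioms]) simp

lemma measurable_lebesgue_d_nth [measurable (raw)]:
  "f \<in> M \<rightarrow>\<^sub>M lebesgue_d d \<Longrightarrow> i < d \<Longrightarrow> (\<lambda>x. f x i) \<in> borel_measurable M"
  unfolding lebesgue_d_def
  using measurable_compose[OF _ measurable_component_singleton[of i "{..<d}" "\<lambda>_. lborel"]] by auto

lemma measurable_lebesgue_dI [measurable (raw)]:
  "(\<And>i. i < d \<Longrightarrow> (\<lambda>x. f x i) \<in> borel_measurable M) \<Longrightarrow> (\<lambda>x. \<lambda>i\<in>{..<d}. f x i) \<in> M \<rightarrow>\<^sub>M lebesgue_d d"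
  unfolding lebesgue_d_def by (rule measurable_restrict) auto

lemma full_weight_measurable [measurable (raw)]:
  assumes [measurable]: "f \<in> M \<rightarrow>\<^sub>M lebesgue_d d" and "j < Suc d"
  shows "(\<lambda>x. full_weight d (f x) j) \<in> borel_measurable M"
proof (cases j)
  case 0
  then show ?thesis by simp measurable
next
  case (Suc i)
  with assms(2) show ?thesis by simp measurable
qed

lemma wsum_measurable [measurable (raw)]:
  assumes [measurable]: "f \<in> M \<rightarrow>\<^sub>M points d" "g \<in> M \<rightarrow>\<^sub>M lebesgue_d d"
  shows "(\<lambda>x. wsum d (f x) (g x)) \<in> M \<rightarrow>\<^sub>M lebesgue_d d"
proof -
  have [measurable]: "(\<lambda>x. f x j i) \<in> borel_measurable M" if "j < Suc d" "i < d" for j i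
  proof -
    have "(\<lambda>x. f x j) \<in> M \<rightarrow>\<^sub>M lebesgue_d d"
      using measurable_compose[OF assms(1) measurable_component_singleton[of j]] that by auto
    then show ?thesis using that by measurable
  qed
  show ?thesis unfolding wsum_def
    by (intro measurable_lebesgue_dI borel_measurable_sum borel_measurable_times full_weight_measurable) auto
qed

lemma wsum_measurable_fixed [measurable]: "wsum d X \<in> lebesgue_d d \<rightarrow>\<^sub>M lebesgue_d d"
  unfolding wsum_def
  by (intro measurable_lebesgue_dI borel_measurable_sum borel_measurable_times full_weight_measurable) auto

lemma norm_d_measurable [measurable (raw)]:
  "f \<in> M \<rightarrow>\<^sub>M lebesgue_d d \<Longrightarrow> (\<lambda>x. norm_d d (f x)) \<in> borel_measurable M"
proof -
  assume [measurable]: "f \<in> M \<rightarrow>\<^sub>M lebesgue_d d"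
  have [measurable]: "(\<lambda>x. f x i) \<in> borel_measurable M" if "i \<in> {..<d}" for i
    using that by (intro measurable_lebesgue_d_nth[of f M d]) auto
  show ?thesis unfolding norm_d_def by measurable
qed

lemma face_cone_measurable [measurable]: "face_cone d k \<in> sets (lebesgue_d d)"
  unfolding face_cone_def by measurable

lemma norm_d_scale: "norm_d d (\<lambda>i. r * x i) = \<bar>r\<bar> * norm_d d x"
  by (simp add: norm_d_def power_mult_distrib sum_distrib_left[symmetric] real_sqrt_mult)

lemma norm_d_cong: "(\<And>i. i < d \<Longrightarrow> x i = y i) \<Longrightarrow> norm_d d x = norm_d d y"
  by (simp add: norm_d_def)

lemma abs_nth_le_norm_d: "i < d \<Longrightarrow> \<bar>x i\<bar> \<le> norm_d d x"
  unfolding norm_d_def by (rule real_le_rsqrt) (auto intro!: member_le_sum[of i "{..<d}" "\<lambda>i. (x i)\<^sup>2"])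

lemma wsum_scale: "wsum d X (\<lambda>i\<in>{..<d}. r * w i) = (\<lambda>i\<in>{..<d}. r * wsum d X w i)"
proof (rule extensionalityI[of _ "{..<d}"])
  show "wsum d X (\<lambda>i\<in>{..<d}. r * w i) i = (\<lambda>i\<in>{..<d}. r * wsum d X w i) i" if "i \<in> {..<d}" for i
    using that by (simp add: wsum_nth sum_distrib_left mult.assoc)
qed (auto simp: wsum_def)

lemma emeasure_ball_d_origin:
  "0 < emeasure (lebesgue_d d) {x \<in> space (lebesgue_d d). norm_d d x < 1}"
  "emeasure (lebesgue_d d) {x \<in> space (lebesgue_d d). norm_d d x < 1} < \<infinity>"
proof -
  let ?B = "{x \<in> space (lebesgue_d d). norm_d d x < 1}"
  interpret product_sigma_finite "\<lambda>_::nat. lborel :: real measure" by standard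
  \<comment> \<open>With this half-width d h^2 < 1, so the cube lies in the open unit ball; the
    added 1 also covers d = 0.\<close>
  define h where "h = 1 / (real d + 1)"
  have "real d < (real d + 1)\<^sup>2"
    by (simp add: power2_eq_square algebra_simps add_pos_nonneg)
  then have h: "h > 0" "real d * h\<^sup>2 < 1"
    by (auto simp: h_def power_divide)
  have box: "emeasure (lebesgue_d d) (Pi\<^sub>E {..<d} (\<lambda>_. {-a..a})) = ennreal (2 * a) ^ d" if "a \<ge> 0" for a
    unfolding lebesgue_d_def using that by (subst emeasure_PiM) auto
  have "Pi\<^sub>E {..<d} (\<lambda>_. {-h..h}) \<subseteq> ?B"
  proof safe
    fix x assume x: "x \<in> Pi\<^sub>E {..<d} (\<lambda>_. {-h..h})"
    then show "x \<in> space (lebesgue_d d)" by (auto simp: space_lebesgue_d PiE_iff)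
    have "(\<Sum>i<d. (x i)\<^sup>2) \<le> (\<Sum>i<d. h\<^sup>2)"
    proof (rule sum_mono)
      fix i assume "i \<in> {..<d}"
      then have "\<bar>x i\<bar> \<le> h" using x by (auto simp: PiE_iff abs_le_iff minus_le_iff)
      then show "(x i)\<^sup>2 \<le> h\<^sup>2" by (metis abs_le_square_iff abs_of_pos h(1))
    qed
    also have "\<dots> < 1" using h by simp
    finally show "norm_d d x < 1" by (simp add: norm_d_def)
  qed
  then have "emeasure (lebesgue_d d) (Pi\<^sub>E {..<d} (\<lambda>_. {-h..h})) \<le> emeasure (lebesgue_d d) ?B"
    by (rule emeasure_mono) measurable
  moreover have "0 < ennreal (2 * h) ^ d" using h by (simp add: ennreal_power)
  ultimately show "0 < emeasure (lebesgue_d d) ?B" using box[of h] h by (simp add: order_less_le_trans)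
  have "?B \<subseteq> Pi\<^sub>E {..<d} (\<lambda>_. {-1..1})"
  proof
    fix x assume "x \<in> ?B"
    then have x: "x \<in> space (lebesgue_d d)" "norm_d d x < 1" by auto
    have "- 1 \<le> x i \<and> x i \<le> 1" if "i < d" for i
      using abs_nth_le_norm_d[OF that, of x] x(2) by (simp add: abs_le_iff)
    then show "x \<in> Pi\<^sub>E {..<d} (\<lambda>_. {-1..1})" using x(1) by (auto simp: space_lebesgue_d PiE_iff)
  qed
  moreover have "Pi\<^sub>E {..<d} (\<lambda>_. {-1..1}) \<in> sets (lebesgue_d d)"
    unfolding lebesgue_d_def by (rule sets_PiM_I_finite) auto
  ultimately have "emeasure (lebesgue_d d) ?B \<le> emeasure (lebesgue_d d) (Pi\<^sub>E {..<d} (\<lambda>_. {-1..1}))"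
    by (rule emeasure_mono)
  also have "\<dots> < \<infinity>" by (subst box) (auto simp: ennreal_power[symmetric] power_less_top_ennreal)
  finally show "emeasure (lebesgue_d d) ?B < \<infinity>" .
qed

text \<open>The inverse matrix as a plain function: \<open>C j i\<close> is the coefficient of
  coordinate i in the weight of \<open>X (Suc j)\<close>. Both one-sided identities are recorded,
  one for each order of composition with \<open>wsum d X\<close>.\<close>

lemma edge_inverse:
  assumes "edge_det d X \<noteq> 0"
  shows "\<exists>C. (\<forall>j<d. \<forall>l<d. (\<Sum>i<d. C j i * (X (Suc l) i - X 0 i)) = (if j = l then 1 else 0)) \<and>
    (\<forall>i<d. \<forall>m<d. (\<Sum>j<d. (X (Suc j) i - X 0 i) * C j m) = (if i = m then 1 else 0))"
proof -
  define A where "A = mat d d (\<lambda>(i, j). X (Suc j) i - X 0 i)"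
  have A: "A \<in> carrier_mat d d" by (simp add: A_def)
  obtain B where B: "B \<in> carrier_mat d d" "A * B = 1\<^sub>m d" "B * A = 1\<^sub>m d"
    using det_non_zero_imp_unit[OF A, of "()"] assms
    by (auto simp: Units_def ring_mat_def edge_det_def A_def)
  have 1: "(\<Sum>i<d. B $$ (j, i) * (X (Suc l) i - X 0 i)) = (if j = l then 1 else 0)" if "j < d" "l < d" for j l
  proof -
    have "(B * A) $$ (j, l) = (\<Sum>i = 0..<d. B $$ (j, i) * A $$ (i, l))"
      using A B(1) that by (simp add: scalar_prod_def)
    then have "(\<Sum>i = 0..<d. B $$ (j, i) * A $$ (i, l)) = 1\<^sub>m d $$ (j, l)" using B by simp
    then show ?thesis using that by (simp add: A_def atLeast0LessThan)
  qed
  have 2: "(\<Sum>j<d. (X (Suc j) i - X 0 i) * B $$ (j, m)) = (if i = m then 1 else 0)" if "i < d" "m < d" for i m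
  proof -
    have "(A * B) $$ (i, m) = (\<Sum>j = 0..<d. A $$ (i, j) * B $$ (j, m))"
      using A B(1) that by (simp add: scalar_prod_def)
    then have "(\<Sum>j = 0..<d. A $$ (i, j) * B $$ (j, m)) = 1\<^sub>m d $$ (i, m)" using B by simp
    then show ?thesis using that by (simp add: A_def atLeast0LessThan)
  qed
  from 1 2 show ?thesis by (intro exI[of _ "\<lambda>j i. B $$ (j, i)"]) blast
qed

text \<open>A kernel vector of the transposed edge matrix. Geometrically a is normal to a hyperplane
  that contains all the points.\<close>

lemma edge_annihilator:
  assumes "edge_det d X = 0"
  shows "\<exists>a. (\<exists>i<d. a i \<noteq> 0) \<and> (\<forall>j<d. (\<Sum>i<d. a i * (X (Suc j) i - X 0 i)) = 0)"
proof -
  define A where "A = mat d d (\<lambda>(j, i). X (Suc j) i - X 0 i)"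
  have A: "A \<in> carrier_mat d d" by (simp add: A_def)
  have "A = transpose_mat (mat d d (\<lambda>(i, j). X (Suc j) i - X 0 i))"
    by (rule eq_matI) (auto simp: A_def)
  then have "Determinant.det A = 0"
    using assms Determinant.det_transpose[of "mat d d (\<lambda>(i, j). X (Suc j) i - X 0 i)" d] by (simp add: edge_det_def)
  then obtain v where v: "v \<in> carrier_vec d" "v \<noteq> 0\<^sub>v d" "A *\<^sub>v v = 0\<^sub>v d"
    using det_0_iff_vec_prod_zero[OF A] by auto
  obtain i where i: "i < d" "vec_index v i \<noteq> 0"
    using v(1,2) by (metis carrier_vecD eq_vecI index_zero_vec(1) index_zero_vec(2))
  have "(\<Sum>i<d. vec_index v i * (X (Suc j) i - X 0 i)) = 0" if "j < d" for j
  proof -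
    have "vec_index (A *\<^sub>v v) j = (\<Sum>i = 0..<d. A $$ (j, i) * vec_index v i)"
      using A v(1) that by (simp add: scalar_prod_def)
    then have "(\<Sum>i = 0..<d. A $$ (j, i) * vec_index v i) = 0" using that v(3) by simp
    then show ?thesis using that by (simp add: A_def atLeast0LessThan mult.commute)
  qed
  with i show ?thesis by (intro exI[of _ "vec_index v"]) blast
qed

text \<open>Moving each \<open>X (Suc i)\<close> by t along the i-th axis adds t times the identity
  to the edge matrix. The zeros are therefore the negatives of its eigenvalues, and these are roots
  of the nonzero characteristic polynomial.\<close>

lemma finite_edge_det_zeros:
  "finite {t. edge_det d (\<lambda>j i. (if j = Suc i then t else 0) + X j i) = 0}"
proof -
  define A where "A = mat d d (\<lambda>(i, j). X (Suc j) i - X 0 i)"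
  have A: "A \<in> carrier_mat d d" by (simp add: A_def)
  have eq: "edge_det d (\<lambda>j i. (if j = Suc i then t else 0) + X j i) = Determinant.det (char_matrix A (- t))" for t
    unfolding edge_det_def
    by (intro arg_cong[where f = Determinant.det] eq_matI) (auto simp: char_matrix_def A_def)
  have "char_poly A \<noteq> 0" using degree_monic_char_poly[OF A] by auto
  then have "finite {x. poly (char_poly A) x = 0}" by (rule poly_roots_finite)
  moreover have "{t. edge_det d (\<lambda>j i. (if j = Suc i then t else 0) + X j i) = 0} =
    uminus -` {x. poly (char_poly A) x = 0}"
    unfolding eq eigenvalue_det[OF A, symmetric] eigenvalue_root_char_poly[OF A] by auto
  ultimately show ?thesis by (simp only:) (rule finite_vimageI, auto simp: inj_def)
qed

lemma edge_det_measurable [measurable]: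
  "edge_det d \<in> borel_measurable (points d)"
proof -
  let ?P = "points d"
  have X [measurable]: "(\<lambda>X. X j i) \<in> borel_measurable ?P" if "j < Suc d" "i < d" for j i
    using measurable_component_singleton[of j "{..<Suc d}" "\<lambda>_. lebesgue_d d"] that
    by (intro measurable_lebesgue_d_nth) auto
  have "(\<lambda>X. edge_det d X) = (\<lambda>X. \<Sum>p\<in>{p. p permutes {0..<d}}. signof p *
      (\<Prod>i = 0..<d. X (Suc (p i)) i - X 0 i))"
  proof
    fix X
    have p: "p i < d" if "p permutes {0..<d}" "i < d" for p i
      using permutes_in_image[OF that(1), of i] that by auto
    show "edge_det d X = (\<Sum>p\<in>{p. p permutes {0..<d}}. signof p *
      (\<Prod>i = 0..<d. X (Suc (p i)) i - X 0 i))"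
      unfolding edge_det_def
      by (subst Determinant.det_def'[of _ d]) (auto intro!: sum.cong prod.cong simp: p)
  qed
  also have "\<dots> \<in> borel_measurable ?P"
  proof (intro borel_measurable_sum borel_measurable_times borel_measurable_const borel_measurable_prod borel_measurable_diff)
    fix p i assume "p \<in> {p. p permutes {0..<d}}" "i \<in> {0..<d}"
    then have "p i < d" "i < d" using permutes_in_image[of p "{0..<d}" i] by auto
    then show "(\<lambda>X. X (Suc (p i)) i) \<in> borel_measurable ?P" "(\<lambda>X. X 0 i) \<in> borel_measurable ?P"
      by (auto intro!: X)
  qed
  finally show ?thesis .
qed

text \<open>Every line along which the edge matrix grows by a multiple of the identity meets the
  degenerate configurations in finitely many points only, so they form a null set.\<close>

lemma AE_edge_det_nonzero: "AE X in points d. edge_det d X \<noteq> 0"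
proof -
  let ?P = "points d"
  define e where "e = (\<lambda>t::real. \<lambda>j\<in>{..<Suc d}. \<lambda>i\<in>{..<d}. if j = Suc i then t else 0)"
  have [measurable]: "e \<in> borel \<rightarrow>\<^sub>M ?P"
    unfolding e_def by (intro measurable_restrict measurable_lebesgue_dI) auto
  have "emeasure ?P {X \<in> space ?P. edge_det d X = 0} = 0"
  proof (rule points.null_set_if_null_on_lines[where e = e])
    fix Y assume "Y \<in> space ?P"
    have "edge_det d (\<lambda>j\<in>{..<Suc d}. \<lambda>i\<in>{..<d}. e t j i + Y j i) =
      edge_det d (\<lambda>j i. (if j = Suc i then t else 0) + Y j i)" for t
      unfolding edge_det_def by (intro arg_cong[where f = Determinant.det] eq_matI) (auto simp: e_def)
    then have "{t. edge_det d (\<lambda>j\<in>{..<Suc d}. \<lambda>i\<in>{..<d}. e t j i + Y j i) = 0} \<in> null_sets lborel"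
      using finite_edge_det_zeros[of d Y] by (simp add: finite_imp_null_set_lborel)
    then show "AE t in lborel. (\<lambda>j\<in>{..<Suc d}. \<lambda>i\<in>{..<d}. e t j i + Y j i) \<notin> {X \<in> space ?P. edge_det d X = 0}"
      by (rule AE_not_in[THEN eventually_mono]) auto
  qed measurable
  then show ?thesis by (intro AE_I[where N = "{X \<in> space ?P. edge_det d X = 0}"]) auto
qed

section \<open>Dilations and the passage from weights to vectors\<close>

lemma translation_iso_scale:
  assumes "r \<noteq> 0"
  shows "translation_iso (lebesgue_d d) (add_d d) (neg_d d)
    (lebesgue_d d) (add_d d) (neg_d d)
    (\<lambda>x. \<lambda>i\<in>{..<d}. r * x i) (\<lambda>x. \<lambda>i\<in>{..<d}. x i / r)"
proof -
  show ?thesis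
  proof
    show "(\<lambda>x. \<lambda>i\<in>{..<d}. r * x i) \<in> lebesgue_d d \<rightarrow>\<^sub>M lebesgue_d d"
      "(\<lambda>x. \<lambda>i\<in>{..<d}. x i / r) \<in> lebesgue_d d \<rightarrow>\<^sub>M lebesgue_d d" by measurable
  qed (use assms in \<open>auto intro!: lebesgue_d_eqI[of _ d] simp: space_lebesgue_d PiE_iff algebra_simps\<close>)
qed

lemma translation_iso_wsum:
  assumes C1: "\<And>j l. j < d \<Longrightarrow> l < d \<Longrightarrow> (\<Sum>i<d. C j i * (X (Suc l) i - X 0 i)) = (if j = l then 1 else 0)"
    and C2: "\<And>i m. i < d \<Longrightarrow> m < d \<Longrightarrow> (\<Sum>j<d. (X (Suc j) i - X 0 i) * C j m) = (if i = m then 1 else 0)"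
  shows "translation_iso (lebesgue_d d) (add_d d) (neg_d d)
    (lebesgue_d d) (add_d d) (neg_d d)
    (wsum d X) (\<lambda>g. \<lambda>j\<in>{..<d}. \<Sum>i<d. C j i * g i)"
proof -
  have ws: "wsum d X w \<in> space (lebesgue_d d)" for w by (auto simp: wsum_def space_lebesgue_d)
  show ?thesis
  proof
    show "(\<lambda>g. \<lambda>j\<in>{..<d}. \<Sum>i<d. C j i * g i) \<in> lebesgue_d d \<rightarrow>\<^sub>M lebesgue_d d"
      by (intro measurable_lebesgue_dI borel_measurable_sum borel_measurable_times borel_measurable_const
          measurable_lebesgue_d_nth[of "\<lambda>x. x" _ d]) auto
  next
    fix w assume w: "w \<in> space (lebesgue_d d)"
    show "(\<lambda>j\<in>{..<d}. \<Sum>i<d. C j i * wsum d X w i) = w"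
    proof (rule lebesgue_d_eqI[of _ d])
      fix j assume j: "j < d"
      have "(\<Sum>i<d. C j i * wsum d X w i) = (\<Sum>i<d. \<Sum>l<d. w l * (C j i * (X (Suc l) i - X 0 i)))"
        by (intro sum.cong refl) (simp add: wsum_nth sum_distrib_left mult_ac)
      also have "\<dots> = (\<Sum>l<d. w l * (\<Sum>i<d. C j i * (X (Suc l) i - X 0 i)))"
        by (subst sum.swap) (simp add: sum_distrib_left)
      also have "\<dots> = w j" using j by (simp add: C1 if_distrib cong: if_cong)
      finally show "(\<lambda>j\<in>{..<d}. \<Sum>i<d. C j i * wsum d X w i) j = w j" using j by simp
    qed (use w in \<open>auto simp: space_lebesgue_d\<close>)
  next
    fix g assume g: "g \<in> space (lebesgue_d d)"
    show "wsum d X (\<lambda>j\<in>{..<d}. \<Sum>i<d. C j i * g i) = g"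
    proof (rule lebesgue_d_eqI[of _ d, OF ws g])
      fix i assume i: "i < d"
      have "wsum d X (\<lambda>j\<in>{..<d}. \<Sum>m<d. C j m * g m) i =
        (\<Sum>j<d. \<Sum>m<d. g m * ((X (Suc j) i - X 0 i) * C j m))"
        using i by (simp add: wsum_nth sum_distrib_left sum_distrib_right mult_ac)
      also have "\<dots> = (\<Sum>m<d. g m * (\<Sum>j<d. (X (Suc j) i - X 0 i) * C j m))"
        by (subst sum.swap) (simp add: sum_distrib_left)
      also have "\<dots> = g i" using i by (simp add: C2 if_distrib cong: if_cong)
      finally show "wsum d X (\<lambda>j\<in>{..<d}. \<Sum>m<d. C j m * g m) i = g i" .
    qed
  next
    fix x y assume "x \<in> space (lebesgue_d d)" "y \<in> space (lebesgue_d d)"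
    show "wsum d X (\<lambda>i\<in>{..<d}. x i + y i) = (\<lambda>i\<in>{..<d}. wsum d X x i + wsum d X y i)"
      by (rule lebesgue_d_eqI[of _ d, OF ws])
         (auto simp: space_lebesgue_d wsum_nth sum.distrib[symmetric] distrib_right)
  qed measurable
qed

text \<open>Close to the barycentre z only the inequalities for vertices off the face are active.
  The weights of y are those of z, namely 1/k on the face, plus the unique zero-sum weights u of y -
  z. The bound on r keeps the sum of the |u j| at most 1/k, so no face vertex, \<open>X 0\<close>
  included, can get a negative weight.\<close>

lemma simplex_mem_iff:
  fixes z :: "nat \<Rightarrow> real"
  assumes C1: "\<And>j l. j < d \<Longrightarrow> l < d \<Longrightarrow> (\<Sum>i<d. C j i * (X (Suc l) i - X 0 i)) = (if j = l then 1 else 0)"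
    and C2: "\<And>i m. i < d \<Longrightarrow> m < d \<Longrightarrow> (\<Sum>j<d. (X (Suc j) i - X 0 i) * C j m) = (if i = m then 1 else 0)"
    and k: "1 \<le> k" "k \<le> d" and z: "z = (\<lambda>i. (\<Sum>j<k. X j i) / real k)"
    and y: "y \<in> space (lebesgue_d d)" and small: "norm_d d (\<lambda>i. y i - z i) < r"
    and r: "r * (\<Sum>j<d. \<Sum>i<d. \<bar>C j i\<bar>) \<le> 1 / real k"
  shows "y \<in> simplex_d d X {..<Suc d} \<longleftrightarrow> (\<forall>j<d. k \<le> Suc j \<longrightarrow> 0 \<le> (\<Sum>i<d. C j i * (y i - z i)))"
proof -
  interpret translation_iso "lebesgue_d d" "add_d d" "neg_d d"
    "lebesgue_d d" "add_d d" "neg_d d"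
    "wsum d X" "\<lambda>g. \<lambda>j\<in>{..<d}. \<Sum>i<d. C j i * g i"
    by (rule translation_iso_wsum[OF C1 C2])
  define g where "g = (\<lambda>i\<in>{..<d}. y i - z i)"
  define u where "u = (\<lambda>j\<in>{..<d}. \<Sum>i<d. C j i * g i)"
  define b where "b j = (if j < k then 1 / real k else 0)" for j
  have g: "g \<in> space (lebesgue_d d)" by (auto simp: g_def space_lebesgue_d)
  have u_j: "u j = (\<Sum>i<d. C j i * (y i - z i))" if "j < d" for j using that by (simp add: u_def g_def)
  have wu: "wsum d X u = g" unfolding u_def by (rule L_K[OF g])
  have sub: "{..<k} \<subseteq> {..<Suc d}" using k by auto
  have sum_b: "(\<Sum>j<Suc d. b j) = 1"
  proof -
    have "(\<Sum>j<Suc d. b j) = (\<Sum>j<k. 1 / real k)"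
      unfolding b_def by (rule sum.mono_neutral_cong_right) (use sub in auto)
    then show ?thesis using k by simp
  qed
  have sum_bX: "(\<Sum>j<Suc d. b j * X j i) = z i" for i
  proof -
    have "(\<Sum>j<Suc d. b j * X j i) = (\<Sum>j<k. 1 / real k * X j i)"
      unfolding b_def by (rule sum.mono_neutral_cong_right) (use sub in auto)
    then show ?thesis using k by (simp add: z sum_divide_distrib)
  qed
  have y_eq: "y i = (\<Sum>j<Suc d. (b j + full_weight d u j) * X j i)" if "i < d" for i
  proof -
    have "(\<Sum>j<Suc d. full_weight d u j * X j i) = y i - z i"
      using that fun_cong[OF wu, of i] by (simp add: g_def wsum_def del: sum.lessThan_Suc)
    then show ?thesis using sum_bX[of i] by (simp add: distrib_right sum.distrib del: sum.lessThan_Suc)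
  qed
  have abs_u: "(\<Sum>j<d. \<bar>u j\<bar>) \<le> 1 / real k"
  proof -
    have r0: "0 \<le> r" using small by (smt (verit) norm_d_def real_sqrt_ge_zero sum_nonneg zero_le_power2)
    have "(\<Sum>j<d. \<bar>u j\<bar>) \<le> (\<Sum>j<d. \<Sum>i<d. \<bar>C j i\<bar> * r)"
    proof (rule sum_mono)
      fix j assume j: "j \<in> {..<d}"
      have "\<bar>u j\<bar> \<le> (\<Sum>i<d. \<bar>C j i * (y i - z i)\<bar>)" using j u_j[of j] sum_abs[of "\<lambda>i. C j i * (y i - z i)"] by simp
      also have "\<dots> \<le> (\<Sum>i<d. \<bar>C j i\<bar> * r)"
      proof (rule sum_mono)
        fix i assume "i \<in> {..<d}"
        then have "\<bar>y i - z i\<bar> \<le> r"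
          using abs_nth_le_norm_d[of i d "\<lambda>i. y i - z i"] small by simp
        then show "\<bar>C j i * (y i - z i)\<bar> \<le> \<bar>C j i\<bar> * r"
          by (simp add: abs_mult mult_left_mono)
      qed
      finally show "\<bar>u j\<bar> \<le> (\<Sum>i<d. \<bar>C j i\<bar> * r)" .
    qed
    also have "\<dots> = r * (\<Sum>j<d. \<Sum>i<d. \<bar>C j i\<bar>)" by (simp add: sum_distrib_left mult.commute)
    finally show ?thesis using r by simp
  qed
  have fw: "- 1 / real k \<le> full_weight d u j" if "j < Suc d" for j
  proof (cases j)
    case 0
    have "\<bar>\<Sum>i<d. u i\<bar> \<le> 1 / real k" by (rule order_trans[OF sum_abs abs_u])
    then show ?thesis using 0 by simp
  next
    case (Suc i)
    have "\<bar>u i\<bar> \<le> (\<Sum>j<d. \<bar>u j\<bar>)" using that Suc by (intro member_le_sum) auto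
    then show ?thesis using Suc abs_u by simp
  qed
  show ?thesis
  proof
    assume "y \<in> simplex_d d X {..<Suc d}"
    then obtain w where w: "\<And>j. j < Suc d \<Longrightarrow> 0 \<le> w j" "(\<Sum>j<Suc d. w j) = 1"
      "\<And>i. i < d \<Longrightarrow> y i = (\<Sum>j<Suc d. w j * X j i)"
      by (auto simp: simplex_d_def)
    \<comment> \<open>The given barycentric weights of y minus those of z have sum zero and
      represent y - z, so by uniqueness they are u. Off the face b vanishes, hence u is nonnegative
      there.\<close>
    define v where "v = (\<lambda>j\<in>{..<d}. w (Suc j) - b (Suc j))"
    have v: "v \<in> space (lebesgue_d d)" by (auto simp: v_def space_lebesgue_d)
    have fwv: "full_weight d v j = w j - b j" if "j < Suc d" for j
    proof (cases j)
      case 0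
      have "(\<Sum>j<d. w (Suc j) - b (Suc j)) = - (w 0 - b 0)"
        using w(2) sum_b by (simp add: sum.lessThan_Suc_shift sum_subtractf del: sum.lessThan_Suc)
      then show ?thesis using 0 by (simp add: v_def)
    qed (use that in \<open>auto simp: v_def\<close>)
    have "wsum d X v = g"
    proof (rule lebesgue_d_eqI[of _ d, OF _ g])
      fix i assume i: "i < d"
      have "wsum d X v i = (\<Sum>j<Suc d. (w j - b j) * X j i)"
        using i by (auto simp: wsum_def fwv intro!: sum.cong simp del: sum.lessThan_Suc)
      also have "\<dots> = y i - z i"
        using w(3)[OF i] sum_bX[of i] by (simp add: left_diff_distrib sum_subtractf del: sum.lessThan_Suc)
      finally show "wsum d X v i = g i" using i by (simp add: g_def)
    qed (auto simp: wsum_def space_lebesgue_d)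
    then have "u = v" using K_L[OF v] by (simp add: u_def)
    show "\<forall>j<d. k \<le> Suc j \<longrightarrow> 0 \<le> (\<Sum>i<d. C j i * (y i - z i))"
    proof (intro allI impI)
      fix j assume j: "j < d" "k \<le> Suc j"
      then have "u j = w (Suc j)" by (simp add: \<open>u = v\<close> v_def b_def)
      then show "0 \<le> (\<Sum>i<d. C j i * (y i - z i))" using w(1)[of "Suc j"] j u_j[of j] by simp
    qed
  next
    assume pos: "\<forall>j<d. k \<le> Suc j \<longrightarrow> 0 \<le> (\<Sum>i<d. C j i * (y i - z i))"
    have "0 \<le> b j + full_weight d u j" if j: "j < Suc d" for j
    proof (cases "j < k")
      case True
      then show ?thesis using fw[OF j] by (simp add: b_def)
    next
      case False
      then obtain i where i: "j = Suc i" using k by (cases j) auto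
      then show ?thesis using False pos j u_j[of i] by (simp add: b_def)
    qed
    moreover have "(\<Sum>j<Suc d. b j + full_weight d u j) = 1"
      using sum_b sum_full_weight[of d u] by (simp add: sum.distrib del: sum.lessThan_Suc)
    ultimately show "y \<in> simplex_d d X {..<Suc d}"
      unfolding simplex_d_def using y y_eq
      by (auto intro!: exI[of _ "\<lambda>j. b j + full_weight d u j"] simp del: sum.lessThan_Suc)
  qed
qed


section \<open>The internal angle as a ratio of volumes of weights\<close>

lemma restrict_in_space_lebesgue_d: "(\<lambda>i\<in>{..<d}. f i) \<in> space (lebesgue_d d)"
  by (auto simp: space_lebesgue_d)

text \<open>In the weight coordinates of y - z the ball and its part in the simplex become
  \<open>U r\<close> and \<open>G r\<close>, with one common volume factor, as soon as r is below
  \<rho>. A dilation changes both by the same factor, so the quotient is constant for small r and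
  equals its limit.\<close>

lemma internal_angle_nondegenerate:
  assumes det: "edge_det d X \<noteq> 0" and k: "1 \<le> k" "k \<le> d"
  shows "internal_angle d X {..<k} {..<Suc d} =
      measure (lebesgue_d d) {w \<in> face_cone d k. norm_d d (wsum d X w) < 1} /
      measure (lebesgue_d d) {w \<in> space (lebesgue_d d). norm_d d (wsum d X w) < 1}" (is ?A)
    and "0 < emeasure (lebesgue_d d) {w \<in> space (lebesgue_d d). norm_d d (wsum d X w) < 1}" (is ?B)
    and "emeasure (lebesgue_d d) {w \<in> space (lebesgue_d d). norm_d d (wsum d X w) < 1} < \<infinity>" (is ?C)
proof -
  let ?V = "lebesgue_d d"
  obtain C where C: "\<forall>j<d. \<forall>l<d. (\<Sum>i<d. C j i * (X (Suc l) i - X 0 i)) = (if j = l then 1 else 0)"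
    "\<forall>i<d. \<forall>m<d. (\<Sum>j<d. (X (Suc j) i - X 0 i) * C j m) = (if i = m then 1 else 0)"
    using edge_inverse[OF det] by blast
  have C1: "(\<Sum>i<d. C j i * (X (Suc l) i - X 0 i)) = (if j = l then 1 else 0)" if "j < d" "l < d" for j l
    using C(1) that by blast
  have C2: "(\<Sum>j<d. (X (Suc j) i - X 0 i) * C j m) = (if i = m then 1 else 0)" if "i < d" "m < d" for i m
    using C(2) that by blast
  interpret L: translation_iso ?V "add_d d" "neg_d d"
    ?V "add_d d" "neg_d d"
    "wsum d X" "\<lambda>g. \<lambda>j\<in>{..<d}. \<Sum>i<d. C j i * g i"
    by (rule translation_iso_wsum[OF C1 C2])
  obtain c where c: "0 < c" "c < \<infinity>" "\<And>A. A \<in> sets ?V \<Longrightarrow> emeasure ?V (wsum d X -` A \<inter> space ?V) = c * emeasure ?V A"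
    by (rule L.emeasure_vimage_proportional) blast
  obtain c' where c': "c = ennreal c'" "c' > 0" using c by (cases c) auto
  define U where "U r = {w \<in> space ?V. norm_d d (wsum d X w) < r}" for r
  define G where "G r = {w \<in> face_cone d k. norm_d d (wsum d X w) < r}" for r
  have wsum_space: "wsum d X w \<in> space ?V" for w by (auto simp: wsum_def space_lebesgue_d)
  have "wsum d X -` {x \<in> space ?V. norm_d d x < 1} \<inter> space ?V = U 1" using wsum_space by (auto simp: U_def)
  then have U1: "emeasure ?V (U 1) = c * emeasure ?V {x \<in> space ?V. norm_d d x < 1}"
    using c(3)[of "{x \<in> space ?V. norm_d d x < 1}"] by simp
  show ?B unfolding U_def[symmetric] U1 using c(1) emeasure_ball_d_origin(1)[of d] by (simp add: ennreal_zero_less_mult_iff)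
  show ?C unfolding U_def[symmetric] U1 using c(2) emeasure_ball_d_origin(2)[of d] by (simp add: ennreal_mult_less_top)
  define z where "z = (\<lambda>i. (\<Sum>j<k. X j i) / real k)"
  define T where "T = simplex_d d X {..<Suc d}"
  have transl: "emeasure ?V {w \<in> space ?V. (\<lambda>i\<in>{..<d}. z i + wsum d X w i) \<in> S} = c * emeasure ?V S"
    if S [measurable]: "S \<in> sets ?V" for S
  proof -
    let ?t = "\<lambda>g. \<lambda>i\<in>{..<d}. (\<lambda>i\<in>{..<d}. z i) i + g i"
    have [measurable]: "?t \<in> ?V \<rightarrow>\<^sub>M ?V"
      by (intro measurable_lebesgue_dI borel_measurable_add borel_measurable_const measurable_lebesgue_d_nth[of "\<lambda>x. x" _ d]) auto
    have "emeasure ?V S = emeasure (distr ?V ?V ?t) S"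
      by (subst lebesgue_d.distr_pl) (auto simp: space_lebesgue_d)
    also have "\<dots> = emeasure ?V (?t -` S \<inter> space ?V)" by (rule emeasure_distr) auto
    finally have "c * emeasure ?V S = c * emeasure ?V (?t -` S \<inter> space ?V)" by (rule arg_cong)
    also have "\<dots> = emeasure ?V (wsum d X -` (?t -` S \<inter> space ?V) \<inter> space ?V)"
      by (rule c(3)[symmetric]) measurable
    also have "wsum d X -` (?t -` S \<inter> space ?V) \<inter> space ?V = {w \<in> space ?V. (\<lambda>i\<in>{..<d}. z i + wsum d X w i) \<in> S}"
      using wsum_space by (auto cong: restrict_cong)
    finally show ?thesis by simp
  qed
  \<comment> \<open>Chosen so that r < \<rho> implies the smallness hypothesis of
    \<open>simplex_mem_iff\<close>; the added 1 keeps the denominator positive without a look at the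
    sum.\<close>
  define \<rho> where "\<rho> = 1 / (real k * ((\<Sum>j<d. \<Sum>i<d. \<bar>C j i\<bar>) + 1))"
  have S0: "0 \<le> (\<Sum>j<d. \<Sum>i<d. \<bar>C j i\<bar>)" by (intro sum_nonneg) auto
  have \<rho>: "0 < \<rho>" using k S0 by (auto simp: \<rho>_def intro!: divide_pos_pos mult_pos_pos)
  have ratio: "measure ?V (ball_d d z r \<inter> T) / measure ?V (ball_d d z r) = measure ?V (G 1) / measure ?V (U 1)"
    if r: "0 < r" "r < \<rho>" for r
  proof -
    define S where "S = {y \<in> space ?V. norm_d d (\<lambda>i. y i - z i) < r \<and>
      (\<forall>j<d. k \<le> Suc j \<longrightarrow> 0 \<le> (\<Sum>i<d. C j i * (y i - z i)))}"
    have nd [measurable]: "(\<lambda>y. norm_d d (\<lambda>i. y i - z i)) \<in> borel_measurable ?V"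
    proof -
      have "(\<lambda>y. norm_d d (\<lambda>i. y i - z i)) = (\<lambda>y. norm_d d (\<lambda>i\<in>{..<d}. y i - z i))"
        by (intro ext norm_d_cong) auto
      then show ?thesis by simp
    qed
    have lin [measurable]: "(\<lambda>y. \<Sum>i<d. C j i * (y i - z i)) \<in> borel_measurable ?V" for j
      by (intro borel_measurable_sum borel_measurable_times borel_measurable_const borel_measurable_diff
          measurable_lebesgue_d_nth[of "\<lambda>x. x" _ d]) auto
    have S [measurable]: "S \<in> sets ?V" unfolding S_def by measurable
    have ball [measurable]: "ball_d d z r \<in> sets ?V" unfolding ball_d_def by measurable
    have "r * (\<Sum>j<d. \<Sum>i<d. \<bar>C j i\<bar>) \<le> \<rho> * ((\<Sum>j<d. \<Sum>i<d. \<bar>C j i\<bar>) + 1)"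
      using r S0 by (intro mult_mono) auto
    also have "\<dots> = 1 / real k" using S0 by (simp add: \<rho>_def)
    finally have "ball_d d z r \<inter> T = S"
      using simplex_mem_iff[OF C1 C2 k z_def] by (auto simp: S_def ball_d_def T_def)
    moreover have "{w \<in> space ?V. (\<lambda>i\<in>{..<d}. z i + wsum d X w i) \<in> S} = G r"
    proof -
      have "norm_d d (\<lambda>i. (\<lambda>i\<in>{..<d}. z i + wsum d X w i) i - z i) = norm_d d (wsum d X w)" for w
        by (rule norm_d_cong) auto
      moreover have "(\<Sum>i<d. C j i * ((\<lambda>i\<in>{..<d}. z i + wsum d X w i) i - z i)) = w j"
        if "j < d" "w \<in> space ?V" for j w
        using fun_cong[OF L.K_L[OF that(2)], of j] that(1) by simp
      ultimately show ?thesis by (auto simp: S_def G_def face_cone_def space_lebesgue_d)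
    qed
    ultimately have Gr: "emeasure ?V (G r) = c * emeasure ?V (ball_d d z r \<inter> T)" using transl[OF S] by simp
    have "{w \<in> space ?V. (\<lambda>i\<in>{..<d}. z i + wsum d X w i) \<in> ball_d d z r} = U r"
    proof -
      have "norm_d d (\<lambda>i. (\<lambda>i\<in>{..<d}. z i + wsum d X w i) i - z i) = norm_d d (wsum d X w)" for w
        by (rule norm_d_cong) auto
      then show ?thesis by (auto simp: U_def ball_d_def space_lebesgue_d)
    qed
    then have Ur: "emeasure ?V (U r) = c * emeasure ?V (ball_d d z r)" using transl[OF ball] by simp
    interpret s: translation_iso ?V "add_d d" "neg_d d"
      ?V "add_d d" "neg_d d"
      "\<lambda>x. \<lambda>i\<in>{..<d}. r * x i" "\<lambda>x. \<lambda>i\<in>{..<d}. x i / r"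
      by (rule translation_iso_scale) (use r in auto)
    \<comment> \<open>The factor b is r^(-d); it drops out because it scales both volumes.\<close>
    obtain b where b: "0 < b" "b < \<infinity>"
      "\<And>A. A \<in> sets ?V \<Longrightarrow> emeasure ?V ((\<lambda>x. \<lambda>i\<in>{..<d}. r * x i) -` A \<inter> space ?V) = b * emeasure ?V A"
      by (rule s.emeasure_vimage_proportional) blast
    obtain b' where b': "b = ennreal b'" "b' > 0" using b by (cases b) auto
    have nsc: "norm_d d (wsum d X (\<lambda>i\<in>{..<d}. r * w i)) = r * norm_d d (wsum d X w)" for w
      unfolding wsum_scale using r norm_d_scale[of d r "wsum d X w"]
      by (subst norm_d_cong[where y = "\<lambda>i. r * wsum d X w i"]) auto
    have "(\<lambda>x. \<lambda>i\<in>{..<d}. r * x i) -` G r \<inter> space ?V = G 1"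
      using r by (auto simp: G_def face_cone_def nsc space_lebesgue_d zero_le_mult_iff)
    moreover have "(\<lambda>x. \<lambda>i\<in>{..<d}. r * x i) -` U r \<inter> space ?V = U 1"
      using r by (auto simp: U_def nsc space_lebesgue_d)
    moreover have "G r \<in> sets ?V"
    proof -
      have "G r = face_cone d k \<inter> {w \<in> space ?V. norm_d d (wsum d X w) < r}" by (auto simp: G_def face_cone_def)
      then show ?thesis by simp
    qed
    moreover have "U r \<in> sets ?V" unfolding U_def by measurable
    ultimately have GU: "emeasure ?V (G 1) = b * emeasure ?V (G r)" "emeasure ?V (U 1) = b * emeasure ?V (U r)"
      using b(3)[of "G r"] b(3)[of "U r"] by auto
    have "measure ?V (G 1) = b' * c' * measure ?V (ball_d d z r \<inter> T)" "measure ?V (U 1) = b' * c' * measure ?V (ball_d d z r)"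
      unfolding measure_def GU Gr Ur using b' c' by (auto simp: enn2real_mult)
    then show ?thesis using b' c' by simp
  qed
  have "((\<lambda>r. measure ?V (ball_d d z r \<inter> T) / measure ?V (ball_d d z r)) \<longlongrightarrow> measure ?V (G 1) / measure ?V (U 1)) (at_right 0)"
  proof (rule tendsto_eventually)
    show "\<forall>\<^sub>F r in at_right 0. measure ?V (ball_d d z r \<inter> T) / measure ?V (ball_d d z r) = measure ?V (G 1) / measure ?V (U 1)"
      using eventually_at_right_real[OF \<rho>] by (rule eventually_mono) (auto intro!: ratio)
  qed
  then have "Lim (at_right 0) (\<lambda>r. measure ?V (ball_d d z r \<inter> T) / measure ?V (ball_d d z r)) = measure ?V (G 1) / measure ?V (U 1)"
    by (intro tendsto_Lim) auto
  then show ?A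
    by (simp add: internal_angle_def angle_at_def T_def z_def G_def U_def)
qed

text \<open>All points, hence the whole simplex, lie in a hyperplane, which is a null set; every
  quotient in the definition is therefore 0. Knowing the value on degenerate configurations too
  makes the angle measurable and nonnegative for all X.\<close>

lemma internal_angle_degenerate:
  assumes "edge_det d X = 0"
  shows "internal_angle d X K {..<Suc d} = 0"
proof -
  let ?V = "lebesgue_d d"
  obtain a i where a: "i < d" "a i \<noteq> 0" "\<forall>j<d. (\<Sum>i<d. a i * (X (Suc j) i - X 0 i)) = 0"
    using edge_annihilator[OF assms] by blast
  define b where "b = (\<Sum>i<d. a i * X 0 i)"
  have aX: "(\<Sum>i<d. a i * X j i) = b" if "j < Suc d" for j
    using that a(3)[rule_format, of "j - 1"] by (cases j) (auto simp: b_def right_diff_distrib sum_subtractf)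
  define Z where "Z = {y \<in> space ?V. (\<Sum>i<d. a i * y i) = b}"
  have [measurable]: "(\<lambda>y. \<Sum>i<d. a i * y i) \<in> borel_measurable ?V"
    by (intro borel_measurable_sum borel_measurable_times borel_measurable_const
          measurable_lebesgue_d_nth[of "\<lambda>x. x" _ d]) auto
  have [measurable]: "Z \<in> sets ?V" unfolding Z_def by measurable
  have "emeasure ?V Z = 0"
  proof (rule lebesgue_d.null_set_if_null_on_lines[where e = "\<lambda>t. \<lambda>l\<in>{..<d}. if l = i then t else 0"])
    fix y assume "y \<in> space ?V"
    have "(\<Sum>l<d. a l * ((if l = i then t else 0) + y l)) = a i * t + (\<Sum>l<d. a l * y l)" for t
    proof -
      have "(\<Sum>l<d. a l * ((if l = i then t else 0) + y l)) = (\<Sum>l<d. (if l = i then a l * t else 0) + a l * y l)"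
        by (intro sum.cong) (auto simp: distrib_left)
      then show ?thesis using a(1) by (simp add: sum.distrib)
    qed
    then have "t = (b - (\<Sum>l<d. a l * y l)) / a i"
      if "(\<lambda>l\<in>{..<d}. (\<lambda>l\<in>{..<d}. if l = i then t else 0) l + y l) \<in> Z" for t
      using that a(2) by (auto simp: Z_def field_simps)
    then have "{t. (\<lambda>l\<in>{..<d}. (\<lambda>l\<in>{..<d}. if l = i then t else 0) l + y l) \<in> Z} \<subseteq> {(b - (\<Sum>l<d. a l * y l)) / a i}"
      by blast
    then have "{t. (\<lambda>l\<in>{..<d}. (\<lambda>l\<in>{..<d}. if l = i then t else 0) l + y l) \<in> Z} \<in> null_sets lborel"
      by (intro finite_imp_null_set_lborel) (rule finite_subset, auto)
    then show "AE t in lborel. (\<lambda>l\<in>{..<d}. (\<lambda>l\<in>{..<d}. if l = i then t else 0) l + y l) \<notin> Z"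
      by (rule AE_not_in[THEN eventually_mono]) auto
  qed (measurable, auto)
  moreover have "simplex_d d X {..<Suc d} \<subseteq> Z"
  proof
    fix y assume "y \<in> simplex_d d X {..<Suc d}"
    then obtain w where w: "y \<in> space ?V" "(\<Sum>j<Suc d. w j) = 1" "\<And>i. i < d \<Longrightarrow> y i = (\<Sum>j<Suc d. w j * X j i)"
      by (auto simp: simplex_d_def)
    have "(\<Sum>i<d. a i * y i) = (\<Sum>i<d. \<Sum>j<Suc d. w j * (a i * X j i))"
      using w(3) by (intro sum.cong refl) (simp add: sum_distrib_left mult_ac del: sum.lessThan_Suc)
    also have "\<dots> = (\<Sum>j<Suc d. w j * (\<Sum>i<d. a i * X j i))"
      by (subst sum.swap) (simp add: sum_distrib_left del: sum.lessThan_Suc)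
    also have "\<dots> = (\<Sum>j<Suc d. w j * b)" by (intro sum.cong refl) (use aX in auto)
    also have "\<dots> = b" using w(2) by (simp add: sum_distrib_right[symmetric] del: sum.lessThan_Suc)
    finally show "y \<in> Z" using w(1) by (simp add: Z_def)
  qed
  ultimately have "emeasure ?V (B \<inter> simplex_d d X {..<Suc d}) = 0" for B
    using emeasure_mono[of "B \<inter> simplex_d d X {..<Suc d}" Z ?V] by auto
  then have "measure ?V (B \<inter> simplex_d d X {..<Suc d}) = 0" for B by (simp add: measure_def)
  then show ?thesis unfolding internal_angle_def angle_at_def by (intro tendsto_Lim) auto
qed

section \<open>The law of the weights for fixed variances\<close>

text \<open>Up to sign the exponent in the joint density of independent centred Gaussians of
  variances 2 v_j, restricted to the hyperplane of zero-sum vectors, which the d free weights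
  parametrize.\<close>

definition weight_form :: "nat \<Rightarrow> (nat \<Rightarrow> real) \<Rightarrow> (nat \<Rightarrow> real) \<Rightarrow> real" where
  "weight_form d v w = (\<Sum>j<Suc d. (full_weight d w j)\<^sup>2 / (4 * v j))"

lemma weight_form_eq: "weight_form d v w = (\<Sum>j<Suc d. (full_weight d w j)\<^sup>2 / v j) / 4"
  unfolding weight_form_def sum_divide_distrib by (intro sum.cong) auto

text \<open>Joint density of the points given \<open>v\<close>: each coordinate of
  \<open>X j\<close> is centred Gaussian of variance 1 / (2 v_j), the reciprocal of the scaling of
  the weights.\<close>

definition gauss_weight :: "nat \<Rightarrow> (nat \<Rightarrow> real) \<Rightarrow> (nat \<Rightarrow> nat \<Rightarrow> real) \<Rightarrow> real" where
  "gauss_weight d v X = (\<Prod>j<Suc d. \<Prod>i<d. sqrt (v j / pi) * exp (- v j * (X j i)\<^sup>2))"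

definition unit_vol :: "nat \<Rightarrow> (nat \<Rightarrow> nat \<Rightarrow> real) \<Rightarrow> ennreal" where
  "unit_vol d X = (\<integral>\<^sup>+w. indicator {..<1} (norm_d d (wsum d X w)) \<partial>lebesgue_d d)"

text \<open>Density of w when the points are Gaussian with parameters \<open>v\<close> and, given
  the points, \<open>wsum d X w\<close> is uniform in the unit ball. Then w is uniform on the
  preimage of the ball, whence the division by \<open>unit_vol d X\<close>.\<close>

definition weight_density :: "nat \<Rightarrow> (nat \<Rightarrow> real) \<Rightarrow> (nat \<Rightarrow> real) \<Rightarrow> ennreal" where
  "weight_density d v w = (\<integral>\<^sup>+X. ennreal (gauss_weight d v X) *
     (indicator {..<1} (norm_d d (wsum d X w)) / unit_vol d X) \<partial>points d)"

lemma points_nth_measurable [measurable (raw)]: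
  assumes "f \<in> M \<rightarrow>\<^sub>M PiM {..<n} (\<lambda>_. lebesgue_d d)" "j < n" "i < d"
  shows "(\<lambda>x. f x j i) \<in> borel_measurable M"
proof -
  have "(\<lambda>x. f x j) \<in> M \<rightarrow>\<^sub>M lebesgue_d d"
    using measurable_compose[OF assms(1) measurable_component_singleton[of j]] assms by auto
  then show ?thesis using assms by measurable
qed

lemma unit_vol_measurable [measurable]:
  "unit_vol d \<in> borel_measurable (points d)"
  unfolding unit_vol_def by measurable

lemma gauss_weight_measurable [measurable (raw)]:
  assumes f: "f \<in> M \<rightarrow>\<^sub>M lebesgue_d (Suc d)" and g: "g \<in> M \<rightarrow>\<^sub>M points d"
  shows "(\<lambda>x. gauss_weight d (f x) (g x)) \<in> borel_measurable M"
proof -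
  have [measurable]: "(\<lambda>x. f x j) \<in> borel_measurable M" "(\<lambda>x. g x j i) \<in> borel_measurable M"
    if "j \<in> {..<Suc d}" "i \<in> {..<d}" for i j
    using that by (auto intro!: measurable_lebesgue_d_nth[OF f] points_nth_measurable[OF g])
  show ?thesis unfolding gauss_weight_def by measurable
qed

lemma gauss_weight_measurable_fixed [measurable]:
  "gauss_weight d v \<in> borel_measurable (points d)"
proof -
  have "gauss_weight d v = (\<lambda>X. gauss_weight d (\<lambda>j\<in>{..<Suc d}. v j) X)"
    by (auto simp: gauss_weight_def fun_eq_iff intro!: prod.cong)
  then show ?thesis
    using gauss_weight_measurable[of "\<lambda>_. \<lambda>j\<in>{..<Suc d}. v j" "points d" d "\<lambda>x. x"]
    by (simp add: restrict_in_space_lebesgue_d)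
qed

lemma gauss_weight_eq:
  assumes "\<And>j. j < Suc d \<Longrightarrow> 0 < v j"
  shows "gauss_weight d v X = (\<Prod>j<Suc d. sqrt (v j / pi) ^ d) * exp (- (\<Sum>i<d. \<Sum>j<Suc d. v j * (X j i)\<^sup>2))"
proof -
  have "gauss_weight d v X = (\<Prod>j<Suc d. sqrt (v j / pi) ^ d * exp (- (\<Sum>i<d. v j * (X j i)\<^sup>2)))"
    unfolding gauss_weight_def
    by (intro prod.cong refl) (simp add: prod.distrib exp_sum[symmetric] sum_negf)
  also have "\<dots> = (\<Prod>j<Suc d. sqrt (v j / pi) ^ d) * exp (- (\<Sum>j<Suc d. \<Sum>i<d. v j * (X j i)\<^sup>2))"
    by (simp add: prod.distrib exp_sum[symmetric] sum_negf del: sum.lessThan_Suc prod.lessThan_Suc)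
  also have "(\<Sum>j<Suc d. \<Sum>i<d. v j * (X j i)\<^sup>2) = (\<Sum>i<d. \<Sum>j<Suc d. v j * (X j i)\<^sup>2)"
    by (rule sum.swap)
  finally show ?thesis .
qed

lemma sum_diff_mult: "(\<Sum>j\<in>A. f j - c * g j) = sum f A - c * sum g A" for c :: real
  by (simp add: sum_subtractf sum_distrib_left)

lemma full_weight_add:
  "full_weight d (\<lambda>i\<in>{..<d}. x i + y i) j = full_weight d x j + full_weight d y j" if "j < Suc d"
  using that by (cases j) (auto simp: sum.distrib)

lemma full_weight_scale:
  "full_weight d (\<lambda>i\<in>{..<d}. r * x i) j = r * full_weight d x j" if "j < Suc d"
  using that by (cases j) (auto simp: sum_distrib_left)

lemma full_weight_reflect:
  assumes "(\<Sum>j<Suc d. e j) = 0" "j < Suc d"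
  shows "full_weight d (\<lambda>i\<in>{..<d}. x i - c * e (Suc i)) j = full_weight d x j - c * e j"
proof (cases j)
  case 0
  have "(\<Sum>i<d. e (Suc i)) = - e 0"
    using assms(1) by (simp add: sum.lessThan_Suc_shift del: sum.lessThan_Suc)
  then show ?thesis using 0 by (simp add: sum_subtractf sum_distrib_left[symmetric])
qed (use assms in auto)

text \<open>Given \<open>v\<close>, the reflection exchanging \<open>w\<close> and \<open>w'\<close> is an isometry for \<open>weight_form d v\<close>, and its
  adjoint acts on the points preserving their Gaussian law; hence the density of the weights is
  a function of \<open>weight_form d v\<close> only.\<close>

lemma weight_density_radial:
  assumes v: "\<And>j. j < Suc d \<Longrightarrow> 0 < v j"
    and w: "w \<in> space (lebesgue_d d)" and w': "w' \<in> space (lebesgue_d d)"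
    and eq: "weight_form d v w = weight_form d v w'"
  shows "weight_density d v w = weight_density d v w'"
proof (cases "w = w'")
  case False
  let ?V = "lebesgue_d d" and ?P = "points d"
  \<comment> \<open>The vector e = w - w' is the direction of the reflection, N its squared length
    for the form sum_j x_j y_j / v_j, and b the pairing with e. \<rho> is the reflection of the
    weights along e; \<theta> is its transpose acting on the points, so that
    \<open>wsum d (\<theta> X) x = wsum d X (\<rho> x)\<close>.\<close>
  define e where "e j = full_weight d w j - full_weight d w' j" for j
  define N where "N = (\<Sum>j<Suc d. (e j)\<^sup>2 / v j)"
  have sum_e: "(\<Sum>j<Suc d. e j) = 0"
    unfolding e_def by (simp add: sum_subtractf sum_full_weight del: sum.lessThan_Suc)
  obtain i where i: "i < d" "w i \<noteq> w' i"
    using False lebesgue_d_eqI[OF w w'] by blast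
  have "(e (Suc i))\<^sup>2 / v (Suc i) \<le> N"
    unfolding N_def by (rule member_le_sum) (use i v in \<open>auto intro!: divide_nonneg_pos\<close>)
  moreover have "0 < (e (Suc i))\<^sup>2 / v (Suc i)" using i v[of "Suc i"] by (auto simp: e_def)
  ultimately have N: "0 < N" by linarith
  define b where "b x = (\<Sum>j<Suc d. full_weight d x j * e j / v j)" for x
  define \<rho> where "\<rho> x = (\<lambda>i\<in>{..<d}. x i - 2 * b x / N * e (Suc i))" for x
  define s where "s X i = (\<Sum>j<Suc d. e j * X j i)" for X :: "nat \<Rightarrow> nat \<Rightarrow> real" and i
  define \<theta> where "\<theta> X = (\<lambda>j\<in>{..<Suc d}. \<lambda>i\<in>{..<d}. X j i - 2 * e j / (v j * N) * s X i)" for X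
  have fw_\<rho>: "full_weight d (\<rho> x) j = full_weight d x j - 2 * b x / N * e j" if "j < Suc d" for x j
    unfolding \<rho>_def by (rule full_weight_reflect[OF sum_e that])
  have fw_eq: "full_weight d w j = e j + full_weight d w' j" for j by (simp add: e_def)
  have "(\<Sum>j<Suc d. (full_weight d w j)\<^sup>2 / v j) = (\<Sum>j<Suc d. (full_weight d w' j)\<^sup>2 / v j)"
    using eq by (simp add: weight_form_eq del: sum.lessThan_Suc)
  then have "(\<Sum>j<Suc d. (full_weight d w j)\<^sup>2 / v j - (full_weight d w' j)\<^sup>2 / v j) = 0"
    by (simp add: sum_subtractf del: sum.lessThan_Suc)
  moreover have "(\<Sum>j<Suc d. (full_weight d w j)\<^sup>2 / v j - (full_weight d w' j)\<^sup>2 / v j) =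
      (\<Sum>j<Suc d. 2 * (full_weight d w j * e j / v j) - (e j)\<^sup>2 / v j)"
    by (intro sum.cong refl) (simp add: fw_eq power2_eq_square diff_divide_distrib[symmetric] algebra_simps)
  \<comment> \<open>Equality of the two forms says that the midpoint of w and w' is orthogonal to e;
    this is what makes \<rho> carry w to w'.\<close>
  ultimately have "2 * b w = N"
    by (simp add: b_def N_def sum_subtractf sum_distrib_left del: sum.lessThan_Suc)
  then have "2 * b w / N = 1" using N by simp
  then have \<rho>_w: "\<rho> w = w'"
    using w' by (intro lebesgue_d_eqI[of _ d]) (auto simp: \<rho>_def e_def space_lebesgue_d)
  have b_\<rho>: "b (\<rho> x) = - b x" for x
  proof -
    have "b (\<rho> x) = (\<Sum>j<Suc d. full_weight d x j * e j / v j - 2 * b x / N * ((e j)\<^sup>2 / v j))"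
      unfolding b_def[of "\<rho> x"]
      by (intro sum.cong refl) (simp add: fw_\<rho> power2_eq_square diff_divide_distrib left_diff_distrib mult.assoc)
    also have "\<dots> = b x - 2 * b x / N * N"
      by (simp only: sum_diff_mult b_def N_def)
    finally show ?thesis using N by simp
  qed
  have \<rho>_\<rho>: "\<rho> (\<rho> x) = x" if "x \<in> space ?V" for x
  proof (rule lebesgue_d_eqI[of _ d, OF _ that])
    show "\<rho> (\<rho> x) i = x i" if "i < d" for i
      using that b_\<rho>[of x] by (subst \<rho>_def) (simp add: \<rho>_def[of x])
  qed (auto simp: \<rho>_def space_lebesgue_d)
  have b_meas [measurable]: "b \<in> borel_measurable ?V"
    unfolding b_def by (intro borel_measurable_sum borel_measurable_times borel_measurable_divide
        borel_measurable_const full_weight_measurable[of "\<lambda>x. x" _ d]) auto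
  have \<rho>_meas [measurable]: "\<rho> \<in> ?V \<rightarrow>\<^sub>M ?V" unfolding \<rho>_def by measurable
  have \<rho>_add: "\<rho> (\<lambda>i\<in>{..<d}. x i + y i) = (\<lambda>i\<in>{..<d}. \<rho> x i + \<rho> y i)" for x y
  proof -
    have "b (\<lambda>i\<in>{..<d}. x i + y i) = b x + b y"
      unfolding b_def sum.distrib[symmetric]
      by (intro sum.cong refl) (simp add: full_weight_add algebra_simps add_divide_distrib)
    then show ?thesis by (auto simp: \<rho>_def add_divide_distrib algebra_simps intro!: restrict_ext)
  qed
  have s_\<theta>: "s (\<theta> X) i = - s X i" if "i < d" for X i
  proof -
    have "s (\<theta> X) i = (\<Sum>j<Suc d. e j * X j i - 2 / N * s X i * ((e j)\<^sup>2 / v j))"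
      unfolding s_def[of "\<theta> X"]
      by (intro sum.cong refl) (use that in \<open>simp add: \<theta>_def power2_eq_square right_diff_distrib mult_ac\<close>)
    also have "\<dots> = s X i - 2 / N * s X i * N"
      by (simp only: sum_diff_mult s_def N_def)
    finally show ?thesis using N by simp
  qed
  have \<theta>_\<theta>: "\<theta> (\<theta> X) = X" if X: "X \<in> space ?P" for X
  proof (rule extensionalityI[of _ "{..<Suc d}"])
    fix j assume j: "j \<in> {..<Suc d}"
    have "\<theta> (\<theta> X) j i = X j i" if "i < d" for i
      using that j s_\<theta>[of i X] by (subst \<theta>_def) (simp add: \<theta>_def[of X])
    moreover have "X j \<in> space ?V" using X j by (auto simp: space_PiM)
    ultimately show "\<theta> (\<theta> X) j = X j"
      using j by (intro lebesgue_d_eqI[of _ d]) (auto simp: \<theta>_def space_lebesgue_d)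
  qed (use X in \<open>auto simp: \<theta>_def space_PiM PiE_def\<close>)
  have s_meas [measurable]: "(\<lambda>X. s X i) \<in> borel_measurable ?P" if "i < d" for i
    unfolding s_def by (intro borel_measurable_sum borel_measurable_times borel_measurable_const
        points_nth_measurable[of "\<lambda>x. x" _ "Suc d" d]) (use that in auto)
  have \<theta>_meas [measurable]: "\<theta> \<in> ?P \<rightarrow>\<^sub>M ?P"
    unfolding \<theta>_def
    by (intro measurable_restrict measurable_lebesgue_dI borel_measurable_diff borel_measurable_times
        borel_measurable_const points_nth_measurable[of "\<lambda>x. x" _ "Suc d" d] s_meas) auto
  have \<theta>_add: "\<theta> (\<lambda>j\<in>{..<Suc d}. \<lambda>i\<in>{..<d}. X j i + Y j i) = (\<lambda>j\<in>{..<Suc d}. \<lambda>i\<in>{..<d}. \<theta> X j i + \<theta> Y j i)" for X Y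
  proof -
    have "s (\<lambda>j\<in>{..<Suc d}. \<lambda>i\<in>{..<d}. X j i + Y j i) i = s X i + s Y i" if "i < d" for i
      unfolding s_def sum.distrib[symmetric]
      by (intro sum.cong refl) (use that in \<open>simp add: algebra_simps\<close>)
    then show ?thesis by (auto simp: \<theta>_def algebra_simps add_divide_distrib intro!: restrict_ext)
  qed
  have wsum_\<theta>: "wsum d (\<theta> X) x = wsum d X (\<rho> x)" for X x
  proof (rule lebesgue_d_eqI[of _ d])
    fix i assume i: "i < d"
    have "wsum d (\<theta> X) x i = (\<Sum>j<Suc d. full_weight d x j * X j i - 2 / N * s X i * (full_weight d x j * e j / v j))"
      unfolding wsum_def using i by (auto simp: \<theta>_def right_diff_distrib mult_ac intro!: sum.cong simp del: sum.lessThan_Suc)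
    also have "\<dots> = (\<Sum>j<Suc d. full_weight d x j * X j i) - 2 / N * s X i * b x"
      by (simp only: sum_diff_mult b_def)
    also have "\<dots> = (\<Sum>j<Suc d. full_weight d x j * X j i - 2 * b x / N * (e j * X j i))"
      unfolding sum_diff_mult s_def[symmetric] by simp
    also have "\<dots> = wsum d X (\<rho> x) i"
      unfolding wsum_def using i by (auto simp: fw_\<rho> left_diff_distrib mult.assoc intro!: sum.cong simp del: sum.lessThan_Suc)
    finally show "wsum d (\<theta> X) x i = wsum d X (\<rho> x) i" .
  qed (auto simp: wsum_def space_lebesgue_d)
  \<comment> \<open>For each coordinate i, \<theta> reflects the vector of the X j i along the
    vector e_j / v_j, and this reflection is orthogonal for the dual form sum_j v_j x_j^2, the
    exponent of the Gaussian density.\<close>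
  have gauss_\<theta>: "gauss_weight d v (\<theta> X) = gauss_weight d v X" for X
  proof -
    have "(\<Sum>j<Suc d. v j * (\<theta> X j i)\<^sup>2) = (\<Sum>j<Suc d. v j * (X j i)\<^sup>2)" if "i < d" for i
    proof -
      have "v j * (\<theta> X j i)\<^sup>2 = v j * (X j i)\<^sup>2 - 4 / N * s X i * (e j * X j i) + 4 / N\<^sup>2 * (s X i)\<^sup>2 * ((e j)\<^sup>2 / v j)"
        if "j < Suc d" for j
        using v[OF that] N that \<open>i < d\<close> by (simp add: \<theta>_def power2_eq_square field_simps)
      then have "(\<Sum>j<Suc d. v j * (\<theta> X j i)\<^sup>2) =
        (\<Sum>j<Suc d. v j * (X j i)\<^sup>2 - 4 / N * s X i * (e j * X j i) + 4 / N\<^sup>2 * (s X i)\<^sup>2 * ((e j)\<^sup>2 / v j))"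
        by (intro sum.cong refl) auto
      also have "\<dots> = (\<Sum>j<Suc d. v j * (X j i)\<^sup>2) - 4 / N * s X i * s X i + 4 / N\<^sup>2 * (s X i)\<^sup>2 * N"
        unfolding sum.distrib sum_diff_mult sum_distrib_left[symmetric] by (simp only: s_def N_def)
      also have "\<dots> = (\<Sum>j<Suc d. v j * (X j i)\<^sup>2)"
        using N by (simp add: power2_eq_square)
      finally show ?thesis .
    qed
    then show ?thesis using v by (simp add: gauss_weight_eq del: sum.lessThan_Suc)
  qed
  have vol_\<theta>: "unit_vol d (\<theta> X) = unit_vol d X" for X
    unfolding unit_vol_def wsum_\<theta>
    by (rule lebesgue_d.nn_integral_involution[where f = "\<lambda>w. indicator {..<1} (norm_d d (wsum d X w))"])
       (auto simp: \<rho>_\<rho> \<rho>_add)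
  have "weight_density d v w = (\<integral>\<^sup>+X. ennreal (gauss_weight d v (\<theta> X)) *
     (indicator {..<1} (norm_d d (wsum d (\<theta> X) w)) / unit_vol d (\<theta> X)) \<partial>?P)"
    unfolding weight_density_def
    by (rule points.nn_integral_involution[symmetric, where f = "\<lambda>X. ennreal (gauss_weight d v X) *
     (indicator {..<1} (norm_d d (wsum d X w)) / unit_vol d X)"]) (use w in \<open>auto simp: \<theta>_\<theta> \<theta>_add\<close>)
  also have "\<dots> = weight_density d v w'"
    by (simp add: gauss_\<theta> vol_\<theta> wsum_\<theta> \<rho>_w weight_density_def)
  finally show ?thesis .
qed simp

text \<open>Left unnormalized. The quotient by \<open>full_mass d v\<close> is the conditional
  probability, given sum 0, that Gaussians of variances 2 v_j are nonnegative at the indices from k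
  on; the constants of the densities are common to both masses.\<close>

definition cone_mass :: "nat \<Rightarrow> nat \<Rightarrow> (nat \<Rightarrow> real) \<Rightarrow> ennreal" where
  "cone_mass d k v = (\<integral>\<^sup>+w. indicator (face_cone d k) w * ennreal (exp (- weight_form d v w)) \<partial>lebesgue_d d)"

definition full_mass :: "nat \<Rightarrow> (nat \<Rightarrow> real) \<Rightarrow> ennreal" where
  "full_mass d v = (\<integral>\<^sup>+w. ennreal (exp (- weight_form d v w)) \<partial>lebesgue_d d)"

abbreviation cone_ratio :: "nat \<Rightarrow> nat \<Rightarrow> (nat \<Rightarrow> real) \<Rightarrow> ennreal" where
  "cone_ratio d k v \<equiv> cone_mass d k v / full_mass d v"

section \<open>Scaling of the quadratic form and radial functions\<close>

lemma weight_form_measurable_fixed [measurable]: "weight_form d v \<in> borel_measurable (lebesgue_d d)"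
  unfolding weight_form_def
  by (intro borel_measurable_sum borel_measurable_divide borel_measurable_power borel_measurable_const
      full_weight_measurable[of "\<lambda>x. x" _ d]) auto

lemma weight_form_scale: "weight_form d v (\<lambda>i\<in>{..<d}. r * w i) = r\<^sup>2 * weight_form d v w"
  unfolding weight_form_def sum_distrib_left
  by (intro sum.cong refl) (simp add: full_weight_scale power_mult_distrib)

lemma weight_form_nonneg: "(\<And>j. j < Suc d \<Longrightarrow> 0 < v j) \<Longrightarrow> 0 \<le> weight_form d v w"
  unfolding weight_form_def by (intro sum_nonneg divide_nonneg_nonneg) (auto simp: less_imp_le)

lemma emeasure_weight_form_less:
  assumes v: "\<And>j. j < Suc d \<Longrightarrow> 0 < v j"
  shows "emeasure (lebesgue_d d) {w \<in> space (lebesgue_d d). weight_form d v w < r} < \<infinity>"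
proof -
  interpret product_sigma_finite "\<lambda>_::nat. lborel :: real measure" by standard
  define a where "a i = sqrt (4 * v (Suc i) * \<bar>r\<bar>)" for i
  have "{w \<in> space (lebesgue_d d). weight_form d v w < r} \<subseteq> Pi\<^sub>E {..<d} (\<lambda>i. {- a i..a i})"
  proof
    fix w assume "w \<in> {w \<in> space (lebesgue_d d). weight_form d v w < r}"
    then have w: "w \<in> space (lebesgue_d d)" "weight_form d v w < r" by auto
    have "\<bar>w i\<bar> \<le> a i" if i: "i < d" for i
    proof -
      have "(full_weight d w (Suc i))\<^sup>2 / (4 * v (Suc i)) \<le> weight_form d v w"
        unfolding weight_form_def
        by (rule member_le_sum) (use i v in \<open>auto intro!: divide_nonneg_nonneg simp: less_imp_le\<close>)
      then have "(w i)\<^sup>2 / (4 * v (Suc i)) \<le> \<bar>r\<bar>" using w(2) by simp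
      then have "(w i)\<^sup>2 \<le> 4 * v (Suc i) * \<bar>r\<bar>" using v[of "Suc i"] i by (simp add: divide_le_eq mult_ac)
      then show ?thesis unfolding a_def by (intro real_le_rsqrt) simp
    qed
    then show "w \<in> Pi\<^sub>E {..<d} (\<lambda>i. {- a i..a i})"
      using w(1) by (auto simp: space_lebesgue_d PiE_iff abs_le_iff minus_le_iff)
  qed
  then have "emeasure (lebesgue_d d) {w \<in> space (lebesgue_d d). weight_form d v w < r} \<le>
    emeasure (lebesgue_d d) (Pi\<^sub>E {..<d} (\<lambda>i. {- a i..a i}))"
    by (rule emeasure_mono) (auto simp: lebesgue_d_def intro!: sets_PiM_I_finite)
  also have "\<dots> = (\<Prod>i<d. emeasure lborel {- a i..a i})"
    unfolding lebesgue_d_def by (rule emeasure_PiM) auto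
  also have "\<dots> < \<infinity>"
    by (simp add: ennreal_prod_eq_top less_top[symmetric] emeasure_lborel_Icc_eq)
  finally show ?thesis .
qed

text \<open>Both \<open>F\<close> and \<open>exp (- weight_form)\<close> are functions of the quadratic form \<open>weight_form\<close>, whose law
  under Lebesgue measure restricted to a cone is determined up to a factor by scaling.\<close>

lemma cone_radial_integral:
  assumes v: "\<And>j. j < Suc d \<Longrightarrow> 0 < v j" and d: "0 < d"
    and F [measurable]: "F \<in> borel_measurable (lebesgue_d d)"
    and rad: "\<And>w w'. w \<in> space (lebesgue_d d) \<Longrightarrow> w' \<in> space (lebesgue_d d) \<Longrightarrow>
       weight_form d v w = weight_form d v w' \<Longrightarrow> F w = F w'"
  shows "(\<integral>\<^sup>+w. indicator (face_cone d k) w * F w \<partial>lebesgue_d d) * full_mass d v =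
    cone_mass d k v * (\<integral>\<^sup>+w. F w \<partial>lebesgue_d d)"
proof -
  let ?V = "lebesgue_d d" and ?Q = "weight_form d v"
  define A where "A r = emeasure ?V {w \<in> space ?V. ?Q w < r}" for r
  define B where "B r = emeasure ?V {w \<in> face_cone d k. ?Q w < r}" for r
  have mB [measurable]: "{w \<in> face_cone d k. ?Q w < r} \<in> sets ?V" for r
  proof -
    have "{w \<in> face_cone d k. ?Q w < r} = face_cone d k \<inter> {w \<in> space ?V. ?Q w < r}"
      by (auto simp: face_cone_def)
    then show ?thesis by simp
  qed
  have Q_nonneg: "0 \<le> ?Q w" for w by (rule weight_form_nonneg) (rule v)
  have A_fin: "A r < \<infinity>" for r unfolding A_def by (rule emeasure_weight_form_less[OF v])
  have BA: "B r \<le> A r" for r unfolding A_def B_def by (rule emeasure_mono) (auto simp: face_cone_def)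
  \<comment> \<open>Dilation by sqrt r carries the sublevel set at 1 to that at r and preserves the
    cone, so the volumes A and B pick up the same factor.\<close>
  have scale: "\<exists>b. 0 < b \<and> b < \<infinity> \<and> A 1 = b * A r \<and> B 1 = b * B r" if r: "0 < r" for r
  proof -
    interpret s: translation_iso ?V "add_d d" "neg_d d"
      ?V "add_d d" "neg_d d"
      "\<lambda>x. \<lambda>i\<in>{..<d}. sqrt r * x i" "\<lambda>x. \<lambda>i\<in>{..<d}. x i / sqrt r"
      by (rule translation_iso_scale) (use r in auto)
    obtain b where b: "0 < b" "b < \<infinity>"
      "\<And>A. A \<in> sets ?V \<Longrightarrow> emeasure ?V ((\<lambda>x. \<lambda>i\<in>{..<d}. sqrt r * x i) -` A \<inter> space ?V) = b * emeasure ?V A"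
      by (rule s.emeasure_vimage_proportional) blast
    have "(\<lambda>x. \<lambda>i\<in>{..<d}. sqrt r * x i) -` {w \<in> space ?V. ?Q w < r} \<inter> space ?V = {w \<in> space ?V. ?Q w < 1}"
      using r by (auto simp: weight_form_scale space_lebesgue_d)
    moreover have "(\<lambda>x. \<lambda>i\<in>{..<d}. sqrt r * x i) -` {w \<in> face_cone d k. ?Q w < r} \<inter> space ?V =
        {w \<in> face_cone d k. ?Q w < 1}"
      using r by (auto simp: weight_form_scale space_lebesgue_d face_cone_def zero_le_mult_iff)
    ultimately have "A 1 = b * A r" "B 1 = b * B r"
      using b(3)[of "{w \<in> space ?V. ?Q w < r}"] b(3)[OF mB, of r] by (auto simp: A_def B_def)
    with b(1,2) show ?thesis by blast
  qed
  have A0: "A 1 \<noteq> 0"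
  proof
    assume 0: "A 1 = 0"
    have "A (real (Suc n)) = 0" for n
      using scale[of "real (Suc n)"] 0 by auto
    then have "(\<Union>n. {w \<in> space ?V. ?Q w < real (Suc n)}) \<in> null_sets ?V"
      by (intro null_sets_UN) (auto simp: null_sets_def A_def)
    moreover have "(\<Union>n. {w \<in> space ?V. ?Q w < real (Suc n)}) = space ?V"
    proof safe
      fix w assume "w \<in> space ?V"
      obtain n where "?Q w < real n" using reals_Archimedean2 by blast
      then have "?Q w < real (Suc n)" by simp
      then show "w \<in> (\<Union>n. {w \<in> space ?V. ?Q w < real (Suc n)})" using \<open>w \<in> space ?V\<close> by blast
    qed
    ultimately show False using lebesgue_d.space_nonnull[of d] by auto
  qed
  have cross: "A 1 * B r = B 1 * A r" if "0 < r" for r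
    using scale[OF that] by (auto simp: mult_ac)
  \<comment> \<open>The law of the form, weighted by B 1, and its law on the cone, weighted by A 1.
    The minus sign turns sublevel sets into rays unbounded above, which are the sets on which the
    two measures are compared.\<close>
  define \<mu> where "\<mu> = scale_measure (B 1) (distr ?V borel (\<lambda>w. - ?Q w))"
  define \<nu> where "\<nu> = scale_measure (A 1) (distr (density ?V (indicator (face_cone d k))) borel (\<lambda>w. - ?Q w))"
  have \<nu>_val: "emeasure \<nu> {x<..} = A 1 * B (- x)" for x
  proof -
    have "emeasure \<nu> {x<..} = A 1 * (\<integral>\<^sup>+w. indicator (face_cone d k) w * indicator ((\<lambda>w. - ?Q w) -` {x<..} \<inter> space ?V) w \<partial>?V)"
      by (simp add: \<nu>_def emeasure_distr emeasure_density)
    also have "(\<integral>\<^sup>+w. indicator (face_cone d k) w * indicator ((\<lambda>w. - ?Q w) -` {x<..} \<inter> space ?V) w \<partial>?V) =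
      (\<integral>\<^sup>+w. indicator {w \<in> face_cone d k. ?Q w < - x} w \<partial>?V)"
      by (intro nn_integral_cong) (auto simp: indicator_def face_cone_def)
    also have "\<dots> = B (- x)" by (simp add: B_def)
    finally show ?thesis .
  qed
  have \<mu>_val: "emeasure \<mu> {x<..} = B 1 * A (- x)" for x
  proof -
    have "(\<lambda>w. - ?Q w) -` {x<..} \<inter> space ?V = {w \<in> space ?V. ?Q w < - x}" by auto
    then show ?thesis by (simp add: \<mu>_def emeasure_distr A_def)
  qed
  have "\<mu> = \<nu>"
  proof (rule measure_eqI_lessThan)
    show "sets \<mu> = sets borel" "sets \<nu> = sets borel" by (auto simp: \<mu>_def \<nu>_def)
    fix x :: real
    have "B 1 < \<infinity>" using BA[of 1] A_fin[of 1] by (rule le_less_trans)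
    then show "emeasure \<mu> {x<..} < \<infinity>" using A_fin[of "- x"] by (simp add: \<mu>_val ennreal_mult_less_top)
    show "emeasure \<mu> {x<..} = emeasure \<nu> {x<..}"
    proof (cases "x < 0")
      case True
      then show ?thesis using cross[of "- x"] by (simp add: \<mu>_val \<nu>_val)
    next
      case False
      then have "{w \<in> space ?V. ?Q w < - x} = {}"
        by (auto simp: not_less intro!: order_trans[OF _ Q_nonneg])
      then have "A (- x) = 0" "B (- x) = 0"
        using BA[of "- x"] by (auto simp: A_def simp del: Collect_empty_eq)
      then show ?thesis by (simp add: \<mu>_val \<nu>_val)
    qed
  qed
  have main: "A 1 * (\<integral>\<^sup>+w. indicator (face_cone d k) w * f (- ?Q w) \<partial>?V) = B 1 * (\<integral>\<^sup>+w. f (- ?Q w) \<partial>?V)"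
    if [measurable]: "f \<in> borel_measurable borel" for f :: "real \<Rightarrow> ennreal"
  proof -
    have "A 1 * (\<integral>\<^sup>+w. indicator (face_cone d k) w * f (- ?Q w) \<partial>?V) = (\<integral>\<^sup>+x. f x \<partial>\<nu>)"
      by (simp add: \<nu>_def nn_integral_scale_measure nn_integral_distr nn_integral_density)
    also have "\<dots> = (\<integral>\<^sup>+x. f x \<partial>\<mu>)" by (simp add: \<open>\<mu> = \<nu>\<close>)
    also have "\<dots> = B 1 * (\<integral>\<^sup>+w. f (- ?Q w) \<partial>?V)"
      by (simp add: \<mu>_def nn_integral_scale_measure nn_integral_distr)
    finally show ?thesis .
  qed
  \<comment> \<open>A reference point with positive form; this is where d > 0 enters. For x at most
    0 its multiple by \<open>sqrt (- x / ?Q u)\<close> has form - x, so F, being a function of the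
    form, can be evaluated there.\<close>
  define u where "u = (\<lambda>i\<in>{..<d}. 1 :: real)"
  have "(full_weight d u (Suc 0))\<^sup>2 / (4 * v (Suc 0)) \<le> ?Q u"
    unfolding weight_form_def
    by (rule member_le_sum) (use d v in \<open>auto intro!: divide_nonneg_nonneg simp: less_imp_le\<close>)
  moreover have "0 < (full_weight d u (Suc 0))\<^sup>2 / (4 * v (Suc 0))" using d v[of "Suc 0"] by (simp add: u_def)
  ultimately have Qu: "0 < ?Q u" by linarith
  define f where "f x = F (\<lambda>i\<in>{..<d}. sqrt (- x / ?Q u) * u i)" for x
  have [measurable]: "f \<in> borel_measurable borel"
  proof -
    have "(\<lambda>x. \<lambda>i\<in>{..<d}. sqrt (- x / ?Q u) * u i) \<in> borel \<rightarrow>\<^sub>M ?V"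
      by (intro measurable_lebesgue_dI) measurable
    then show ?thesis unfolding f_def by (rule measurable_compose) simp
  qed
  have fF: "f (- ?Q w) = F w" if "w \<in> space ?V" for w
    unfolding f_def
  proof (rule rad[OF _ that])
    show "?Q (\<lambda>i\<in>{..<d}. sqrt (- (- ?Q w) / ?Q u) * u i) = ?Q w"
      using Qu Q_nonneg[of w] by (simp add: weight_form_scale)
  qed (auto simp: space_lebesgue_d)
  have 1: "A 1 * (\<integral>\<^sup>+w. indicator (face_cone d k) w * F w \<partial>?V) = B 1 * (\<integral>\<^sup>+w. F w \<partial>?V)"
    using main[of f] by (simp add: fF cong: nn_integral_cong)
  have 2: "A 1 * cone_mass d k v = B 1 * full_mass d v"
    using main[of "\<lambda>x. ennreal (exp x)"] by (simp add: cone_mass_def full_mass_def)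
  have "A 1 * ((\<integral>\<^sup>+w. indicator (face_cone d k) w * F w \<partial>?V) * full_mass d v) =
    (A 1 * (\<integral>\<^sup>+w. indicator (face_cone d k) w * F w \<partial>?V)) * full_mass d v"
    by (simp only: mult.assoc)
  also have "\<dots> = (B 1 * full_mass d v) * (\<integral>\<^sup>+w. F w \<partial>?V)"
    unfolding 1 by (simp only: mult_ac)
  also have "\<dots> = A 1 * (cone_mass d k v * (\<integral>\<^sup>+w. F w \<partial>?V))"
    unfolding 2[symmetric] by (simp only: mult_ac)
  finally have "A 1 * ((\<integral>\<^sup>+w. indicator (face_cone d k) w * F w \<partial>?V) * full_mass d v) =
    A 1 * (cone_mass d k v * (\<integral>\<^sup>+w. F w \<partial>?V))" .
  then show ?thesis using A0 A_fin[of 1] by (auto simp: ennreal_mult_cancel_left)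
qed

section \<open>Gaussian mixtures and the expected angle\<close>

definition gamma_dens :: "real \<Rightarrow> real \<Rightarrow> real" where
  "gamma_dens s v = (if 0 < v then v powr (s - 1) * exp (- v) / Gamma s else 0)"

lemma gamma_dens_nonneg: "0 < s \<Longrightarrow> 0 \<le> gamma_dens s v"
  using Gamma_real_pos[of s] by (simp add: gamma_dens_def)

lemma gamma_dens_measurable [measurable]: "gamma_dens s \<in> borel_measurable borel"
  unfolding gamma_dens_def by measurable

lemma nn_integral_powr_exp:
  assumes s: "0 < s" and c: "0 < c"
  shows "(\<integral>\<^sup>+v. ennreal (indicator {0<..} v * (v powr (s - 1) * exp (- (c * v)))) \<partial>lborel) = ennreal (Gamma s / c powr s)"
proof -
  have "ennreal (Gamma s) = (\<integral>\<^sup>+t. ennreal (indicator {0..} t * t powr (s - 1) / exp t) \<partial>lborel)"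
    by (rule Gamma_conv_nn_integral_real[OF s])
  also have "\<dots> = ennreal c * (\<integral>\<^sup>+v. ennreal (indicator {0..} (0 + c * v) * (0 + c * v) powr (s - 1) / exp (0 + c * v)) \<partial>lborel)"
    using c by (subst nn_integral_real_affine[of _ c 0]) auto
  also have "\<dots> = ennreal c * (\<integral>\<^sup>+v. ennreal (c powr (s - 1)) * ennreal (indicator {0<..} v * (v powr (s - 1) * exp (- (c * v)))) \<partial>lborel)"
  proof (intro arg_cong[where f = "\<lambda>x. ennreal c * x"] nn_integral_cong_AE)
    show "AE v in lborel. ennreal (indicator {0..} (0 + c * v) * (0 + c * v) powr (s - 1) / exp (0 + c * v)) =
      ennreal (c powr (s - 1)) * ennreal (indicator {0<..} v * (v powr (s - 1) * exp (- (c * v))))"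
      using AE_lborel_singleton[of 0]
    proof eventually_elim
      case (elim v)
      then show ?case
        using c by (auto simp: indicator_def zero_le_mult_iff ennreal_mult'[symmetric] powr_mult exp_minus field_simps)
    qed
  qed
  also have "\<dots> = ennreal (c powr s) * (\<integral>\<^sup>+v. ennreal (indicator {0<..} v * (v powr (s - 1) * exp (- (c * v)))) \<partial>lborel)"
  proof -
    have "c powr s = c * c powr (s - 1)" using c powr_add[of c 1 "s - 1"] by simp
    then have "ennreal (c powr s) = ennreal c * ennreal (c powr (s - 1))" using c by (simp add: ennreal_mult')
    then show ?thesis by (simp only: mult.assoc) (subst nn_integral_cmult, auto)
  qed
  finally have eq: "ennreal (Gamma s) = ennreal (c powr s) * (\<integral>\<^sup>+v. ennreal (indicator {0<..} v * (v powr (s - 1) * exp (- (c * v)))) \<partial>lborel)" .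
  show ?thesis
  proof -
    have cs: "0 < c powr s" using c by simp
    have "(\<integral>\<^sup>+v. ennreal (indicator {0<..} v * (v powr (s - 1) * exp (- (c * v)))) \<partial>lborel) =
       ennreal (inverse (c powr s)) * (ennreal (c powr s) * (\<integral>\<^sup>+v. ennreal (indicator {0<..} v * (v powr (s - 1) * exp (- (c * v)))) \<partial>lborel))"
      using c by (simp add: mult.assoc[symmetric] ennreal_mult'[symmetric])
    also have "\<dots> = ennreal (inverse (c powr s)) * ennreal (Gamma s)" by (simp only: eq)
    also have "\<dots> = ennreal (Gamma s / c powr s)"
      using cs by (subst ennreal_mult'[symmetric]) (auto simp: divide_inverse mult.commute)
    finally show ?thesis .
  qed
qed

lemma nn_integral_gamma_dens_exp:
  assumes s: "0 < s" and c: "0 \<le> c"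
  shows "(\<integral>\<^sup>+v. ennreal (gamma_dens s v * exp (- (c * v))) \<partial>lborel) = ennreal ((1 + c) powr (- s))"
proof -
  have G: "0 < Gamma s" using s by (rule Gamma_real_pos)
  have "(\<integral>\<^sup>+v. ennreal (gamma_dens s v * exp (- (c * v))) \<partial>lborel) =
    (\<integral>\<^sup>+v. ennreal (1 / Gamma s) * ennreal (indicator {0<..} v * (v powr (s - 1) * exp (- ((1 + c) * v)))) \<partial>lborel)"
    by (intro nn_integral_cong)
       (use G in \<open>auto simp: gamma_dens_def indicator_def ennreal_mult'[symmetric] mult_exp_exp algebra_simps\<close>)
  also have "\<dots> = ennreal (1 / Gamma s) * ennreal (Gamma s / (1 + c) powr s)"
    using c s by (subst nn_integral_cmult) (auto simp: nn_integral_powr_exp)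
  also have "\<dots> = ennreal ((1 + c) powr (- s))"
    using G c by (simp add: ennreal_mult'[symmetric] powr_minus divide_inverse)
  finally show ?thesis .
qed

lemma nn_integral_gamma_dens: "0 < s \<Longrightarrow> (\<integral>\<^sup>+v. ennreal (gamma_dens s v) \<partial>lborel) = 1"
  using nn_integral_gamma_dens_exp[of s 0] by simp

lemma nn_integral_gauss:
  assumes "0 < v"
  shows "(\<integral>\<^sup>+x. ennreal (exp (- (v * x\<^sup>2))) \<partial>lborel) = ennreal (sqrt (pi / v))"
proof -
  define \<sigma> where "\<sigma> = sqrt (1 / (2 * v))"
  have \<sigma>: "0 < \<sigma>" "\<sigma>\<^sup>2 = 1 / (2 * v)" using assms by (auto simp: \<sigma>_def)
  have "prob_space (density lborel (\<lambda>x. ennreal (normal_density 0 \<sigma> x)))"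
    by (rule prob_space_normal_density[OF \<sigma>(1)])
  then have "(\<integral>\<^sup>+x. ennreal (normal_density 0 \<sigma> x) \<partial>lborel) = 1"
    by (simp add: prob_space_def prob_space_axioms_def emeasure_density)
  moreover have "normal_density 0 \<sigma> x = sqrt (v / pi) * exp (- (v * x\<^sup>2))" for x
    using assms by (simp add: normal_density_def \<sigma> real_sqrt_divide field_simps)
  ultimately have "ennreal (sqrt (v / pi)) * (\<integral>\<^sup>+x. ennreal (exp (- (v * x\<^sup>2))) \<partial>lborel) = 1"
    using assms by (simp add: ennreal_mult' nn_integral_cmult)
  then have "ennreal (sqrt (pi / v)) * (ennreal (sqrt (v / pi)) * (\<integral>\<^sup>+x. ennreal (exp (- (v * x\<^sup>2))) \<partial>lborel)) = ennreal (sqrt (pi / v))"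
    by simp
  then show ?thesis
    using assms by (simp add: mult.assoc[symmetric] ennreal_mult'[symmetric] real_sqrt_mult[symmetric])
qed

lemma nn_integral_gauss_normalized:
  "0 < v \<Longrightarrow> (\<integral>\<^sup>+x. ennreal (sqrt (v / pi) * exp (- v * x\<^sup>2)) \<partial>lborel) = 1"
proof -
  assume v: "0 < v"
  have "(\<integral>\<^sup>+x. ennreal (sqrt (v / pi) * exp (- v * x\<^sup>2)) \<partial>lborel) =
    (\<integral>\<^sup>+x. ennreal (sqrt (v / pi)) * ennreal (exp (- (v * x\<^sup>2))) \<partial>lborel)"
    using v by (simp add: ennreal_mult')
  also have "\<dots> = ennreal (sqrt (v / pi)) * ennreal (sqrt (pi / v))"
    using v by (simp add: nn_integral_cmult nn_integral_gauss)
  also have "\<dots> = ennreal (sqrt (v / pi) * sqrt (pi / v))"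
    using v by (simp add: ennreal_mult')
  also have "sqrt (v / pi) * sqrt (pi / v) = 1"
    using v by (simp add: real_sqrt_mult[symmetric])
  finally show ?thesis by simp
qed

text \<open>The powers of v in the gamma density and in the d Gaussian factors combine to
  v^((\<alpha>+d)/2 - 1) exp(-(1 + |x|^2) v), again a gamma integrand. The shape \<alpha>/2 is
  \<beta> - d/2 for \<beta> = (\<alpha>+d)/2, and Gamma(\<alpha>/2) pi^(d/2) becomes the denominator
  of the normalizing constant.\<close>

lemma f_tilde_mixture:
  assumes a: "0 < \<alpha>"
  shows "ennreal (f_tilde d ((\<alpha> + real d) / 2) x) =
    (\<integral>\<^sup>+v. ennreal (gamma_dens (\<alpha> / 2) v * (\<Prod>i<d. sqrt (v / pi) * exp (- v * (x i)\<^sup>2))) \<partial>lborel)"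
proof -
  define N where "N = (\<Sum>i<d. (x i)\<^sup>2)"
  define c where "c = 1 / (Gamma (\<alpha> / 2) * pi powr (real d / 2))"
  have N: "0 \<le> N" unfolding N_def by (intro sum_nonneg) auto
  have G: "0 < Gamma (\<alpha> / 2)" using a by (intro Gamma_real_pos) auto
  have c0: "0 < c" using G by (simp add: c_def)
  have integrand: "gamma_dens (\<alpha> / 2) v * (\<Prod>i<d. sqrt (v / pi) * exp (- v * (x i)\<^sup>2)) =
    c * (indicator {0<..} v * (v powr ((\<alpha> + real d) / 2 - 1) * exp (- ((1 + N) * v))))" for v
  proof (cases "0 < v")
    case True
    have "(\<Prod>i<d. sqrt (v / pi) * exp (- v * (x i)\<^sup>2)) = sqrt (v / pi) ^ d * exp (\<Sum>i<d. - v * (x i)\<^sup>2)"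
      by (simp add: prod.distrib exp_sum)
    also have "(\<Sum>i<d. - v * (x i)\<^sup>2) = - (v * N)" by (simp add: N_def sum_distrib_left sum_negf)
    also have "sqrt (v / pi) ^ d = v powr (real d / 2) / pi powr (real d / 2)"
    proof -
      have "sqrt (v / pi) ^ d = (v / pi) powr (real d / 2)"
        using True by (simp add: powr_half_sqrt[symmetric] powr_realpow[symmetric] powr_powr)
      then show ?thesis using True by (simp add: powr_divide)
    qed
    finally have "gamma_dens (\<alpha> / 2) v * (\<Prod>i<d. sqrt (v / pi) * exp (- v * (x i)\<^sup>2)) =
      c * ((v powr (\<alpha> / 2 - 1) * v powr (real d / 2)) * (exp (- v) * exp (- (v * N))))"
      using True by (simp add: gamma_dens_def c_def)
    also have "v powr (\<alpha> / 2 - 1) * v powr (real d / 2) = v powr ((\<alpha> + real d) / 2 - 1)"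
    proof -
      have "\<alpha> / 2 - 1 + real d / 2 = (\<alpha> + real d) / 2 - 1" by (simp add: field_simps)
      then show ?thesis by (simp only: powr_add[symmetric])
    qed
    also have "exp (- v) * exp (- (v * N)) = exp (- ((1 + N) * v))"
      by (simp add: mult_exp_exp algebra_simps)
    finally show ?thesis using True by simp
  qed (simp add: gamma_dens_def)
  have "(\<integral>\<^sup>+v. ennreal (gamma_dens (\<alpha> / 2) v * (\<Prod>i<d. sqrt (v / pi) * exp (- v * (x i)\<^sup>2))) \<partial>lborel) =
    ennreal c * ennreal (Gamma ((\<alpha> + real d) / 2) / (1 + N) powr ((\<alpha> + real d) / 2))"
  proof -
    have "(\<integral>\<^sup>+v. ennreal (gamma_dens (\<alpha> / 2) v * (\<Prod>i<d. sqrt (v / pi) * exp (- v * (x i)\<^sup>2))) \<partial>lborel) =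
      (\<integral>\<^sup>+v. ennreal c * ennreal (indicator {0<..} v * (v powr ((\<alpha> + real d) / 2 - 1) * exp (- ((1 + N) * v)))) \<partial>lborel)"
      unfolding integrand using c0 by (intro nn_integral_cong ennreal_mult') simp
    then show ?thesis using a N by (simp only:) (subst nn_integral_cmult, auto simp: nn_integral_powr_exp)
  qed
  also have "\<dots> = ennreal (c * (Gamma ((\<alpha> + real d) / 2) / (1 + N) powr ((\<alpha> + real d) / 2)))"
    using c0 by (intro ennreal_mult'[symmetric]) simp
  also have "c * (Gamma ((\<alpha> + real d) / 2) / (1 + N) powr ((\<alpha> + real d) / 2)) = f_tilde d ((\<alpha> + real d) / 2) x"
  proof -
    have e1: "(norm_d d x)\<^sup>2 = N" using N by (simp add: norm_d_def N_def)
    have e2: "(\<alpha> + real d) / 2 - real d / 2 = \<alpha> / 2" by (simp add: add_divide_distrib)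
    show ?thesis
      unfolding f_tilde_def c_tilde_d_def c_def e1 e2 powr_minus by (simp add: inverse_eq_divide mult_ac)
  qed
  finally show ?thesis by simp
qed

lemma PiM_density:
  fixes M :: "'a measure" and f :: "'a \<Rightarrow> ennreal"
  assumes "sigma_finite_measure M" "sigma_finite_measure (density M f)" and I: "finite (I :: 'i set)"
    and f [measurable]: "f \<in> borel_measurable M"
  shows "PiM I (\<lambda>_. density M f) = density (PiM I (\<lambda>_. M)) (\<lambda>x. \<Prod>i\<in>I. f (x i))"
proof -
  interpret M: sigma_finite_measure M by fact
  interpret D: sigma_finite_measure "density M f" by fact
  interpret PM: product_sigma_finite "\<lambda>_::'i. M" by standard
  interpret PD: product_sigma_finite "\<lambda>_::'i. density M f" by standard
  have "density (PiM I (\<lambda>_. M)) (\<lambda>x. \<Prod>i\<in>I. f (x i)) = PiM I (\<lambda>_. density M f)"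
  proof (rule PD.PiM_eqI[OF I])
    show "sets (density (PiM I (\<lambda>_. M)) (\<lambda>x. \<Prod>i\<in>I. f (x i))) = sets (PiM I (\<lambda>_. density M f))"
      by (simp cong: sets_PiM_cong)
    fix A assume "\<And>i. i \<in> I \<Longrightarrow> A i \<in> sets (density M f)"
    then have A [measurable]: "\<And>i. i \<in> I \<Longrightarrow> A i \<in> sets M" by simp
    have "emeasure (density (PiM I (\<lambda>_. M)) (\<lambda>x. \<Prod>i\<in>I. f (x i))) (Pi\<^sub>E I A) =
      (\<integral>\<^sup>+x. (\<Prod>i\<in>I. f (x i)) * indicator (Pi\<^sub>E I A) x \<partial>PiM I (\<lambda>_. M))"
      using I A by (intro emeasure_density sets_PiM_I_finite) auto
    also have "\<dots> = (\<integral>\<^sup>+x. (\<Prod>i\<in>I. f (x i) * indicator (A i) (x i)) \<partial>PiM I (\<lambda>_. M))"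
    proof (intro nn_integral_cong)
      fix x assume x: "x \<in> space (PiM I (\<lambda>_. M))"
      have "indicator (Pi\<^sub>E I A) x = (\<Prod>i\<in>I. indicator (A i) (x i) :: ennreal)"
        using x I by (auto simp: indicator_def space_PiM PiE_iff intro!: prod.neutral)
      then show "(\<Prod>i\<in>I. f (x i)) * indicator (Pi\<^sub>E I A) x = (\<Prod>i\<in>I. f (x i) * indicator (A i) (x i))"
        by (simp add: prod.distrib)
    qed
    also have "\<dots> = (\<Prod>i\<in>I. \<integral>\<^sup>+x. f x * indicator (A i) x \<partial>M)"
      using A by (intro PM.product_nn_integral_prod I) measurable
    also have "\<dots> = (\<Prod>i\<in>I. emeasure (density M f) (A i))"
      by (intro prod.cong refl emeasure_density[symmetric]) (use A in auto)
    finally show "emeasure (density (PiM I (\<lambda>_. M)) (\<lambda>x. \<Prod>i\<in>I. f (x i))) (Pi\<^sub>E I A) =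
      (\<Prod>i\<in>I. emeasure (density M f) (A i))" .
  qed
  then show ?thesis by simp
qed

lemma nn_integral_lebesgue_d_prod:
  assumes "\<And>i. i < d \<Longrightarrow> f i \<in> borel_measurable borel"
  shows "(\<integral>\<^sup>+x. (\<Prod>i<d. f i (x i)) \<partial>lebesgue_d d) = (\<Prod>i<d. \<integral>\<^sup>+t. f i t \<partial>lborel)"
proof -
  interpret product_sigma_finite "\<lambda>_::nat. lborel :: real measure" by standard
  show ?thesis unfolding lebesgue_d_def by (rule product_nn_integral_prod) (use assms in auto)
qed

lemma nn_integral_points_prod:
  fixes f :: "nat \<Rightarrow> (nat \<Rightarrow> real) \<Rightarrow> ennreal"
  assumes "\<And>j. j < n \<Longrightarrow> f j \<in> borel_measurable (lebesgue_d d)"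
  shows "(\<integral>\<^sup>+X. (\<Prod>j<n. f j (X j)) \<partial>PiM {..<n} (\<lambda>_. lebesgue_d d)) = (\<Prod>j<n. \<integral>\<^sup>+x. f j x \<partial>lebesgue_d d)"
proof -
  interpret product_sigma_finite "\<lambda>_::nat. lebesgue_d d" by standard
  show ?thesis by (rule product_nn_integral_prod) (use assms in auto)
qed

lemma gauss_factor_measurable [measurable]:
  "(\<lambda>x. \<Prod>i<d. ennreal (sqrt (v / pi) * exp (- v * (x i)\<^sup>2))) \<in> borel_measurable (lebesgue_d d)"
proof -
  have [measurable]: "(\<lambda>x. x i) \<in> borel_measurable (lebesgue_d d)" if "i \<in> {..<d}" for i
    using that by (intro measurable_lebesgue_d_nth[of "\<lambda>x. x" _ d]) auto
  show ?thesis by measurable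
qed

lemma nn_integral_gauss_weight:
  assumes v: "\<And>j. j < Suc d \<Longrightarrow> 0 < v j"
  shows "(\<integral>\<^sup>+X. ennreal (gauss_weight d v X) \<partial>points d) = 1"
proof -
  have "ennreal (gauss_weight d v X) = (\<Prod>j<Suc d. \<Prod>i<d. ennreal (sqrt (v j / pi) * exp (- v j * (X j i)\<^sup>2)))" for X
  proof -
    have "ennreal (gauss_weight d v X) = (\<Prod>j<Suc d. ennreal (\<Prod>i<d. sqrt (v j / pi) * exp (- v j * (X j i)\<^sup>2)))"
      unfolding gauss_weight_def
      by (rule prod_ennreal[symmetric]) (use v in \<open>auto intro!: prod_nonneg simp: less_imp_le\<close>)
    also have "\<dots> = (\<Prod>j<Suc d. \<Prod>i<d. ennreal (sqrt (v j / pi) * exp (- v j * (X j i)\<^sup>2)))"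
      by (intro prod.cong refl prod_ennreal[symmetric]) (use v in \<open>auto simp: less_imp_le\<close>)
    finally show ?thesis .
  qed
  then have "(\<integral>\<^sup>+X. ennreal (gauss_weight d v X) \<partial>points d) =
    (\<Prod>j<Suc d. \<integral>\<^sup>+x. (\<Prod>i<d. ennreal (sqrt (v j / pi) * exp (- v j * (x i)\<^sup>2))) \<partial>lebesgue_d d)"
    by (simp only:) (rule nn_integral_points_prod[where f = "\<lambda>j x. \<Prod>i<d. ennreal (sqrt (v j / pi) * exp (- v j * (x i)\<^sup>2))"], measurable)
  also have "\<dots> = (\<Prod>j<Suc d. 1)"
  proof (intro prod.cong refl)
    fix j assume "j \<in> {..<Suc d}"
    then have "0 < v j" using v by auto
    then have "(\<integral>\<^sup>+x. ennreal (sqrt (v j / pi) * exp (- v j * x\<^sup>2)) \<partial>lborel) = 1"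
      by (rule nn_integral_gauss_normalized)
    then show "(\<integral>\<^sup>+x. (\<Prod>i<d. ennreal (sqrt (v j / pi) * exp (- v j * (x i)\<^sup>2))) \<partial>lebesgue_d d) = 1"
      by (subst nn_integral_lebesgue_d_prod) auto
  qed
  finally show ?thesis by simp
qed

lemma unit_vol_eq: "unit_vol d X = emeasure (lebesgue_d d) {w \<in> space (lebesgue_d d). norm_d d (wsum d X w) < 1}"
proof -
  have "unit_vol d X = (\<integral>\<^sup>+w. indicator {w \<in> space (lebesgue_d d). norm_d d (wsum d X w) < 1} w \<partial>lebesgue_d d)"
    unfolding unit_vol_def by (intro nn_integral_cong) (auto simp: indicator_def)
  then show ?thesis by simp
qed

lemma unit_vol_pos_finite:
  assumes "edge_det d X \<noteq> 0" "0 < d"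
  shows "unit_vol d X \<noteq> 0" "unit_vol d X \<noteq> \<infinity>"
  using internal_angle_nondegenerate(2,3)[OF assms(1), of 1] assms(2) by (auto simp: unit_vol_eq)

lemma weight_density_measurable [measurable]: "weight_density d v \<in> borel_measurable (lebesgue_d d)"
proof -
  show ?thesis unfolding weight_density_def by measurable
qed

text \<open>Tonelli over points and weights. For nondegenerate X the quotient on the right is the
  internal angle if A is the face cone, and it is 1 if A is the whole space (in positive
  dimension).\<close>

lemma nn_integral_weight_density_cone:
  assumes [measurable]: "A \<in> sets (lebesgue_d d)"
  shows "(\<integral>\<^sup>+w. indicator A w * weight_density d v w \<partial>lebesgue_d d) =
    (\<integral>\<^sup>+X. ennreal (gauss_weight d v X) *
      ((\<integral>\<^sup>+w. indicator A w * indicator {..<1} (norm_d d (wsum d X w)) \<partial>lebesgue_d d) / unit_vol d X)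
     \<partial>points d)"
proof -
  let ?P = "points d" and ?V = "lebesgue_d d"
  interpret PV: pair_sigma_finite ?P ?V by standard
  have "(\<integral>\<^sup>+w. indicator A w * weight_density d v w \<partial>?V) =
    (\<integral>\<^sup>+w. \<integral>\<^sup>+X. indicator A w * (ennreal (gauss_weight d v X) * (indicator {..<1} (norm_d d (wsum d X w)) / unit_vol d X)) \<partial>?P \<partial>?V)"
    unfolding weight_density_def by (intro nn_integral_cong nn_integral_cmult[symmetric]) measurable
  also have "\<dots> = (\<integral>\<^sup>+X. \<integral>\<^sup>+w. indicator A w * (ennreal (gauss_weight d v X) * (indicator {..<1} (norm_d d (wsum d X w)) / unit_vol d X)) \<partial>?V \<partial>?P)"
    by (rule PV.Fubini') measurable
  also have "\<dots> = (\<integral>\<^sup>+X. ennreal (gauss_weight d v X) *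
      ((\<integral>\<^sup>+w. indicator A w * indicator {..<1} (norm_d d (wsum d X w)) \<partial>?V) / unit_vol d X) \<partial>?P)"
  proof (intro nn_integral_cong)
    fix X
    have "(\<integral>\<^sup>+w. indicator A w * (ennreal (gauss_weight d v X) * (indicator {..<1} (norm_d d (wsum d X w)) / unit_vol d X)) \<partial>?V) =
      (\<integral>\<^sup>+w. (ennreal (gauss_weight d v X) / unit_vol d X) * (indicator A w * indicator {..<1} (norm_d d (wsum d X w))) \<partial>?V)"
      by (intro nn_integral_cong) (simp add: divide_ennreal_def mult_ac)
    also have "\<dots> = (ennreal (gauss_weight d v X) / unit_vol d X) * (\<integral>\<^sup>+w. indicator A w * indicator {..<1} (norm_d d (wsum d X w)) \<partial>?V)"
      by (rule nn_integral_cmult) measurable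
    finally show "(\<integral>\<^sup>+w. indicator A w * (ennreal (gauss_weight d v X) * (indicator {..<1} (norm_d d (wsum d X w)) / unit_vol d X)) \<partial>?V) =
      ennreal (gauss_weight d v X) * ((\<integral>\<^sup>+w. indicator A w * indicator {..<1} (norm_d d (wsum d X w)) \<partial>?V) / unit_vol d X)"
      by (simp add: divide_ennreal_def mult_ac)
  qed
  finally show ?thesis .
qed

lemma nn_integral_weight_density:
  assumes v: "\<And>j. j < Suc d \<Longrightarrow> 0 < v j" and d: "0 < d"
  shows "(\<integral>\<^sup>+w. weight_density d v w \<partial>lebesgue_d d) = 1"
proof -
  let ?P = "points d" and ?V = "lebesgue_d d"
  have "(\<integral>\<^sup>+w. weight_density d v w \<partial>?V) = (\<integral>\<^sup>+w. indicator (space ?V) w * weight_density d v w \<partial>?V)"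
    by (intro nn_integral_cong) simp
  also have "\<dots> = (\<integral>\<^sup>+X. ennreal (gauss_weight d v X) *
      ((\<integral>\<^sup>+w. indicator (space ?V) w * indicator {..<1} (norm_d d (wsum d X w)) \<partial>?V) / unit_vol d X) \<partial>?P)"
    by (rule nn_integral_weight_density_cone) simp
  also have "\<dots> = (\<integral>\<^sup>+X. ennreal (gauss_weight d v X) \<partial>?P)"
  proof (rule nn_integral_cong_AE, use AE_edge_det_nonzero[of d] in eventually_elim)
    case (elim X)
    have "(\<integral>\<^sup>+w. indicator (space ?V) w * indicator {..<1} (norm_d d (wsum d X w)) \<partial>?V) = unit_vol d X"
      unfolding unit_vol_def by (intro nn_integral_cong) simp
    then show ?case using unit_vol_pos_finite[OF elim d] by (simp add: ennreal_divide_self less_top)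
  qed
  also have "\<dots> = 1" by (rule nn_integral_gauss_weight[OF v])
  finally show ?thesis .
qed

lemma full_mass_pos_finite:
  assumes v: "\<And>j. j < Suc d \<Longrightarrow> 0 < v j"
  shows "full_mass d v \<noteq> 0" "full_mass d v \<noteq> \<infinity>"
proof -
  show "full_mass d v \<noteq> 0"
  proof
    assume "full_mass d v = 0"
    then have "AE w in lebesgue_d d. ennreal (exp (- weight_form d v w)) = 0"
      unfolding full_mass_def by (subst (asm) nn_integral_0_iff_AE) auto
    then have "AE w in lebesgue_d d. False" by simp
    then have "emeasure (lebesgue_d d) (space (lebesgue_d d)) = 0"
      by (simp add: AE_iff_measurable[of "space (lebesgue_d d)"])
    then show False using lebesgue_d.space_nonnull[of d] by simp
  qed
  have "full_mass d v \<le> (\<integral>\<^sup>+w. (\<Prod>i<d. ennreal (exp (- (1 / (4 * v (Suc i)) * (w i)\<^sup>2)))) \<partial>lebesgue_d d)"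
    unfolding full_mass_def
  proof (intro nn_integral_mono)
    fix w
    \<comment> \<open>Dropping the nonnegative term of index 0 leaves a sum over the free weights,
      so the bound is a product of one-dimensional Gaussians.\<close>
    have "(\<Sum>i<d. 1 / (4 * v (Suc i)) * (w i)\<^sup>2) \<le> weight_form d v w"
      unfolding weight_form_def sum.lessThan_Suc_shift using v[of 0] by (simp add: less_imp_le)
    then have "exp (- weight_form d v w) \<le> (\<Prod>i<d. exp (- (1 / (4 * v (Suc i)) * (w i)\<^sup>2)))"
      by (simp add: exp_sum[symmetric] sum_negf)
    then show "ennreal (exp (- weight_form d v w)) \<le> (\<Prod>i<d. ennreal (exp (- (1 / (4 * v (Suc i)) * (w i)\<^sup>2))))"
      by (subst prod_ennreal) (auto intro: ennreal_leI)
  qed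
  also have "\<dots> = (\<Prod>i<d. \<integral>\<^sup>+t. ennreal (exp (- (1 / (4 * v (Suc i)) * t\<^sup>2))) \<partial>lborel)"
    by (rule nn_integral_lebesgue_d_prod) measurable
  also have "\<dots> = (\<Prod>i<d. ennreal (sqrt (pi / (1 / (4 * v (Suc i))))))"
    by (intro prod.cong refl nn_integral_gauss) (use v in auto)
  also have "\<dots> < \<infinity>" by (simp add: ennreal_prod_eq_top less_top[symmetric])
  finally show "full_mass d v \<noteq> \<infinity>" by simp
qed

text \<open>The density of the weights is not explicit, but it depends on the form only and has
  total mass 1. Its share in the cone is therefore that of any other function of the form, here the
  Gaussian.\<close>

lemma nn_integral_cone_weight_density:
  assumes v: "\<And>j. j < Suc d \<Longrightarrow> 0 < v j" and d: "0 < d"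
  shows "(\<integral>\<^sup>+w. indicator (face_cone d k) w * weight_density d v w \<partial>lebesgue_d d) = cone_ratio d k v"
proof -
  have "(\<integral>\<^sup>+w. indicator (face_cone d k) w * weight_density d v w \<partial>lebesgue_d d) * full_mass d v =
    cone_mass d k v * (\<integral>\<^sup>+w. weight_density d v w \<partial>lebesgue_d d)"
    by (rule cone_radial_integral[OF v d]) (auto intro: weight_density_radial[OF v])
  then have "(\<integral>\<^sup>+w. indicator (face_cone d k) w * weight_density d v w \<partial>lebesgue_d d) * full_mass d v / full_mass d v =
    cone_ratio d k v"
    by (simp add: nn_integral_weight_density[OF v d])
  then show ?thesis using full_mass_pos_finite[of d v, OF v] by (simp add: mult_divide_eq_ennreal)
qed

section \<open>The expected angle as a gamma average\<close>

lemma ennreal_internal_angle: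
  assumes det: "edge_det d X \<noteq> 0" and k: "1 \<le> k" "k \<le> d"
  shows "ennreal (internal_angle d X {..<k} {..<Suc d}) =
    (\<integral>\<^sup>+w. indicator (face_cone d k) w * indicator {..<1} (norm_d d (wsum d X w)) \<partial>lebesgue_d d) / unit_vol d X"
proof -
  let ?V = "lebesgue_d d"
  let ?G = "{w \<in> face_cone d k. norm_d d (wsum d X w) < 1}"
  have G: "?G = face_cone d k \<inter> {w \<in> space ?V. norm_d d (wsum d X w) < 1}" by (auto simp: face_cone_def)
  then have [measurable]: "?G \<in> sets ?V" by simp
  have "(\<integral>\<^sup>+w. indicator (face_cone d k) w * indicator {..<1} (norm_d d (wsum d X w)) \<partial>?V) = (\<integral>\<^sup>+w. indicator ?G w \<partial>?V)"
    by (intro nn_integral_cong) (auto simp: indicator_def)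
  also have "\<dots> = emeasure ?V ?G" by simp
  finally have eq: "(\<integral>\<^sup>+w. indicator (face_cone d k) w * indicator {..<1} (norm_d d (wsum d X w)) \<partial>?V) = emeasure ?V ?G" .
  have d: "0 < d" using k by simp
  note fin = unit_vol_pos_finite[OF det d]
  have "emeasure ?V ?G \<le> unit_vol d X" unfolding unit_vol_eq G by (rule emeasure_mono) auto
  then have "emeasure ?V ?G \<noteq> \<infinity>" using fin by (auto simp: top_unique)
  then have "emeasure ?V ?G = ennreal (measure ?V ?G)" by (simp add: emeasure_eq_ennreal_measure)
  moreover have "unit_vol d X = ennreal (measure ?V {w \<in> space ?V. norm_d d (wsum d X w) < 1})"
    using fin unfolding unit_vol_eq by (simp add: emeasure_eq_ennreal_measure)
  moreover have "0 < measure ?V {w \<in> space ?V. norm_d d (wsum d X w) < 1}"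
    using fin calculation(2) by (metis ennreal_0 measure_nonneg order_le_less)
  ultimately show ?thesis unfolding eq internal_angle_nondegenerate(1)[OF det k] by (simp add: divide_ennreal)
qed

text \<open>The defining limit gives no direct access to measurability; the quotient of two
  parameter integrals on nondegenerate X, with value 0 elsewhere, does.\<close>

lemma internal_angle_measurable:
  assumes k: "1 \<le> k" "k \<le> d"
  shows "(\<lambda>X. internal_angle d X {..<k} {..<Suc d}) \<in> borel_measurable (points d)"
proof -
  have "internal_angle d X {..<k} {..<Suc d} = (if edge_det d X = 0 then 0 else enn2real
    ((\<integral>\<^sup>+w. indicator (face_cone d k) w * indicator {..<1} (norm_d d (wsum d X w)) \<partial>lebesgue_d d) / unit_vol d X))" for X
  proof (cases "edge_det d X = 0")
    case False
    have "0 \<le> internal_angle d X {..<k} {..<Suc d}" unfolding internal_angle_nondegenerate(1)[OF False k] by simp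
    then show ?thesis using False ennreal_internal_angle[OF False k] by (metis enn2real_ennreal)
  qed (simp add: internal_angle_degenerate)
  then show ?thesis by (simp only:) measurable
qed

abbreviation gamma_prod :: "real \<Rightarrow> nat \<Rightarrow> (nat \<Rightarrow> real) \<Rightarrow> ennreal" where
  "gamma_prod s n \<equiv> \<lambda>v. \<Prod>j<n. ennreal (gamma_dens s (v j))"

text \<open>Identities that require all v_j > 0 become valid for every v after multiplication by the
  gamma weight, with no exceptional set to carry along.\<close>

lemma prod_gamma_dens_eq_0:
  assumes "\<not> (\<forall>j<n. 0 < v j)"
  shows "(\<Prod>j<n. gamma_dens s (v j)) = 0" "gamma_prod s n v = 0"
proof -
  obtain j where "j < n" "\<not> 0 < v j" using assms by auto
  then show "(\<Prod>j<n. gamma_dens s (v j)) = 0" "gamma_prod s n v = 0"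
    by (auto intro!: prod_zero bexI[of _ j] simp: gamma_dens_def)
qed

lemma gamma_prod_measurable [measurable]:
  "gamma_prod s n \<in> borel_measurable (lebesgue_d n)"
proof (rule borel_measurable_prod_ennreal)
  fix j assume "j \<in> {..<n}"
  then have [measurable]: "(\<lambda>v. v j) \<in> borel_measurable (lebesgue_d n)"
    by (intro measurable_lebesgue_d_nth[of "\<lambda>x. x" _ n]) auto
  show "(\<lambda>v. ennreal (gamma_dens s (v j))) \<in> borel_measurable (lebesgue_d n)" by measurable
qed

text \<open>Writing each density as a Gaussian mixture and applying Tonelli brings the integral over
  the variance parameters outside; for fixed \<open>v\<close> the Gaussian average of the angle is
  the cone ratio.\<close>

lemma expected_angle:
  assumes a: "0 < \<alpha>" and k: "1 \<le> k" "k \<le> d"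
  shows "(\<integral>X. internal_angle d X {..<k} {..<Suc d} \<partial>PiM {..<Suc d} (\<lambda>_. beta'_distr d ((\<alpha> + real d) / 2))) =
    enn2real (\<integral>\<^sup>+v. gamma_prod (\<alpha> / 2) (Suc d) v * (cone_ratio d k v) \<partial>lebesgue_d (Suc d))"
proof -
  let ?P = "points d" and ?V = "lebesgue_d d" and ?U = "lebesgue_d (Suc d)"
  let ?f = "f_tilde d ((\<alpha> + real d) / 2)" and ?ang = "\<lambda>X. internal_angle d X {..<k} {..<Suc d}"
  let ?A = "\<lambda>X. (\<integral>\<^sup>+w. indicator (face_cone d k) w * indicator {..<1} (norm_d d (wsum d X w)) \<partial>?V) / unit_vol d X"
  have d: "0 < d" using k by simp
  interpret PU: pair_sigma_finite ?P ?U by standard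
  have f_meas [measurable]: "?f \<in> borel_measurable ?V" unfolding f_tilde_def by measurable
  have "sigma_finite_measure (density ?V (\<lambda>x. ennreal (?f x)))"
    by (subst lebesgue_d.sigma_finite_iff_density_finite) auto
  then have D: "PiM {..<Suc d} (\<lambda>_. beta'_distr d ((\<alpha> + real d) / 2)) = density ?P (\<lambda>X. \<Prod>j<Suc d. ennreal (?f (X j)))"
    unfolding beta'_distr_def by (intro PiM_density lebesgue_d.sigma_finite_measure_axioms) auto
  have [measurable]: "(\<lambda>X. \<Prod>j<Suc d. ennreal (?f (X j))) \<in> borel_measurable ?P"
  proof (rule borel_measurable_prod_ennreal)
    fix j assume "j \<in> {..<Suc d}"
    then have "(\<lambda>X. X j) \<in> ?P \<rightarrow>\<^sub>M ?V" by (rule measurable_component_singleton)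
    then show "(\<lambda>X. ennreal (?f (X j))) \<in> borel_measurable ?P" by measurable
  qed
  note [measurable] = internal_angle_measurable[OF k]
  have ang_nonneg: "0 \<le> ?ang X" for X
    by (cases "edge_det d X = 0") (simp_all add: internal_angle_degenerate internal_angle_nondegenerate(1)[OF _ k])
  have mix: "(\<Prod>j<Suc d. ennreal (?f (X j))) =
    (\<integral>\<^sup>+v. gamma_prod (\<alpha> / 2) (Suc d) v * ennreal (gauss_weight d v X) \<partial>?U)" for X
  proof -
    have "(\<Prod>j<Suc d. ennreal (?f (X j))) =
      (\<Prod>j<Suc d. \<integral>\<^sup>+t. ennreal (gamma_dens (\<alpha> / 2) t * (\<Prod>i<d. sqrt (t / pi) * exp (- t * (X j i)\<^sup>2))) \<partial>lborel)"
      by (simp only: f_tilde_mixture[OF a])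
    also have "\<dots> = (\<integral>\<^sup>+v. (\<Prod>j<Suc d. ennreal (gamma_dens (\<alpha> / 2) (v j) * (\<Prod>i<d. sqrt (v j / pi) * exp (- v j * (X j i)\<^sup>2)))) \<partial>?U)"
      by (rule nn_integral_lebesgue_d_prod[symmetric]) measurable
    also have "\<dots> = (\<integral>\<^sup>+v. gamma_prod (\<alpha> / 2) (Suc d) v * ennreal (gauss_weight d v X) \<partial>?U)"
    proof (intro nn_integral_cong)
      fix v :: "nat \<Rightarrow> real"
      show "(\<Prod>j<Suc d. ennreal (gamma_dens (\<alpha> / 2) (v j) * (\<Prod>i<d. sqrt (v j / pi) * exp (- v j * (X j i)\<^sup>2)))) =
        gamma_prod (\<alpha> / 2) (Suc d) v * ennreal (gauss_weight d v X)"
      proof (cases "\<forall>j<Suc d. 0 < v j")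
        case True
        have "(\<Prod>j<Suc d. ennreal (gamma_dens (\<alpha> / 2) (v j) * (\<Prod>i<d. sqrt (v j / pi) * exp (- v j * (X j i)\<^sup>2)))) =
          (\<Prod>j<Suc d. ennreal (gamma_dens (\<alpha> / 2) (v j)) * ennreal (\<Prod>i<d. sqrt (v j / pi) * exp (- v j * (X j i)\<^sup>2)))"
          by (intro prod.cong refl ennreal_mult' gamma_dens_nonneg) (use a in auto)
        also have "\<dots> = gamma_prod (\<alpha> / 2) (Suc d) v * ennreal (gauss_weight d v X)"
        proof -
          have "(\<Prod>j<Suc d. ennreal (\<Prod>i<d. sqrt (v j / pi) * exp (- v j * (X j i)\<^sup>2))) = ennreal (gauss_weight d v X)"
            unfolding gauss_weight_def
            by (rule prod_ennreal) (use True in \<open>auto intro!: prod_nonneg simp: less_imp_le\<close>)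
          then show ?thesis by (simp only: prod.distrib[of "\<lambda>j. ennreal (gamma_dens (\<alpha> / 2) (v j))"])
        qed
        finally show ?thesis .
      next
        case False
        then obtain j where j: "j < Suc d" "\<not> 0 < v j" by auto
        then have z: "gamma_dens (\<alpha> / 2) (v j) = 0" by (simp add: gamma_dens_def)
        have "(\<Prod>j<Suc d. ennreal (gamma_dens (\<alpha> / 2) (v j) * (\<Prod>i<d. sqrt (v j / pi) * exp (- v j * (X j i)\<^sup>2)))) = 0"
          using j z by (intro prod_zero) (auto intro!: bexI[of _ j])
        moreover have "gamma_prod (\<alpha> / 2) (Suc d) v = 0" using False by (rule prod_gamma_dens_eq_0)
        ultimately show ?thesis by (simp only: mult_zero_left)
      qed
    qed
    finally show ?thesis .
  qed
  have "(\<integral>\<^sup>+X. ennreal (?ang X) \<partial>density ?P (\<lambda>X. \<Prod>j<Suc d. ennreal (?f (X j)))) =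
    (\<integral>\<^sup>+X. (\<Prod>j<Suc d. ennreal (?f (X j))) * ennreal (?ang X) \<partial>?P)"
    by (rule nn_integral_density) measurable
  also have "\<dots> = (\<integral>\<^sup>+X. (\<Prod>j<Suc d. ennreal (?f (X j))) * ?A X \<partial>?P)"
    by (rule nn_integral_cong_AE, use AE_edge_det_nonzero[of d] in eventually_elim)
       (simp only: ennreal_internal_angle[OF _ k] not_False_eq_True)
  also have "\<dots> = (\<integral>\<^sup>+X. \<integral>\<^sup>+v. gamma_prod (\<alpha> / 2) (Suc d) v * ennreal (gauss_weight d v X) * ?A X \<partial>?U \<partial>?P)"
  proof (intro nn_integral_cong)
    fix X assume [simp]: "X \<in> space ?P"
    have "(\<lambda>v. gamma_prod (\<alpha> / 2) (Suc d) v * ennreal (gauss_weight d v X)) \<in> borel_measurable ?U"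
      by (intro borel_measurable_times_ennreal gamma_prod_measurable measurable_compose[OF gauss_weight_measurable measurable_ennreal]) auto
    then show "(\<Prod>j<Suc d. ennreal (?f (X j))) * ?A X =
      (\<integral>\<^sup>+v. gamma_prod (\<alpha> / 2) (Suc d) v * ennreal (gauss_weight d v X) * ?A X \<partial>?U)"
      unfolding mix by (rule nn_integral_multc[symmetric])
  qed
  also have "\<dots> = (\<integral>\<^sup>+v. \<integral>\<^sup>+X. gamma_prod (\<alpha> / 2) (Suc d) v * ennreal (gauss_weight d v X) * ?A X \<partial>?P \<partial>?U)"
    by (rule PU.Fubini'[symmetric]) measurable
  also have "\<dots> = (\<integral>\<^sup>+v. gamma_prod (\<alpha> / 2) (Suc d) v * (cone_ratio d k v) \<partial>?U)"
  proof (intro nn_integral_cong)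
    fix v :: "nat \<Rightarrow> real"
    have "(\<integral>\<^sup>+X. gamma_prod (\<alpha> / 2) (Suc d) v * ennreal (gauss_weight d v X) * ?A X \<partial>?P) =
      gamma_prod (\<alpha> / 2) (Suc d) v * (\<integral>\<^sup>+X. ennreal (gauss_weight d v X) * ?A X \<partial>?P)"
      by (simp only: mult.assoc) (rule nn_integral_cmult, measurable)
    also have "\<dots> = gamma_prod (\<alpha> / 2) (Suc d) v *
      (\<integral>\<^sup>+w. indicator (face_cone d k) w * weight_density d v w \<partial>?V)"
      by (subst nn_integral_weight_density_cone) auto
    also have "\<dots> = gamma_prod (\<alpha> / 2) (Suc d) v * (cone_ratio d k v)"
    proof (cases "\<forall>j<Suc d. 0 < v j")
      case True
      then show ?thesis using nn_integral_cone_weight_density[of d v k] d by simp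
    next
      case False
      then show ?thesis by (simp only: prod_gamma_dens_eq_0 mult_zero_left not_False_eq_True)
    qed
    finally show "(\<integral>\<^sup>+X. gamma_prod (\<alpha> / 2) (Suc d) v * ennreal (gauss_weight d v X) * ?A X \<partial>?P) = \<dots>" .
  qed
  finally have "(\<integral>\<^sup>+X. ennreal (?ang X) \<partial>density ?P (\<lambda>X. \<Prod>j<Suc d. ennreal (?f (X j)))) =
    (\<integral>\<^sup>+v. gamma_prod (\<alpha> / 2) (Suc d) v * (cone_ratio d k v) \<partial>?U)" .
  then show ?thesis unfolding D using ang_nonneg
    by (subst integral_eq_nn_integral) auto
qed

section \<open>Fourier inversion for fixed variances\<close>

text \<open>The index is that of the full weight vector, so entry i of the free weights is governed
  by \<open>sign_set k (Suc i)\<close>, and index 0 is unconstrained whenever 1 \<le> k.\<close>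

definition sign_set :: "nat \<Rightarrow> nat \<Rightarrow> real set" where
  "sign_set k j = (if j < k then UNIV else {0..})"

lemma sign_set_measurable [measurable]: "sign_set k j \<in> sets borel"
  by (simp add: sign_set_def)

lemma integral_lebesgue_d_prod:
  fixes f :: "nat \<Rightarrow> real \<Rightarrow> complex"
  assumes "\<And>i. i < d \<Longrightarrow> integrable lborel (f i)"
  shows "(\<integral>x. (\<Prod>i<d. f i (x i)) \<partial>lebesgue_d d) = (\<Prod>i<d. \<integral>t. f i t \<partial>lborel)"
    and "integrable (lebesgue_d d) (\<lambda>x. \<Prod>i<d. f i (x i))"
proof -
  interpret product_sigma_finite "\<lambda>_::nat. lborel :: real measure" by standard
  show "(\<integral>x. (\<Prod>i<d. f i (x i)) \<partial>lebesgue_d d) = (\<Prod>i<d. \<integral>t. f i t \<partial>lborel)"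
    unfolding lebesgue_d_def by (rule product_integral_prod) (use assms in auto)
  show "integrable (lebesgue_d d) (\<lambda>x. \<Prod>i<d. f i (x i))"
    unfolding lebesgue_d_def by (rule product_integrable_prod) (use assms in auto)
qed

lemma prod_indicator_sign_set:
  assumes "w \<in> space (lebesgue_d d)"
  shows "(\<Prod>i<d. indicator (sign_set k (Suc i)) (w i)) = (indicator (face_cone d k) w :: real)"
proof (cases "w \<in> face_cone d k")
  case True
  then show ?thesis by (auto simp: face_cone_def sign_set_def indicator_def intro!: prod.neutral)
next
  case False
  then obtain i where i: "i < d" "k \<le> Suc i" "w i < 0" using assms by (auto simp: face_cone_def not_le)
  then have "indicator (sign_set k (Suc i)) (w i) = (0::real)" by (simp add: sign_set_def)
  then have "(\<Prod>i<d. indicator (sign_set k (Suc i)) (w i)) = (0::real)"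
    using i(1) by (intro prod_zero) (auto intro!: bexI[of _ i])
  then show ?thesis using False by simp
qed

lemma weight_form_split:
  "weight_form d v w = (\<Sum>i<d. w i)\<^sup>2 / (4 * v 0) + (\<Sum>i<d. (w i)\<^sup>2 / (4 * v (Suc i)))"
  unfolding weight_form_def sum.lessThan_Suc_shift by simp

text \<open>The weight of index 0 is minus the sum S of the others, and the integral over t of
  exp(-v_0 t^2) exp(i t S) is 2 pi times its Gaussian density at S: this is Fourier inversion at 0.
  Since 1 \<le> k, the factor of index 0 is the full-line transform, whose integrability in t makes
  the joint integrand integrable and justifies Fubini.\<close>

lemma integral_prod_gchar:
  assumes v: "\<And>j. j < Suc d \<Longrightarrow> 0 < v j" and k: "1 \<le> k"
  shows "(\<integral>t. (\<Prod>j<Suc d. gchar (sign_set k j) (v j) t) \<partial>lborel) =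
    complex_of_real (sqrt (pi / v 0) * (\<Prod>i<d. 1 / sqrt (4 * pi * v (Suc i))) * enn2real (cone_mass d k v))"
proof -
  let ?V = "lebesgue_d d"
  interpret VT: pair_sigma_finite ?V "lborel :: real measure" by standard
  interpret TV: pair_sigma_finite "lborel :: real measure" ?V by standard
  have v0: "0 < v 0" using v by simp
  define h where "h i w = complex_of_real (indicator (sign_set k (Suc i)) w * gdens (v (Suc i)) w)" for i w
  define H where "H w = (\<Prod>i<d. h i (w i))" for w
  define E where "E t = complex_of_real (exp (- (v 0 * t\<^sup>2)))" for t
  define S where "S w = (\<Sum>i<d. w i)" for w :: "nat \<Rightarrow> real"
  have nth [measurable]: "(\<lambda>w. w i) \<in> borel_measurable ?V" if "i \<in> {..<d}" for i
    using that by (intro measurable_lebesgue_d_nth[of "\<lambda>x. x" _ d]) auto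
  have hm [measurable]: "h i \<in> borel_measurable borel" for i unfolding h_def by measurable
  have Hm [measurable]: "H \<in> borel_measurable ?V" unfolding H_def by measurable
  have Sm [measurable]: "S \<in> borel_measurable ?V" unfolding S_def by measurable
  have Em [measurable]: "E \<in> borel_measurable borel" unfolding E_def by measurable
  have hi: "integrable lborel (\<lambda>w. h i w * iexp (t * w))" if "i < d" for i t
    unfolding h_def by (rule integrable_gchar) (use v that in auto)
  have Hint: "integrable ?V H"
    unfolding H_def by (rule integral_lebesgue_d_prod(2)) (use hi[of _ 0] in simp)
  have Eint: "integrable lborel E"
  proof -
    have "(\<integral>\<^sup>+t. ennreal (norm (E t)) \<partial>lborel) < \<infinity>"
      using nn_integral_gauss[OF v0] by (simp add: E_def)
    then show ?thesis by (intro integrableI_bounded) auto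
  qed
  have prod_eq: "(\<Prod>j<Suc d. gchar (sign_set k j) (v j) t) = (\<integral>w. E t * (H w * iexp (t * S w)) \<partial>?V)" for t
  proof -
    have "(\<Prod>j<Suc d. gchar (sign_set k j) (v j) t) =
      gchar (sign_set k 0) (v 0) t * (\<Prod>i<d. gchar (sign_set k (Suc i)) (v (Suc i)) t)"
      by (rule prod.lessThan_Suc_shift)
    also have "gchar (sign_set k 0) (v 0) t = E t"
      using k gchar_UNIV[OF v0] by (simp add: sign_set_def E_def)
    also have "(\<Prod>i<d. gchar (sign_set k (Suc i)) (v (Suc i)) t) = (\<integral>w. (\<Prod>i<d. h i (w i) * iexp (t * w i)) \<partial>?V)"
      unfolding gchar_def h_def[symmetric] by (rule integral_lebesgue_d_prod(1)[symmetric]) (use hi in auto)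
    also have "\<dots> = (\<integral>w. H w * iexp (t * S w) \<partial>?V)"
      by (simp add: H_def S_def prod.distrib exp_sum[symmetric] sum_distrib_left)
    finally show ?thesis by simp
  qed
  have norm_eq: "norm (E t * (H w * iexp (t * S w))) = norm (E t) * norm (H w)" for t w
    by (simp add: norm_mult)
  have int: "integrable (lborel \<Otimes>\<^sub>M ?V) (\<lambda>(t, w). E t * (H w * iexp (t * S w)))"
  proof (rule TV.Fubini_integrable)
    show "(\<lambda>(t, w). E t * (H w * iexp (t * S w))) \<in> borel_measurable (lborel \<Otimes>\<^sub>M ?V)" by measurable
    show "integrable lborel (\<lambda>t. \<integral>w. norm (case (t, w) of (t, w) \<Rightarrow> E t * (H w * iexp (t * S w))) \<partial>?V)"
      unfolding prod.case norm_eq integral_mult_right_zero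
      by (intro integrable_mult_left integrable_norm Eint)
    show "AE t in lborel. integrable ?V (\<lambda>w. case (t, w) of (t, w) \<Rightarrow> E t * (H w * iexp (t * S w)))"
    proof (intro AE_I2)
      fix t
      have "integrable ?V (\<lambda>w. H w * iexp (t * S w))"
        by (rule Bochner_Integration.integrable_bound[OF Hint]) (auto simp: norm_mult)
      then show "integrable ?V (\<lambda>w. case (t, w) of (t, w) \<Rightarrow> E t * (H w * iexp (t * S w)))" by simp
    qed
  qed
  have "(\<integral>t. (\<Prod>j<Suc d. gchar (sign_set k j) (v j) t) \<partial>lborel) = (\<integral>t. \<integral>w. E t * (H w * iexp (t * S w)) \<partial>?V \<partial>lborel)"
    by (simp only: prod_eq)
  also have "\<dots> = (\<integral>w. \<integral>t. E t * (H w * iexp (t * S w)) \<partial>lborel \<partial>?V)"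
    by (rule TV.Fubini_integral[symmetric, OF int])
  also have "\<dots> = (\<integral>w. complex_of_real (sqrt (pi / v 0) * (\<Prod>i<d. 1 / sqrt (4 * pi * v (Suc i))) *
      (indicator (face_cone d k) w * exp (- weight_form d v w))) \<partial>?V)"
  proof (rule Bochner_Integration.integral_cong[OF refl])
    fix w assume w: "w \<in> space ?V"
    have Hw: "H w = complex_of_real (indicator (face_cone d k) w * ((\<Prod>i<d. 1 / sqrt (4 * pi * v (Suc i))) *
        exp (- (\<Sum>i<d. (w i)\<^sup>2 / (4 * v (Suc i))))))"
    proof -
      have "H w = complex_of_real ((\<Prod>i<d. indicator (sign_set k (Suc i)) (w i)) * (\<Prod>i<d. gdens (v (Suc i)) (w i)))"
        by (simp add: H_def h_def prod.distrib)
      also have "(\<Prod>i<d. gdens (v (Suc i)) (w i)) = (\<Prod>i<d. 1 / sqrt (4 * pi * v (Suc i))) * exp (- (\<Sum>i<d. (w i)\<^sup>2 / (4 * v (Suc i))))"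
        by (simp add: gdens_def prod_dividef exp_sum[symmetric] sum_negf)
      finally show ?thesis by (simp only: prod_indicator_sign_set[OF w])
    qed
    have "(\<integral>t. E t * (H w * iexp (t * S w)) \<partial>lborel) = (\<integral>t. H w * (E t * iexp (S w * t)) \<partial>lborel)"
      by (simp add: mult_ac)
    also have "\<dots> = H w * complex_of_real (sqrt (pi / v 0) * exp (- (S w)\<^sup>2 / (4 * v 0)))"
      unfolding E_def integral_mult_right_zero by (simp only: integral_gauss_iexp[OF v0])
    also have "H w * complex_of_real (sqrt (pi / v 0) * exp (- (S w)\<^sup>2 / (4 * v 0))) =
      complex_of_real (sqrt (pi / v 0) * (\<Prod>i<d. 1 / sqrt (4 * pi * v (Suc i))) *
        (indicator (face_cone d k) w * (exp (- (S w)\<^sup>2 / (4 * v 0)) * exp (- (\<Sum>i<d. (w i)\<^sup>2 / (4 * v (Suc i)))))))"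
      unfolding Hw by (simp only: of_real_mult mult_ac)
    also have "exp (- (S w)\<^sup>2 / (4 * v 0)) * exp (- (\<Sum>i<d. (w i)\<^sup>2 / (4 * v (Suc i)))) = exp (- weight_form d v w)"
      unfolding weight_form_split S_def by (simp add: mult_exp_exp)
    finally show "(\<integral>t. E t * (H w * iexp (t * S w)) \<partial>lborel) = complex_of_real (sqrt (pi / v 0) *
      (\<Prod>i<d. 1 / sqrt (4 * pi * v (Suc i))) * (indicator (face_cone d k) w * exp (- weight_form d v w)))" .
  qed
  also have "\<dots> = complex_of_real (sqrt (pi / v 0) * (\<Prod>i<d. 1 / sqrt (4 * pi * v (Suc i))) *
      (\<integral>w. indicator (face_cone d k) w * exp (- weight_form d v w) \<partial>?V))"
    unfolding integral_complex_of_real integral_mult_right_zero ..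
  also have "(\<integral>w. indicator (face_cone d k) w * exp (- weight_form d v w) \<partial>?V) = enn2real (cone_mass d k v)"
    unfolding cone_mass_def
    by (subst integral_eq_nn_integral) (auto intro!: arg_cong[where f = enn2real] nn_integral_cong simp: indicator_def)
  finally show ?thesis .
qed

text \<open>The constants are removed by comparison with the instance k = d + 1. There no sign is
  prescribed, the product of the transforms is exp(-(sum_j v_j) t^2), and its integral is sqrt(pi /
  sum_j v_j). The quotient of the general case by this one is the cone ratio.\<close>

lemma integral_prod_gchar_ratio:
  assumes v: "\<And>j. j < Suc d \<Longrightarrow> 0 < v j" and k: "1 \<le> k"
  shows "(\<integral>t. (\<Prod>j<Suc d. gchar (sign_set k j) (v j) t) \<partial>lborel) =
    complex_of_real (sqrt (pi / (\<Sum>j<Suc d. v j)) * enn2real (cone_ratio d k v))"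
proof -
  let ?c = "sqrt (pi / v 0) * (\<Prod>i<d. 1 / sqrt (4 * pi * v (Suc i)))"
  have s: "0 < (\<Sum>j<Suc d. v j)" by (rule sum_pos) (use v in auto)
  have full: "cone_mass d (Suc d) v = full_mass d v"
    unfolding cone_mass_def full_mass_def by (intro nn_integral_cong) (auto simp: face_cone_def)
  have "(\<integral>t. (\<Prod>j<Suc d. gchar (sign_set (Suc d) j) (v j) t) \<partial>lborel) =
    (\<integral>t. complex_of_real (exp (- ((\<Sum>j<Suc d. v j) * t\<^sup>2))) * iexp (0 * t) \<partial>lborel)"
  proof (intro Bochner_Integration.integral_cong refl)
    fix t :: real
    have "(\<Prod>j<Suc d. gchar (sign_set (Suc d) j) (v j) t) = (\<Prod>j<Suc d. complex_of_real (exp (- (v j * t\<^sup>2))))"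
      by (intro prod.cong refl) (use v in \<open>auto simp: sign_set_def gchar_UNIV\<close>)
    also have "\<dots> = complex_of_real (exp (- ((\<Sum>j<Suc d. v j) * t\<^sup>2)))"
      unfolding of_real_prod[symmetric] by (simp add: exp_sum[symmetric] sum_negf sum_distrib_right del: sum.lessThan_Suc prod.lessThan_Suc)
    finally show "(\<Prod>j<Suc d. gchar (sign_set (Suc d) j) (v j) t) =
      complex_of_real (exp (- ((\<Sum>j<Suc d. v j) * t\<^sup>2))) * iexp (0 * t)" by simp
  qed
  also have "\<dots> = complex_of_real (sqrt (pi / (\<Sum>j<Suc d. v j)))"
    using integral_gauss_iexp[OF s, of 0] by simp
  finally have "complex_of_real (?c * enn2real (full_mass d v)) = complex_of_real (sqrt (pi / (\<Sum>j<Suc d. v j)))"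
    using integral_prod_gchar[of d v "Suc d"] v by (simp only: full)
  then have c: "?c * enn2real (full_mass d v) = sqrt (pi / (\<Sum>j<Suc d. v j))" by (simp only: of_real_eq_iff)
  have fm: "0 < enn2real (full_mass d v)"
    using full_mass_pos_finite[of d v] v by (simp add: enn2real_positive_iff less_top zero_less_iff_neq_zero)
  have "cone_mass d k v \<le> full_mass d v"
    unfolding cone_mass_def full_mass_def by (intro nn_integral_mono) (auto simp: indicator_def)
  then have "enn2real (cone_ratio d k v) = enn2real (cone_mass d k v) / enn2real (full_mass d v)"
    using full_mass_pos_finite[of d v] v
    by (cases "cone_mass d k v"; cases "full_mass d v") (auto simp: divide_ennreal top_unique)
  then have "sqrt (pi / (\<Sum>j<Suc d. v j)) * enn2real (cone_ratio d k v) =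
      (?c * enn2real (full_mass d v)) * (enn2real (cone_mass d k v) / enn2real (full_mass d v))"
    by (simp only: c)
  also have "\<dots> = ?c * enn2real (cone_mass d k v)" using fm by simp
  finally have "?c * enn2real (cone_mass d k v) = sqrt (pi / (\<Sum>j<Suc d. v j)) * enn2real (cone_ratio d k v)" ..
  then show ?thesis using integral_prod_gchar[of d v k] v k by (simp only:)
qed

section \<open>Averaging over the variances\<close>

text \<open>Restricted characteristic function of a Gaussian of random variance 2v with v gamma
  distributed, that is, of a variance-gamma law. Averaging over independent v_j turns a product of
  \<open>gchar\<close> into a product of these.\<close>

definition mixchar :: "real \<Rightarrow> real set \<Rightarrow> real \<Rightarrow> complex" where
  "mixchar s A t = (\<integral>v. complex_of_real (gamma_dens s v) * gchar A v t \<partial>lborel)"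

text \<open>As measurability rules these two match every application of a curried function.\<close>

declare measurable_lebesgue_d_nth [measurable del] points_nth_measurable [measurable del]

lemma gchar_measurable [measurable (raw)]:
  assumes [measurable]: "f \<in> borel_measurable M" "g \<in> borel_measurable M" "A \<in> sets borel"
  shows "(\<lambda>x. gchar A (f x) (g x)) \<in> borel_measurable M"
  unfolding gchar_def gdens_def by measurable

text \<open>With y = sqrt v |t|, the bounds 1 and 1/y interpolate to y^(-\<tau>) for every \<tau> in
  [0,1]. Fractional \<tau> are needed because 1/y is not integrable against a gamma density in v at
  0 when the shape is at most 1/2.\<close>

lemma norm_gchar_sign_set_le:
  assumes v: "0 < v" and t: "t \<noteq> 0" and \<tau>: "0 \<le> \<tau>" "\<tau> \<le> 1"
  shows "norm (gchar (sign_set k j) v t) \<le> (sqrt v * \<bar>t\<bar>) powr (- \<tau>)"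
proof -
  define y where "y = sqrt v * \<bar>t\<bar>"
  have y: "0 < y" using v t by (simp add: y_def)
  have "exp (- (v * t\<^sup>2)) \<le> 1 / y"
  proof -
    have "y\<^sup>2 = v * t\<^sup>2" using v by (simp add: y_def power_mult_distrib)
    moreover have "y \<le> 1 + y\<^sup>2" using sum_squares_bound[of 1 y] y by (simp add: power2_eq_square)
    moreover have "1 + y\<^sup>2 \<le> exp (y\<^sup>2)" by (rule exp_ge_add_one_self)
    ultimately have "y \<le> exp (v * t\<^sup>2)" by (metis order_trans)
    then show ?thesis using y by (simp add: exp_minus field_simps)
  qed
  then have 1: "norm (gchar (sign_set k j) v t) \<le> 1 / y"
    using norm_gchar_half_le[OF v t] by (simp add: sign_set_def gchar_UNIV[OF v] y_def)
  have 2: "norm (gchar (sign_set k j) v t) \<le> 1" by (rule norm_gchar_le_1[OF v]) simp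
  show ?thesis
  proof (cases "1 \<le> y")
    case True
    have "1 / y = y powr (- 1)" using y by (simp add: powr_minus_divide)
    also have "\<dots> \<le> y powr (- \<tau>)" using True \<tau> by (intro powr_mono) auto
    finally show ?thesis using 1 by (simp add: y_def)
  next
    case False
    then have "y powr \<tau> \<le> 1" using y \<tau> by (intro powr_le1) auto
    then have "1 \<le> y powr (- \<tau>)" using y by (simp add: powr_minus_divide)
    then show ?thesis using 2 by (simp add: y_def)
  qed
qed

text \<open>The gamma average of v^(-\<tau>/2) is Gamma(s - \<tau>/2) / Gamma(s), finite since
  \<tau> < 2s; this serves for |t| \<ge> 1. For |t| < 1 the trivial bound 1 is enough. The factor
  2^(\<tau>/2) pays for a single bound in terms of 1 + t^2 on both ranges.\<close>

lemma nn_integral_mixchar_bound: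
  assumes s: "0 < s" and \<tau>: "0 < \<tau>" "\<tau> \<le> 1" "\<tau> < 2 * s"
  defines "C \<equiv> max 1 (Gamma (s - \<tau> / 2) / Gamma s) * 2 powr (\<tau> / 2)"
  shows "(\<integral>\<^sup>+v. ennreal (norm (complex_of_real (gamma_dens s v) * gchar (sign_set k j) v t)) \<partial>lborel) \<le>
    ennreal (C * (1 + t\<^sup>2) powr (- (\<tau> / 2)))"
proof -
  have G: "0 < Gamma s" "0 < Gamma (s - \<tau> / 2)" using s \<tau> by (auto intro!: Gamma_real_pos)
  have half: "2 powr (\<tau> / 2) * (1 + t\<^sup>2) powr (- (\<tau> / 2)) = ((1 + t\<^sup>2) / 2) powr (- (\<tau> / 2))"
    by (simp add: powr_divide powr_minus_divide add_nonneg_nonneg)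
  show ?thesis
  proof (cases "1 \<le> \<bar>t\<bar>")
    case True
    then have t: "t \<noteq> 0" by auto
    have "(\<integral>\<^sup>+v. ennreal (norm (complex_of_real (gamma_dens s v) * gchar (sign_set k j) v t)) \<partial>lborel) \<le>
      (\<integral>\<^sup>+v. ennreal (\<bar>t\<bar> powr (- \<tau>) / Gamma s) * ennreal (indicator {0<..} v * (v powr (s - \<tau> / 2 - 1) * exp (- (1 * v)))) \<partial>lborel)"
    proof (intro nn_integral_mono)
      fix v :: real
      show "ennreal (norm (complex_of_real (gamma_dens s v) * gchar (sign_set k j) v t)) \<le>
        ennreal (\<bar>t\<bar> powr (- \<tau>) / Gamma s) * ennreal (indicator {0<..} v * (v powr (s - \<tau> / 2 - 1) * exp (- (1 * v))))"
      proof (cases "0 < v")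
        case v: True
        have "norm (complex_of_real (gamma_dens s v) * gchar (sign_set k j) v t) = gamma_dens s v * norm (gchar (sign_set k j) v t)"
          using gamma_dens_nonneg[OF s, of v] by (simp add: norm_mult)
        also have "\<dots> \<le> gamma_dens s v * (sqrt v * \<bar>t\<bar>) powr (- \<tau>)"
          using gamma_dens_nonneg[OF s, of v] \<tau> by (intro mult_left_mono norm_gchar_sign_set_le v t) auto
        also have "(sqrt v * \<bar>t\<bar>) powr (- \<tau>) = v powr (- (\<tau> / 2)) * \<bar>t\<bar> powr (- \<tau>)"
          using v by (simp add: powr_mult powr_half_sqrt[symmetric] powr_powr)
        also have "gamma_dens s v * (v powr (- (\<tau> / 2)) * \<bar>t\<bar> powr (- \<tau>)) =
          \<bar>t\<bar> powr (- \<tau>) / Gamma s * ((v powr (s - 1) * v powr (- (\<tau> / 2))) * exp (- v))"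
          using v by (simp add: gamma_dens_def)
        also have "v powr (s - 1) * v powr (- (\<tau> / 2)) = v powr (s - \<tau> / 2 - 1)"
          unfolding powr_add[symmetric] by (rule arg_cong[where f = "(powr) v"]) simp
        finally have "norm (complex_of_real (gamma_dens s v) * gchar (sign_set k j) v t) \<le>
          \<bar>t\<bar> powr (- \<tau>) / Gamma s * (indicator {0<..} v * (v powr (s - \<tau> / 2 - 1) * exp (- (1 * v))))"
          using v by simp
        then show ?thesis using G by (subst ennreal_mult'[symmetric]) (auto intro!: ennreal_leI)
      qed (simp add: gamma_dens_def)
    qed
    also have "\<dots> = ennreal (\<bar>t\<bar> powr (- \<tau>) / Gamma s) * ennreal (Gamma (s - \<tau> / 2) / 1 powr (s - \<tau> / 2))"
      using s \<tau> nn_integral_powr_exp[of "s - \<tau> / 2" 1] by (subst nn_integral_cmult) auto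
    also have "\<dots> = ennreal (Gamma (s - \<tau> / 2) / Gamma s * \<bar>t\<bar> powr (- \<tau>))"
      using G by (subst ennreal_mult'[symmetric]) auto
    also have "\<dots> \<le> ennreal (C * (1 + t\<^sup>2) powr (- (\<tau> / 2)))"
    proof (rule ennreal_leI)
      have "\<bar>t\<bar> powr (- \<tau>) = (t\<^sup>2) powr (- (\<tau> / 2))"
      proof -
        have "t\<^sup>2 = \<bar>t\<bar> powr 2" using t by simp
        then show ?thesis by (simp only: powr_powr) simp
      qed
      also have "\<dots> \<le> ((1 + t\<^sup>2) / 2) powr (- (\<tau> / 2))"
      proof (rule powr_mono2')
        have "1 \<le> t\<^sup>2" using True by (metis one_power2 power2_abs power_mono zero_le_one)
        then show "(1 + t\<^sup>2) / 2 \<le> t\<^sup>2" by simp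
        show "0 < (1 + t\<^sup>2) / 2" by (simp add: add_pos_nonneg)
      qed (use \<tau> in auto)
      finally have "Gamma (s - \<tau> / 2) / Gamma s * \<bar>t\<bar> powr (- \<tau>) \<le>
        max 1 (Gamma (s - \<tau> / 2) / Gamma s) * (2 powr (\<tau> / 2) * (1 + t\<^sup>2) powr (- (\<tau> / 2)))"
        unfolding half using G by (intro mult_mono) auto
      then show "Gamma (s - \<tau> / 2) / Gamma s * \<bar>t\<bar> powr (- \<tau>) \<le> C * (1 + t\<^sup>2) powr (- (\<tau> / 2))"
        by (simp add: C_def mult.assoc)
    qed
    finally show ?thesis .
  next
    case False
    have "(\<integral>\<^sup>+v. ennreal (norm (complex_of_real (gamma_dens s v) * gchar (sign_set k j) v t)) \<partial>lborel) \<le>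
      (\<integral>\<^sup>+v. ennreal (gamma_dens s v) \<partial>lborel)"
    proof (intro nn_integral_mono ennreal_leI)
      fix v :: real
      show "norm (complex_of_real (gamma_dens s v) * gchar (sign_set k j) v t) \<le> gamma_dens s v"
      proof (cases "0 < v")
        case True
        have "gamma_dens s v * norm (gchar (sign_set k j) v t) \<le> gamma_dens s v * 1"
          using gamma_dens_nonneg[OF s, of v] by (intro mult_left_mono norm_gchar_le_1 True) auto
        then show ?thesis using gamma_dens_nonneg[OF s, of v] by (simp add: norm_mult)
      qed (simp add: gamma_dens_def)
    qed
    also have "\<dots> = ennreal 1" by (simp add: nn_integral_gamma_dens[OF s])
    also have "\<dots> \<le> ennreal (C * (1 + t\<^sup>2) powr (- (\<tau> / 2)))"
    proof (rule ennreal_leI)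
      have "t\<^sup>2 \<le> 1" using False by (simp add: abs_square_le_1)
      then have "((1 + t\<^sup>2) / 2) powr (\<tau> / 2) \<le> 1" using \<tau> by (intro powr_le1) auto
      moreover have "0 < ((1 + t\<^sup>2) / 2) powr (\<tau> / 2)" by (simp add: add_nonneg_eq_0_iff)
      ultimately have "1 \<le> ((1 + t\<^sup>2) / 2) powr (- (\<tau> / 2))"
        unfolding powr_minus_divide by (simp only: le_divide_eq_1_pos)
      then have "1 * 1 \<le> max 1 (Gamma (s - \<tau> / 2) / Gamma s) * (2 powr (\<tau> / 2) * (1 + t\<^sup>2) powr (- (\<tau> / 2)))"
        unfolding half by (intro mult_mono) auto
      then show "1 \<le> C * (1 + t\<^sup>2) powr (- (\<tau> / 2))" by (simp add: C_def mult.assoc)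
    qed
    finally show ?thesis .
  qed
qed

text \<open>The power is itself a gamma average of exp(-t^2 v); after the exchange the Gaussian
  integral over t lowers the shape by 1/2. The value is the reciprocal of
  \<open>c_tilde s\<close>.\<close>

lemma nn_integral_one_plus_square_powr:
  assumes s: "1 / 2 < s"
  shows "(\<integral>\<^sup>+t. ennreal ((1 + t\<^sup>2) powr (- s)) \<partial>lborel) = ennreal (sqrt pi * Gamma (s - 1 / 2) / Gamma s)"
proof -
  have s0: "0 < s" using s by simp
  have G: "0 < Gamma s" using s0 by (rule Gamma_real_pos)
  have "(\<integral>\<^sup>+t. ennreal ((1 + t\<^sup>2) powr (- s)) \<partial>lborel) =
    (\<integral>\<^sup>+t. \<integral>\<^sup>+v. ennreal (gamma_dens s v * exp (- (t\<^sup>2 * v))) \<partial>lborel \<partial>lborel)"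
    using s0 by (simp add: nn_integral_gamma_dens_exp)
  also have "\<dots> = (\<integral>\<^sup>+v. \<integral>\<^sup>+t. ennreal (gamma_dens s v * exp (- (t\<^sup>2 * v))) \<partial>lborel \<partial>lborel)"
    by (rule lborel_pair.Fubini'[symmetric]) measurable
  also have "\<dots> = (\<integral>\<^sup>+v. ennreal (sqrt pi / Gamma s) * ennreal (indicator {0<..} v * (v powr (s - 1 / 2 - 1) * exp (- (1 * v)))) \<partial>lborel)"
  proof (intro nn_integral_cong)
    fix v :: real
    show "(\<integral>\<^sup>+t. ennreal (gamma_dens s v * exp (- (t\<^sup>2 * v))) \<partial>lborel) =
      ennreal (sqrt pi / Gamma s) * ennreal (indicator {0<..} v * (v powr (s - 1 / 2 - 1) * exp (- (1 * v))))"
    proof (cases "0 < v")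
      case True
      have "(\<integral>\<^sup>+t. ennreal (gamma_dens s v * exp (- (t\<^sup>2 * v))) \<partial>lborel) =
        (\<integral>\<^sup>+t. ennreal (gamma_dens s v) * ennreal (exp (- (v * t\<^sup>2))) \<partial>lborel)"
        using gamma_dens_nonneg[OF s0, of v] by (intro nn_integral_cong) (simp add: ennreal_mult' mult.commute)
      also have "\<dots> = ennreal (gamma_dens s v) * ennreal (sqrt (pi / v))"
        by (simp add: nn_integral_cmult nn_integral_gauss[OF True])
      also have "\<dots> = ennreal (gamma_dens s v * sqrt (pi / v))"
        using gamma_dens_nonneg[OF s0, of v] by (rule ennreal_mult'[symmetric])
      also have "gamma_dens s v * sqrt (pi / v) = sqrt pi / Gamma s * ((v powr (s - 1) * v powr (- (1 / 2))) * exp (- v))"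
        using True by (simp add: gamma_dens_def real_sqrt_divide powr_minus_divide powr_half_sqrt)
      also have "v powr (s - 1) * v powr (- (1 / 2)) = v powr (s - 1 / 2 - 1)"
        unfolding powr_add[symmetric] by (rule arg_cong[where f = "(powr) v"]) simp
      finally show ?thesis using True G by (subst ennreal_mult'[symmetric]) auto
    qed (simp add: gamma_dens_def)
  qed
  also have "\<dots> = ennreal (sqrt pi / Gamma s) * ennreal (Gamma (s - 1 / 2) / 1 powr (s - 1 / 2))"
    using s nn_integral_powr_exp[of "s - 1 / 2" 1] by (subst nn_integral_cmult) auto
  also have "\<dots> = ennreal (sqrt pi * Gamma (s - 1 / 2) / Gamma s)"
    using G by (subst ennreal_mult'[symmetric]) auto
  finally show ?thesis .
qed

lemma integrable_mixchar_integrand: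
  assumes s: "0 < s"
  shows "integrable lborel (\<lambda>v. complex_of_real (gamma_dens s v) * gchar (sign_set k j) v t)"
proof (rule integrableI_bounded)
  \<comment> \<open>Only finiteness matters here; the exponent \<open>min 1 s\<close> is admissible
    for every positive s.\<close>
  have "(\<integral>\<^sup>+v. ennreal (norm (complex_of_real (gamma_dens s v) * gchar (sign_set k j) v t)) \<partial>lborel) \<le>
    ennreal (max 1 (Gamma (s - min 1 s / 2) / Gamma s) * 2 powr (min 1 s / 2) * (1 + t\<^sup>2) powr (- (min 1 s / 2)))"
    using s by (intro nn_integral_mixchar_bound) (auto simp: min_def)
  then show "(\<integral>\<^sup>+v. ennreal (norm (complex_of_real (gamma_dens s v) * gchar (sign_set k j) v t)) \<partial>lborel) < \<infinity>"
    by (rule le_less_trans) simp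
qed measurable

lemma integrable_mixchar_prod:
  assumes s: "0 < s" and n: "2 \<le> n" "1 < 2 * s * real n"
  shows "integrable (lborel \<Otimes>\<^sub>M lebesgue_d n)
    (\<lambda>(t, v). \<Prod>j<n. complex_of_real (gamma_dens s (v j)) * gchar (sign_set k j) (v j) t)"
proof (rule integrableI_bounded)
  let ?U = "lebesgue_d n"
  let ?f = "\<lambda>(t, v). \<Prod>j<n. complex_of_real (gamma_dens s (v j)) * gchar (sign_set k j) (v j) t"
  have nth [measurable]: "(\<lambda>p. snd p j) \<in> borel_measurable (lborel \<Otimes>\<^sub>M ?U)" if "j \<in> {..<n}" for j
    using that by (intro measurable_lebesgue_d_nth[of snd _ n]) auto
  show fm [measurable]: "?f \<in> borel_measurable (lborel \<Otimes>\<^sub>M ?U)" unfolding case_prod_beta by measurable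
  \<comment> \<open>The n factors together decay like |t|^(-\<tau> n), which is integrable for
    \<tau> n > 1, while the bound for one factor asks for \<tau> \<le> 1 and \<tau> < 2s. Such a
    \<tau> exists because 1/n < 1 for n \<ge> 2, and 1/n < 2s is the hypothesis \<alpha> n > 1 when
    s = \<alpha>/2.\<close>
  obtain \<tau> where \<tau>: "1 / real n < \<tau>" "\<tau> < min 1 (2 * s)"
    using dense[of "1 / real n" "min 1 (2 * s)"] n by (auto simp: divide_less_eq mult_ac)
  have \<tau>0: "0 < \<tau>" using \<tau> n by (auto intro: less_trans[of 0 "1 / real n"])
  define C where "C = max 1 (Gamma (s - \<tau> / 2) / Gamma s) * 2 powr (\<tau> / 2)"
  have C: "0 \<le> C" by (simp add: C_def)
  have "(\<integral>\<^sup>+p. ennreal (norm (?f p)) \<partial>(lborel \<Otimes>\<^sub>M ?U)) = (\<integral>\<^sup>+t. \<integral>\<^sup>+v. ennreal (norm (?f (t, v))) \<partial>?U \<partial>lborel)"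
    by (subst lebesgue_d.nn_integral_fst) auto
  also have "\<dots> \<le> (\<integral>\<^sup>+t. ennreal (C ^ n) * ennreal ((1 + t\<^sup>2) powr (- (\<tau> * n / 2))) \<partial>lborel)"
  proof (intro nn_integral_mono)
    fix t :: real
    have "(\<integral>\<^sup>+v. ennreal (norm (?f (t, v))) \<partial>?U) =
      (\<integral>\<^sup>+v. (\<Prod>j<n. ennreal (norm (complex_of_real (gamma_dens s (v j)) * gchar (sign_set k j) (v j) t))) \<partial>?U)"
      by (intro nn_integral_cong) (simp add: prod_norm[symmetric] prod_ennreal)
    also have "\<dots> = (\<Prod>j<n. \<integral>\<^sup>+v. ennreal (norm (complex_of_real (gamma_dens s v) * gchar (sign_set k j) v t)) \<partial>lborel)"
      by (rule nn_integral_lebesgue_d_prod) measurable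
    also have "\<dots> \<le> (\<Prod>j<n. ennreal (C * (1 + t\<^sup>2) powr (- (\<tau> / 2))))"
      unfolding C_def using s \<tau> \<tau>0 by (intro prod_mono_ennreal nn_integral_mixchar_bound) auto
    also have "\<dots> = ennreal (C ^ n) * ennreal ((1 + t\<^sup>2) powr (- (\<tau> * n / 2)))"
    proof -
      have "((1 + t\<^sup>2) powr (- (\<tau> / 2))) ^ n = (1 + t\<^sup>2) powr (- (\<tau> * n / 2))"
        by (subst powr_realpow[symmetric]) (auto simp: powr_powr add_nonneg_eq_0_iff mult_ac)
      then show ?thesis using C by (simp add: ennreal_power power_mult_distrib ennreal_mult')
    qed
    finally show "(\<integral>\<^sup>+v. ennreal (norm (?f (t, v))) \<partial>?U) \<le> \<dots>" .
  qed
  also have "\<dots> = ennreal (C ^ n) * (\<integral>\<^sup>+t. ennreal ((1 + t\<^sup>2) powr (- (\<tau> * n / 2))) \<partial>lborel)"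
    by (rule nn_integral_cmult) measurable
  also have "\<dots> < \<infinity>"
  proof -
    have "1 / 2 < \<tau> * n / 2" using \<tau>(1) n by (simp add: divide_less_eq)
    then show ?thesis by (simp add: nn_integral_one_plus_square_powr ennreal_mult_less_top)
  qed
  finally show "(\<integral>\<^sup>+p. ennreal (norm (?f p)) \<partial>(lborel \<Otimes>\<^sub>M ?U)) < \<infinity>" .
qed

lemma integral_prod_mixchar:
  assumes s: "0 < s" and d: "1 \<le> d" "1 < 2 * s * real (Suc d)" and k: "1 \<le> k"
  shows "integrable lborel (\<lambda>t. \<Prod>j<Suc d. mixchar s (sign_set k j) t)"
    and "(\<integral>t. (\<Prod>j<Suc d. mixchar s (sign_set k j) t) \<partial>lborel) =
      complex_of_real (\<integral>v. (\<Prod>j<Suc d. gamma_dens s (v j)) *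
        (sqrt (pi / (\<Sum>j<Suc d. v j)) * enn2real (cone_ratio d k v)) \<partial>lebesgue_d (Suc d))"
proof -
  let ?U = "lebesgue_d (Suc d)"
  let ?f = "\<lambda>t v. \<Prod>j<Suc d. complex_of_real (gamma_dens s (v j)) * gchar (sign_set k j) (v j) t"
  interpret pair_sigma_finite "lborel :: real measure" ?U by standard
  have int: "integrable (lborel \<Otimes>\<^sub>M ?U) (\<lambda>(t, v). ?f t v)"
    by (rule integrable_mixchar_prod[OF s]) (use d in auto)
  have prod: "(\<Prod>j<Suc d. mixchar s (sign_set k j) t) = (\<integral>v. ?f t v \<partial>?U)" for t
    unfolding mixchar_def by (rule integral_lebesgue_d_prod(1)[symmetric]) (rule integrable_mixchar_integrand[OF s])
  show "integrable lborel (\<lambda>t. \<Prod>j<Suc d. mixchar s (sign_set k j) t)"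
    unfolding prod using integrable_fst'[OF int] by (simp only: prod.case)
  have "(\<integral>t. (\<Prod>j<Suc d. mixchar s (sign_set k j) t) \<partial>lborel) = (\<integral>v. \<integral>t. ?f t v \<partial>lborel \<partial>?U)"
    unfolding prod by (rule Fubini_integral[symmetric, OF int])
  also have "\<dots> = (\<integral>v. complex_of_real ((\<Prod>j<Suc d. gamma_dens s (v j)) *
        (sqrt (pi / (\<Sum>j<Suc d. v j)) * enn2real (cone_ratio d k v))) \<partial>?U)"
  proof (intro Bochner_Integration.integral_cong refl)
    fix v :: "nat \<Rightarrow> real"
    have "(\<integral>t. ?f t v \<partial>lborel) = complex_of_real (\<Prod>j<Suc d. gamma_dens s (v j)) * (\<integral>t. (\<Prod>j<Suc d. gchar (sign_set k j) (v j) t) \<partial>lborel)"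
      unfolding prod.distrib of_real_prod by (rule integral_mult_right_zero)
    also have "\<dots> = complex_of_real (\<Prod>j<Suc d. gamma_dens s (v j)) *
      complex_of_real (sqrt (pi / (\<Sum>j<Suc d. v j)) * enn2real (cone_ratio d k v))"
    proof (cases "\<forall>j<Suc d. 0 < v j")
      case True
      then have "(\<integral>t. (\<Prod>j<Suc d. gchar (sign_set k j) (v j) t) \<partial>lborel) =
        complex_of_real (sqrt (pi / (\<Sum>j<Suc d. v j)) * enn2real (cone_ratio d k v))"
        by (intro integral_prod_gchar_ratio k) auto
      then show ?thesis by (simp only:)
    next
      case False
      then show ?thesis by (simp only: prod_gamma_dens_eq_0 of_real_0 mult_zero_left not_False_eq_True)
    qed
    finally show "(\<integral>t. ?f t v \<partial>lborel) = complex_of_real ((\<Prod>j<Suc d. gamma_dens s (v j)) *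
        (sqrt (pi / (\<Sum>j<Suc d. v j)) * enn2real (cone_ratio d k v)))"
      by (simp only: of_real_mult)
  qed
  finally show "(\<integral>t. (\<Prod>j<Suc d. mixchar s (sign_set k j) t) \<partial>lborel) =
      complex_of_real (\<integral>v. (\<Prod>j<Suc d. gamma_dens s (v j)) *
        (sqrt (pi / (\<Sum>j<Suc d. v j)) * enn2real (cone_ratio d k v)) \<partial>?U)"
    by (simp only: integral_complex_of_real)
qed

section \<open>Homogeneity in the variances\<close>

lemma weight_form_scale_variance:
  "weight_form d (\<lambda>i\<in>{..<Suc d}. r * v i) w = weight_form d v w / r"
  unfolding weight_form_def sum_divide_distrib by (intro sum.cong refl) (simp add: mult_ac)

lemma ennreal_mult_divide_mult:
  fixes b x y :: ennreal
  assumes "0 < b" "b < \<infinity>"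
  shows "(b * x) / (b * y) = x / y"
proof -
  have "inverse (b * y) = inverse b * inverse y"
    using assms by (intro ennreal_inverse_mult') auto
  then have "(b * x) / (b * y) = (b * inverse b) * (x * inverse y)"
    by (simp add: divide_ennreal_def mult_ac)
  also have "b * inverse b = 1"
    using assms ennreal_divide_self[of b] by (simp add: divide_ennreal_def)
  finally show ?thesis by (simp add: divide_ennreal_def)
qed

text \<open>Rescaling the weights by sqrt r absorbs the factor r in the form and preserves the cone;
  the Jacobian is the same for both masses and cancels.\<close>

lemma cone_ratio_scale:
  assumes r: "0 < r"
  shows "cone_mass d k (\<lambda>i\<in>{..<Suc d}. r * v i) / full_mass d (\<lambda>i\<in>{..<Suc d}. r * v i) = cone_ratio d k v"
proof -
  let ?V = "lebesgue_d d"
  interpret s: translation_iso ?V "add_d d" "neg_d d"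
    ?V "add_d d" "neg_d d"
    "\<lambda>x. \<lambda>i\<in>{..<d}. sqrt r * x i" "\<lambda>x. \<lambda>i\<in>{..<d}. x i / sqrt r"
    by (rule translation_iso_scale) (use r in auto)
  obtain b where b: "0 < b" "b < \<infinity>"
    "\<And>f. f \<in> borel_measurable ?V \<Longrightarrow> (\<integral>\<^sup>+x. f (\<lambda>i\<in>{..<d}. sqrt r * x i) \<partial>?V) = b * (\<integral>\<^sup>+y. f y \<partial>?V)"
    by (rule s.nn_integral_comp_proportional) blast
  have cone: "indicator (face_cone d k) (\<lambda>i\<in>{..<d}. sqrt r * w i) = (indicator (face_cone d k) w :: ennreal)"
    if "w \<in> space ?V" for w
    using r that by (auto simp: indicator_def face_cone_def zero_le_mult_iff space_lebesgue_d)
  have wf: "weight_form d v (\<lambda>i\<in>{..<d}. sqrt r * w i) / r = weight_form d v w" for w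
    using r by (simp add: weight_form_scale)
  have "cone_mass d k v = b * cone_mass d k (\<lambda>i\<in>{..<Suc d}. r * v i)"
    unfolding cone_mass_def weight_form_scale_variance
    by (subst b(3)[symmetric]) (auto intro!: nn_integral_cong simp: cone wf)
  moreover have "full_mass d v = b * full_mass d (\<lambda>i\<in>{..<Suc d}. r * v i)"
    unfolding full_mass_def weight_form_scale_variance
    by (subst b(3)[symmetric]) (auto intro!: nn_integral_cong simp: wf)
  ultimately show ?thesis using ennreal_mult_divide_mult[OF b(1,2)] by simp
qed

lemma cone_ratio_measurable [measurable]:
  "(\<lambda>v. cone_ratio d k v) \<in> borel_measurable (lebesgue_d (Suc d))"
proof -
  have wf [measurable]: "(\<lambda>p. weight_form d (fst p) (snd p)) \<in> borel_measurable (lebesgue_d (Suc d) \<Otimes>\<^sub>M lebesgue_d d)"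
    unfolding weight_form_def
    by (intro borel_measurable_sum borel_measurable_divide borel_measurable_power borel_measurable_times
        borel_measurable_const full_weight_measurable[of snd _ d] measurable_lebesgue_d_nth[of fst _ "Suc d"]) auto
  have "(\<lambda>v. cone_mass d k v) \<in> borel_measurable (lebesgue_d (Suc d))"
    unfolding cone_mass_def
    by (rule lebesgue_d.borel_measurable_nn_integral) (use wf in \<open>simp add: case_prod_beta\<close>)
  moreover have "(\<lambda>v. full_mass d v) \<in> borel_measurable (lebesgue_d (Suc d))"
    unfolding full_mass_def
    by (rule lebesgue_d.borel_measurable_nn_integral) (use wf in \<open>simp add: case_prod_beta\<close>)
  ultimately show ?thesis by measurable
qed

lemma sum_nth_measurable [measurable]: "(\<lambda>v. \<Sum>j<n. v j) \<in> borel_measurable (lebesgue_d n)"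
  by (intro borel_measurable_sum measurable_lebesgue_d_nth[of "\<lambda>x. x" _ n]) auto

text \<open>The exponential tilt by exp(-c v) changes the rate of the gamma density from 1 to 1 + c;
  substituting v = u / (1 + c) restores the original density up to a factor.\<close>

lemma gamma_dens_scale:
  assumes c: "0 \<le> c"
  shows "gamma_dens s (1 / (1 + c) * u) * exp (- (c * (1 / (1 + c) * u))) = (1 + c) powr (1 - s) * gamma_dens s u"
proof (cases "0 < u")
  case True
  have 1: "exp (- (1 / (1 + c) * u)) * exp (- (c * (1 / (1 + c) * u))) = exp (- u)"
  proof -
    have "1 / (1 + c) * u + c * (1 / (1 + c) * u) = (1 + c) * (1 / (1 + c) * u)" by (simp only: distrib_right mult_1_left)
    also have "\<dots> = u" using c by simp
    finally have "1 / (1 + c) * u + c * (1 / (1 + c) * u) = u" .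
    then show ?thesis by (simp only: mult_exp_exp minus_add_distrib[symmetric])
  qed
  have 2: "(1 / (1 + c) * u) powr (s - 1) = (1 + c) powr (1 - s) * u powr (s - 1)"
  proof -
    have "(1 / (1 + c)) powr (s - 1) = (1 + c) powr (1 - s)"
      using c powr_minus[of "1 + c" "s - 1"] by (simp add: powr_divide inverse_eq_divide)
    then show ?thesis using c True by (simp only: powr_mult)
  qed
  have "gamma_dens s (1 / (1 + c) * u) * exp (- (c * (1 / (1 + c) * u))) =
    (1 / (1 + c) * u) powr (s - 1) * (exp (- (1 / (1 + c) * u)) * exp (- (c * (1 / (1 + c) * u)))) / Gamma s"
    using True c by (simp add: gamma_dens_def)
  then show ?thesis unfolding 1 2 using True by (simp add: gamma_dens_def)
next
  case False
  then have "\<not> 0 < 1 / (1 + c) * u" using c by (simp add: zero_less_divide_iff)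
  then show ?thesis using False unfolding gamma_dens_def by (simp only: if_False mult_zero_left mult_zero_right)
qed

text \<open>This replaces the independence of the sum and the direction of a vector of independent
  gamma variables; the constant is read off from the case \<open>P = 1\<close>.\<close>

lemma nn_integral_gamma_prod_exp:
  assumes s: "0 < s" and c: "0 \<le> c" and P [measurable]: "P \<in> borel_measurable (lebesgue_d n)"
    and hom: "\<And>r v. 0 < r \<Longrightarrow> P (\<lambda>i\<in>{..<n}. r * v i) = P v"
  shows "(\<integral>\<^sup>+v. gamma_prod s n v * ennreal (exp (- (c * (\<Sum>j<n. v j)))) * P v \<partial>lebesgue_d n) =
    ennreal ((1 + c) powr (- (real n * s))) * (\<integral>\<^sup>+v. gamma_prod s n v * P v \<partial>lebesgue_d n)"
proof -
  let ?U = "lebesgue_d n"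
  define r where "r = 1 / (1 + c)"
  have r: "0 < r" using c by (simp add: r_def)
  interpret t: translation_iso ?U "add_d n" "neg_d n"
    ?U "add_d n" "neg_d n"
    "\<lambda>x. \<lambda>i\<in>{..<n}. r * x i" "\<lambda>x. \<lambda>i\<in>{..<n}. x i / r"
    by (rule translation_iso_scale) (use r in auto)
  obtain b where b: "0 < b" "b < \<infinity>"
    "\<And>f. f \<in> borel_measurable ?U \<Longrightarrow> (\<integral>\<^sup>+x. f (\<lambda>i\<in>{..<n}. r * x i) \<partial>?U) = b * (\<integral>\<^sup>+y. f y \<partial>?U)"
    by (rule t.nn_integral_comp_proportional) blast
  define K where "K = ennreal (((1 + c) powr (1 - s)) ^ n)"
  define g where "g v = gamma_prod s n v" for v
  define e where "e v = ennreal (exp (- (c * (\<Sum>j<n. v j))))" for v :: "nat \<Rightarrow> real"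
  have gm [measurable]: "g \<in> borel_measurable ?U" unfolding g_def by measurable
  have em [measurable]: "e \<in> borel_measurable ?U" unfolding e_def by measurable
  have ge: "g v * e v = (\<Prod>j<n. ennreal (gamma_dens s (v j) * exp (- (c * v j))))" for v
  proof -
    have "e v = (\<Prod>j<n. ennreal (exp (- (c * v j))))"
      unfolding e_def by (simp add: prod_ennreal exp_sum[symmetric] sum_negf sum_distrib_left)
    then show ?thesis unfolding g_def using gamma_dens_nonneg[OF s]
      by (simp add: prod.distrib[symmetric] ennreal_mult')
  qed
  have scale: "g (\<lambda>i\<in>{..<n}. r * v i) * e (\<lambda>i\<in>{..<n}. r * v i) = K * g v" for v
  proof -
    have "g (\<lambda>i\<in>{..<n}. r * v i) * e (\<lambda>i\<in>{..<n}. r * v i) = (\<Prod>j<n. ennreal ((1 + c) powr (1 - s) * gamma_dens s (v j)))"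
      unfolding ge by (intro prod.cong refl) (use gamma_dens_scale[OF c] in \<open>simp add: r_def\<close>)
    also have "\<dots> = K * g v" by (simp add: ennreal_mult' prod.distrib K_def g_def ennreal_power)
    finally show ?thesis .
  qed
  \<comment> \<open>The substitution of r v for v undoes the tilt, and Q passes through it unchanged
    by homogeneity.\<close>
  have main: "b * (\<integral>\<^sup>+v. g v * e v * Q v \<partial>?U) = K * (\<integral>\<^sup>+v. g v * Q v \<partial>?U)"
    if [measurable]: "Q \<in> borel_measurable ?U" and hQ: "\<And>v. Q (\<lambda>i\<in>{..<n}. r * v i) = Q v" for Q
  proof -
    have "b * (\<integral>\<^sup>+v. g v * e v * Q v \<partial>?U) = (\<integral>\<^sup>+v. K * (g v * Q v) \<partial>?U)"
      by (subst b(3)[symmetric]) (auto intro!: nn_integral_cong simp: scale hQ mult.assoc[symmetric])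
    then show ?thesis by (simp add: nn_integral_cmult)
  qed
  have "(\<integral>\<^sup>+v. g v * e v \<partial>?U) = (\<Prod>j<n. \<integral>\<^sup>+v. ennreal (gamma_dens s v * exp (- (c * v))) \<partial>lborel)"
    unfolding ge by (rule nn_integral_lebesgue_d_prod) measurable
  also have "\<dots> = ennreal ((1 + c) powr (- s)) ^ n" by (simp add: nn_integral_gamma_dens_exp[OF s c])
  also have "\<dots> = ennreal ((1 + c) powr (- (real n * s)))"
    using c by (simp add: ennreal_power powr_realpow[symmetric] powr_powr mult.commute)
  finally have e1: "(\<integral>\<^sup>+v. g v * e v \<partial>?U) = ennreal ((1 + c) powr (- (real n * s)))" .
  have g1: "(\<integral>\<^sup>+v. g v \<partial>?U) = 1"
    unfolding g_def by (subst nn_integral_lebesgue_d_prod) (auto simp: nn_integral_gamma_dens[OF s])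
  have K: "b * ennreal ((1 + c) powr (- (real n * s))) = K"
    using main[of "\<lambda>_. 1"] e1 g1 by simp
  have "b * (\<integral>\<^sup>+v. g v * e v * P v \<partial>?U) = b * (ennreal ((1 + c) powr (- (real n * s))) * (\<integral>\<^sup>+v. g v * P v \<partial>?U))"
    using main[OF P hom[OF r]] unfolding K[symmetric] by (simp only: mult.assoc)
  then have "(\<integral>\<^sup>+v. g v * e v * P v \<partial>?U) = ennreal ((1 + c) powr (- (real n * s))) * (\<integral>\<^sup>+v. g v * P v \<partial>?U)"
    using b(1,2) by (auto simp: ennreal_mult_cancel_left)
  then show ?thesis unfolding g_def e_def .
qed

text \<open>Writing sqrt(pi / sum_j v_j) as the integral of exp(-t^2 sum_j v_j) over t turns the
  weight into exponentials of the sum, and \<open>nn_integral_gamma_prod_exp\<close> applies with c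
  = t^2 for each t separately.\<close>

lemma nn_integral_gamma_prod_sqrt:
  assumes s: "0 < s" and P [measurable]: "P \<in> borel_measurable (lebesgue_d (Suc d))"
    and hom: "\<And>r v. 0 < r \<Longrightarrow> P (\<lambda>i\<in>{..<Suc d}. r * v i) = P v"
  shows "(\<integral>\<^sup>+v. gamma_prod s (Suc d) v * (ennreal (sqrt (pi / (\<Sum>j<Suc d. v j))) * P v) \<partial>lebesgue_d (Suc d)) =
    (\<integral>\<^sup>+t. ennreal ((1 + t\<^sup>2) powr (- (real (Suc d) * s))) \<partial>lborel) *
    (\<integral>\<^sup>+v. gamma_prod s (Suc d) v * P v \<partial>lebesgue_d (Suc d))"
proof -
  let ?U = "lebesgue_d (Suc d)"
  let ?g = "\<lambda>v. \<Prod>j<Suc d. ennreal (gamma_dens s (v j))"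
  interpret UT: pair_sigma_finite ?U "lborel :: real measure" by standard
  have "(\<integral>\<^sup>+v. ?g v * (ennreal (sqrt (pi / (\<Sum>j<Suc d. v j))) * P v) \<partial>?U) =
    (\<integral>\<^sup>+v. \<integral>\<^sup>+t. ?g v * ennreal (exp (- (t\<^sup>2 * (\<Sum>j<Suc d. v j)))) * P v \<partial>lborel \<partial>?U)"
  proof (intro nn_integral_cong)
    fix v :: "nat \<Rightarrow> real"
    have "(\<integral>\<^sup>+t. ?g v * ennreal (exp (- (t\<^sup>2 * (\<Sum>j<Suc d. v j)))) * P v \<partial>lborel) =
      (\<integral>\<^sup>+t. (?g v * P v) * ennreal (exp (- ((\<Sum>j<Suc d. v j) * t\<^sup>2))) \<partial>lborel)"
      by (intro nn_integral_cong) (simp only: mult_ac)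
    also have "\<dots> = (?g v * P v) * (\<integral>\<^sup>+t. ennreal (exp (- ((\<Sum>j<Suc d. v j) * t\<^sup>2))) \<partial>lborel)"
      by (rule nn_integral_cmult) measurable
    also have "\<dots> = ?g v * (ennreal (sqrt (pi / (\<Sum>j<Suc d. v j))) * P v)"
    proof (cases "\<forall>j<Suc d. 0 < v j")
      case True
      then have "0 < (\<Sum>j<Suc d. v j)" by (intro sum_pos) auto
      then show ?thesis by (simp only: nn_integral_gauss mult_ac)
    next
      case False
      then show ?thesis by (simp only: prod_gamma_dens_eq_0 mult_zero_left not_False_eq_True)
    qed
    finally show "?g v * (ennreal (sqrt (pi / (\<Sum>j<Suc d. v j))) * P v) =
      (\<integral>\<^sup>+t. ?g v * ennreal (exp (- (t\<^sup>2 * (\<Sum>j<Suc d. v j)))) * P v \<partial>lborel)" ..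
  qed
  also have "\<dots> = (\<integral>\<^sup>+t. \<integral>\<^sup>+v. ?g v * ennreal (exp (- (t\<^sup>2 * (\<Sum>j<Suc d. v j)))) * P v \<partial>?U \<partial>lborel)"
  proof (rule UT.Fubini'[symmetric])
    show "(\<lambda>(v, t). ?g v * ennreal (exp (- (t\<^sup>2 * (\<Sum>j<Suc d. v j)))) * P v) \<in> borel_measurable (?U \<Otimes>\<^sub>M lborel)"
      unfolding case_prod_beta
    proof (intro borel_measurable_times_ennreal measurable_compose[OF measurable_fst gamma_prod_measurable]
          measurable_compose[OF measurable_fst P])
      have [measurable]: "(\<lambda>p. \<Sum>j<Suc d. fst p j) \<in> borel_measurable (?U \<Otimes>\<^sub>M (lborel :: real measure))"
        by (rule measurable_compose[OF measurable_fst sum_nth_measurable])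
      show "(\<lambda>p. ennreal (exp (- ((snd p)\<^sup>2 * (\<Sum>j<Suc d. fst p j))))) \<in> borel_measurable (?U \<Otimes>\<^sub>M lborel)"
        by measurable
    qed
  qed
  also have "\<dots> = (\<integral>\<^sup>+t. ennreal ((1 + t\<^sup>2) powr (- (real (Suc d) * s))) * (\<integral>\<^sup>+v. ?g v * P v \<partial>?U) \<partial>lborel)"
    by (intro nn_integral_cong nn_integral_gamma_prod_exp s P hom) auto
  also have "\<dots> = (\<integral>\<^sup>+t. ennreal ((1 + t\<^sup>2) powr (- (real (Suc d) * s))) \<partial>lborel) * (\<integral>\<^sup>+v. ?g v * P v \<partial>?U)"
    by (rule nn_integral_multc) measurable
  finally show ?thesis .
qed

text \<open>Fourier inversion yields the average of the cone ratio with the weight sqrt(pi / sum_j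
  v_j). By homogeneity the weight factors out as the integral of (1 + t^2)^(-\<alpha> n / 2) with n
  = d + 1, whose reciprocal is \<open>c_tilde\<close> at \<alpha> n / 2: the origin of the leading
  constant.\<close>

lemma integral_prod_mixchar_eq_expected_angle:
  assumes a: "0 < \<alpha>" and k: "1 \<le> k" "k \<le> d" and n: "1 < \<alpha> * real (Suc d)"
  shows "complex_of_real (\<integral>X. internal_angle d X {..<k} {..<Suc d} \<partial>PiM {..<Suc d} (\<lambda>_. beta'_distr d ((\<alpha> + real d) / 2))) =
    complex_of_real (c_tilde (\<alpha> * real (Suc d) / 2)) * (\<integral>t. (\<Prod>j<Suc d. mixchar (\<alpha> / 2) (sign_set k j) t) \<partial>lborel)"
proof -
  let ?U = "lebesgue_d (Suc d)" and ?s = "\<alpha> / 2"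
  let ?g = "\<lambda>v. \<Prod>j<Suc d. gamma_dens ?s (v j)"
  let ?P = "\<lambda>v. cone_ratio d k v"
  define EP where "EP = (\<integral>\<^sup>+v. gamma_prod ?s (Suc d) v * ?P v \<partial>?U)"
  have s: "0 < ?s" using a by simp
  have g0: "0 \<le> ?g v" for v using gamma_dens_nonneg[OF s] by (intro prod_nonneg) auto
  \<comment> \<open>The two sides differ in where the passage to extended reals takes place. It
    needs a finite cone ratio, which holds for positive v; otherwise the gamma weight makes both
    sides 0.\<close>
  have key: "ennreal (?g v * (sqrt (pi / (\<Sum>j<Suc d. v j)) * enn2real (?P v))) =
      gamma_prod ?s (Suc d) v * (ennreal (sqrt (pi / (\<Sum>j<Suc d. v j))) * ?P v)"
    and nonneg: "0 \<le> ?g v * (sqrt (pi / (\<Sum>j<Suc d. v j)) * enn2real (?P v))" for v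
  proof -
    have eg: "gamma_prod ?s (Suc d) v = ennreal (?g v)"
      using gamma_dens_nonneg[OF s] by (intro prod_ennreal) auto
    consider "\<forall>j<Suc d. 0 < v j" | "?g v = 0"
    proof (cases "\<forall>j<Suc d. 0 < v j")
      case False
      then show thesis by (intro that(2) prod_gamma_dens_eq_0(1))
    qed (rule that(1))
    then have "ennreal (?g v * (sqrt (pi / (\<Sum>j<Suc d. v j)) * enn2real (?P v))) =
      gamma_prod ?s (Suc d) v * (ennreal (sqrt (pi / (\<Sum>j<Suc d. v j))) * ?P v) \<and>
      0 \<le> ?g v * (sqrt (pi / (\<Sum>j<Suc d. v j)) * enn2real (?P v))"
    proof cases
      case 1
      have "cone_mass d k v \<le> full_mass d v"
        unfolding cone_mass_def full_mass_def by (intro nn_integral_mono) (auto simp: indicator_def)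
      then have "?P v \<noteq> \<infinity>"
        using full_mass_pos_finite[of d v] 1 by (auto simp: ennreal_divide_eq_top_iff top_unique)
      then have P: "ennreal (enn2real (?P v)) = ?P v" by (simp add: less_top)
      have "0 < (\<Sum>j<Suc d. v j)" using 1 by (intro sum_pos) auto
      then have sq: "0 \<le> sqrt (pi / (\<Sum>j<Suc d. v j))" by simp
      have "ennreal (?g v * (sqrt (pi / (\<Sum>j<Suc d. v j)) * enn2real (?P v))) =
        ennreal (?g v) * (ennreal (sqrt (pi / (\<Sum>j<Suc d. v j))) * ennreal (enn2real (?P v)))"
        by (simp only: ennreal_mult'[OF g0] ennreal_mult'[OF sq])
      moreover have "0 \<le> ?g v * (sqrt (pi / (\<Sum>j<Suc d. v j)) * enn2real (?P v))"
        by (intro mult_nonneg_nonneg g0 sq enn2real_nonneg)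
      ultimately show ?thesis by (simp only: eg P)
    next
      case 2
      then show ?thesis unfolding eg by (simp only: mult_zero_left ennreal_0 order_refl)
    qed
    then show "ennreal (?g v * (sqrt (pi / (\<Sum>j<Suc d. v j)) * enn2real (?P v))) =
      gamma_prod ?s (Suc d) v * (ennreal (sqrt (pi / (\<Sum>j<Suc d. v j))) * ?P v)"
      "0 \<le> ?g v * (sqrt (pi / (\<Sum>j<Suc d. v j)) * enn2real (?P v))" by blast+
  qed
  have gm [measurable]: "?g \<in> borel_measurable ?U"
  proof (rule borel_measurable_prod)
    fix j assume "j \<in> {..<Suc d}"
    then have [measurable]: "(\<lambda>v. v j) \<in> borel_measurable ?U"
      by (intro measurable_lebesgue_d_nth[of "\<lambda>x. x" _ "Suc d"]) auto
    show "(\<lambda>v. gamma_dens ?s (v j)) \<in> borel_measurable ?U" by measurable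
  qed
  have "(\<integral>v. ?g v * (sqrt (pi / (\<Sum>j<Suc d. v j)) * enn2real (?P v)) \<partial>?U) =
    enn2real (\<integral>\<^sup>+v. ennreal (?g v * (sqrt (pi / (\<Sum>j<Suc d. v j)) * enn2real (?P v))) \<partial>?U)"
    by (rule integral_eq_nn_integral)
       (auto intro!: borel_measurable_times gm borel_measurable_sqrt borel_measurable_divide sum_nth_measurable
          measurable_compose[OF cone_ratio_measurable borel_measurable_enn2real] nonneg
          simp del: sum.lessThan_Suc prod.lessThan_Suc)
  also have "\<dots> = enn2real ((\<integral>\<^sup>+t. ennreal ((1 + t\<^sup>2) powr (- (real (Suc d) * ?s))) \<partial>lborel) * EP)"
    unfolding key EP_def
    by (subst nn_integral_gamma_prod_sqrt[OF s]) (auto intro!: cone_ratio_scale simp del: sum.lessThan_Suc prod.lessThan_Suc)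
  also have "(\<integral>\<^sup>+t. ennreal ((1 + t\<^sup>2) powr (- (real (Suc d) * ?s))) \<partial>lborel) =
      ennreal (sqrt pi * Gamma (real (Suc d) * ?s - 1 / 2) / Gamma (real (Suc d) * ?s))"
    by (rule nn_integral_one_plus_square_powr) (use n in \<open>simp add: field_simps\<close>)
  also have "enn2real (ennreal (sqrt pi * Gamma (real (Suc d) * ?s - 1 / 2) / Gamma (real (Suc d) * ?s)) * EP) =
      sqrt pi * Gamma (real (Suc d) * ?s - 1 / 2) / Gamma (real (Suc d) * ?s) * enn2real EP"
  proof -
    have "0 < Gamma (real (Suc d) * ?s - 1 / 2)" "0 < Gamma (real (Suc d) * ?s)"
      using n a by (auto intro!: Gamma_real_pos simp: field_simps)
    then show ?thesis by (simp add: enn2real_mult)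
  qed
  finally have eq: "(\<integral>v. ?g v * (sqrt (pi / (\<Sum>j<Suc d. v j)) * enn2real (?P v)) \<partial>?U) =
    sqrt pi * Gamma (real (Suc d) * ?s - 1 / 2) / Gamma (real (Suc d) * ?s) * enn2real EP" .
  have "c_tilde (\<alpha> * real (Suc d) / 2) * (sqrt pi * Gamma (real (Suc d) * ?s - 1 / 2) / Gamma (real (Suc d) * ?s)) = 1"
  proof -
    have "0 < Gamma (real (Suc d) * ?s - 1 / 2)" "0 < Gamma (real (Suc d) * ?s)"
      using n a by (auto intro!: Gamma_real_pos simp: field_simps)
    moreover have "\<alpha> * real (Suc d) / 2 = real (Suc d) * ?s" by simp
    ultimately show ?thesis unfolding c_tilde_def by (simp add: mult.commute[of \<alpha>] del: of_nat_Suc)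
  qed
  then have "enn2real EP = c_tilde (\<alpha> * real (Suc d) / 2) *
      (\<integral>v. ?g v * (sqrt (pi / (\<Sum>j<Suc d. v j)) * enn2real (?P v)) \<partial>?U)"
    unfolding eq by (simp only: mult.assoc[symmetric] mult_1_left)
  moreover have "(\<integral>t. (\<Prod>j<Suc d. mixchar ?s (sign_set k j) t) \<partial>lborel) =
      complex_of_real (\<integral>v. ?g v * (sqrt (pi / (\<Sum>j<Suc d. v j)) * enn2real (?P v)) \<partial>?U)"
    by (rule integral_prod_mixchar(2)[OF s]) (use k n in auto)
  ultimately show ?thesis
    unfolding expected_angle[OF a k] EP_def[symmetric] by (simp only: of_real_mult)
qed

section \<open>Evaluation of the one-dimensional transforms\<close>

lemma integral_gamma_dens_exp:
  assumes s: "0 < s" and c: "0 \<le> c"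
  shows "(\<integral>v. gamma_dens s v * exp (- (c * v)) \<partial>lborel) = (1 + c) powr (- s)"
proof -
  have "(\<integral>v. gamma_dens s v * exp (- (c * v)) \<partial>lborel) = enn2real (\<integral>\<^sup>+v. ennreal (gamma_dens s v * exp (- (c * v))) \<partial>lborel)"
    using gamma_dens_nonneg[OF s] by (intro integral_eq_nn_integral) auto
  then show ?thesis by (simp add: nn_integral_gamma_dens_exp[OF s c])
qed

lemma mixchar_UNIV:
  assumes s: "0 < s"
  shows "mixchar s UNIV t = complex_of_real ((1 + t\<^sup>2) powr (- s))"
proof -
  have "mixchar s UNIV t = (\<integral>v. complex_of_real (gamma_dens s v * exp (- (t\<^sup>2 * v))) \<partial>lborel)"
    unfolding mixchar_def
  proof (intro Bochner_Integration.integral_cong refl)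
    fix v show "complex_of_real (gamma_dens s v) * gchar UNIV v t = complex_of_real (gamma_dens s v * exp (- (t\<^sup>2 * v)))"
      by (cases "0 < v") (simp_all add: gchar_UNIV gamma_dens_def mult.commute)
  qed
  then show ?thesis using integral_gamma_dens_exp[OF s, of "t\<^sup>2"] by (simp only: integral_complex_of_real zero_le_power2)
qed

section \<open>The averaged half-line transform and the cosine integral\<close>

lemma nn_integral_Icc_eq_interval_integral:
  fixes f :: "real \<Rightarrow> real"
  assumes "a \<le> b" "continuous_on {a..b} f" "\<And>x. x \<in> {a..b} \<Longrightarrow> 0 \<le> f x"
  shows "(\<integral>\<^sup>+x. ennreal (indicator {a..b} x * f x) \<partial>lborel) = ennreal (LBINT x=a..b. f x)"
proof -
  have "integrable lborel (\<lambda>x. indicator {a..b} x *\<^sub>R f x)"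
    by (rule borel_integrable_compact[OF compact_Icc assms(2)])
  then have "(\<integral>\<^sup>+x. ennreal (indicator {a..b} x * f x) \<partial>lborel) = ennreal (\<integral>x. indicator {a..b} x * f x \<partial>lborel)"
    using assms(3) by (intro nn_integral_eq_integral) (auto simp: indicator_def)
  then show ?thesis
    using assms(1) by (simp add: interval_integral_Icc set_lebesgue_integral_def)
qed

lemma interval_integral_even:
  fixes f :: "real \<Rightarrow> real"
  assumes "\<And>x. f (- x) = f x"
  shows "(LBINT x=0..ereal (- t). f x) = - (LBINT x=0..ereal t. f x)"
proof -
  have "(LBINT x=0..ereal (- t). f x) = (LBINT x=- ereal (- t)..- 0. f (- x))"
    by (rule interval_integral_reflect)
  also have "\<dots> = (LBINT x=ereal t..0. f x)" by (simp add: assms)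
  also have "\<dots> = - (LBINT x=0..ereal t. f x)" by (rule interval_integral_endpoints_reverse)
  finally show ?thesis .
qed

text \<open>Substitute r = q sin y with q = sqrt(1 + t^2): the base becomes (q cos y)^2, and the
  upper limit is arctan t because sin(arctan t) = t / q. The factor q cos y from dr raises the
  exponent from -(\<alpha> + 1) to -\<alpha>.\<close>

lemma interval_integral_one_plus_square_diff:
  fixes \<alpha> t :: real
  assumes t: "0 \<le> t"
  shows "(LBINT r=0..ereal t. (1 + t\<^sup>2 - r\<^sup>2) powr (- ((\<alpha> + 1) / 2))) =
    (1 + t\<^sup>2) powr (- (\<alpha> / 2)) * (LBINT y=0..ereal (arctan t). cos y powr (- \<alpha>))"
proof -
  define q where "q = sqrt (1 + t\<^sup>2)"
  have q: "0 < q" "q\<^sup>2 = 1 + t\<^sup>2" by (auto simp: q_def add_pos_nonneg)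
  have at: "0 \<le> arctan t" using t by simp
  have cos_pos: "0 < cos y" if "0 \<le> y" "y \<le> arctan t" for y
    using that arctan_ubound[of t] by (intro cos_gt_zero_pi) auto
  have diff: "1 + t\<^sup>2 - (q * sin y)\<^sup>2 = q\<^sup>2 * (cos y)\<^sup>2" for y
    unfolding q(2)[symmetric] power_mult_distrib by (simp add: cos_squared_eq algebra_simps)
  have "(LBINT y=ereal 0..ereal (arctan t). (q * cos y) *\<^sub>R (1 + t\<^sup>2 - (q * sin y)\<^sup>2) powr (- ((\<alpha> + 1) / 2))) =
    (LBINT r=ereal (q * sin 0)..ereal (q * sin (arctan t)). (1 + t\<^sup>2 - r\<^sup>2) powr (- ((\<alpha> + 1) / 2)))"
  proof (rule interval_integral_substitution_finite[OF at, where g = "\<lambda>y. q * sin y" and g' = "\<lambda>y. q * cos y"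
        and f = "\<lambda>r. (1 + t\<^sup>2 - r\<^sup>2) powr (- ((\<alpha> + 1) / 2))"])
    show "((\<lambda>y. q * sin y) has_real_derivative q * cos y) (at y within {0..arctan t})" for y
      by (auto intro!: derivative_eq_intros)
    have "1 + t\<^sup>2 - r\<^sup>2 \<noteq> 0" if "r \<in> (\<lambda>y. q * sin y) ` {0..arctan t}" for r
    proof -
      from that obtain y where y': "y \<in> {0..arctan t}" "r = q * sin y" by blast
      then have y: "r = q * sin y" "0 \<le> y" "y \<le> arctan t" by auto
      show ?thesis unfolding y(1) diff using q(1) cos_pos[OF y(2,3)] by simp
    qed
    then show "continuous_on ((\<lambda>y. q * sin y) ` {0..arctan t}) (\<lambda>r. (1 + t\<^sup>2 - r\<^sup>2) powr (- ((\<alpha> + 1) / 2)))"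
      by (intro continuous_intros) auto
    show "continuous_on {0..arctan t} (\<lambda>y. q * cos y)" by (intro continuous_intros)
  qed
  moreover have "q * sin (arctan t) = t" by (simp add: sin_arctan q_def add_nonneg_eq_0_iff)
  ultimately have "(LBINT r=0..ereal t. (1 + t\<^sup>2 - r\<^sup>2) powr (- ((\<alpha> + 1) / 2))) =
    (LBINT y=ereal 0..ereal (arctan t). (q * cos y) *\<^sub>R (1 + t\<^sup>2 - (q * sin y)\<^sup>2) powr (- ((\<alpha> + 1) / 2)))"
    by (simp add: zero_ereal_def)
  also have "\<dots> = (LBINT y=ereal 0..ereal (arctan t). (1 + t\<^sup>2) powr (- (\<alpha> / 2)) * cos y powr (- \<alpha>))"
  proof (rule interval_integral_cong)
    fix y assume "y \<in> einterval (min (ereal 0) (ereal (arctan t))) (max (ereal 0) (ereal (arctan t)))"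
    then have y: "0 \<le> y" "y \<le> arctan t" using at by (auto simp: einterval_iff min_def max_def)
    have c: "0 < q * cos y" using q(1) cos_pos[OF y] by simp
    have "(q * cos y) *\<^sub>R (1 + t\<^sup>2 - (q * sin y)\<^sup>2) powr (- ((\<alpha> + 1) / 2)) =
      (q * cos y) powr 1 * ((q * cos y) powr 2) powr (- ((\<alpha> + 1) / 2))"
      unfolding diff using c by (simp add: power_mult_distrib)
    also have "\<dots> = (q * cos y) powr (- \<alpha>)"
      unfolding powr_powr powr_add[symmetric] by (rule arg_cong[where f = "(powr) (q * cos y)"]) (simp add: field_simps)
    also have "\<dots> = q powr (- \<alpha>) * cos y powr (- \<alpha>)"
      using q(1) cos_pos[OF y] by (simp add: powr_mult)
    also have "q powr (- \<alpha>) = (1 + t\<^sup>2) powr (- (\<alpha> / 2))"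
    proof -
      have "1 + t\<^sup>2 = q powr 2" using q by simp
      then show ?thesis by (simp only: powr_powr) simp
    qed
    finally show "(q * cos y) *\<^sub>R (1 + t\<^sup>2 - (q * sin y)\<^sup>2) powr (- ((\<alpha> + 1) / 2)) =
      (1 + t\<^sup>2) powr (- (\<alpha> / 2)) * cos y powr (- \<alpha>)" .
  qed
  finally show ?thesis by (simp add: zero_ereal_def)
qed

text \<open>The factor sqrt v raises the shape of the gamma density from s to s + 1/2, and Gamma(s +
  1/2) / (sqrt pi Gamma(s)) is \<open>c_tilde (s + 1/2)\<close>. For s = \<alpha>/2 this is the
  constant in the inner integral of the theorem.\<close>

lemma nn_integral_gamma_dens_sqrt_exp:
  assumes s: "0 < s" and c: "0 \<le> c"
  shows "(\<integral>\<^sup>+v. ennreal (gamma_dens s v * (sqrt (v / pi) * exp (- (c * v)))) \<partial>lborel) =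
    ennreal (c_tilde (s + 1 / 2) * (1 + c) powr (- (s + 1 / 2)))"
proof -
  have G: "0 < Gamma s" "0 < Gamma (s + 1 / 2)" using s by (auto intro!: Gamma_real_pos)
  have "(\<integral>\<^sup>+v. ennreal (gamma_dens s v * (sqrt (v / pi) * exp (- (c * v)))) \<partial>lborel) =
    (\<integral>\<^sup>+v. ennreal (1 / (sqrt pi * Gamma s)) * ennreal (indicator {0<..} v * (v powr (s + 1 / 2 - 1) * exp (- ((1 + c) * v)))) \<partial>lborel)"
  proof (intro nn_integral_cong)
    fix v :: real
    show "ennreal (gamma_dens s v * (sqrt (v / pi) * exp (- (c * v)))) =
      ennreal (1 / (sqrt pi * Gamma s)) * ennreal (indicator {0<..} v * (v powr (s + 1 / 2 - 1) * exp (- ((1 + c) * v))))"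
    proof (cases "0 < v")
      case True
      have "v powr (s + 1 / 2 - 1) = v powr (s - 1) * v powr (1 / 2)"
        unfolding powr_add[symmetric] by (rule arg_cong[where f = "(powr) v"]) simp
      also have "v powr (1 / 2) = sqrt v" using True by (simp add: powr_half_sqrt)
      finally have p: "v powr (s + 1 / 2 - 1) = v powr (s - 1) * sqrt v" .
      have e: "exp (- ((1 + c) * v)) = exp (- v) * exp (- (c * v))"
        by (simp add: mult_exp_exp algebra_simps)
      have "gamma_dens s v * (sqrt (v / pi) * exp (- (c * v))) =
        1 / (sqrt pi * Gamma s) * (indicator {0<..} v * (v powr (s + 1 / 2 - 1) * exp (- ((1 + c) * v))))"
        unfolding p e using True by (simp add: gamma_dens_def real_sqrt_divide mult_ac)
      then show ?thesis using G by (subst ennreal_mult'[symmetric]) auto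
    qed (simp add: gamma_dens_def)
  qed
  also have "\<dots> = ennreal (1 / (sqrt pi * Gamma s)) * ennreal (Gamma (s + 1 / 2) / (1 + c) powr (s + 1 / 2))"
    using s c nn_integral_powr_exp[of "s + 1 / 2" "1 + c"] by (subst nn_integral_cmult) auto
  also have "\<dots> = ennreal (1 / (sqrt pi * Gamma s) * (Gamma (s + 1 / 2) / (1 + c) powr (s + 1 / 2)))"
    using G by (intro ennreal_mult'[symmetric]) simp
  also have "1 / (sqrt pi * Gamma s) * (Gamma (s + 1 / 2) / (1 + c) powr (s + 1 / 2)) =
      c_tilde (s + 1 / 2) * (1 + c) powr (- (s + 1 / 2))"
    unfolding powr_minus_divide c_tilde_def by simp
  finally show ?thesis .
qed

text \<open>\<open>gchar_half\<close> separates the two parts: the real one is half of the full-line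
  transform, the imaginary one remains to be evaluated. Measurability in v of the latter, which
  contains an inner integral, is inherited from the complex integrand and recorded for the
  conversion to a nonnegative integral.\<close>

lemma Im_mixchar_half:
  assumes s: "0 < s"
  shows "Im (mixchar s {0..} t) =
      (\<integral>v. gamma_dens s v * (exp (- (v * t\<^sup>2)) * (sqrt (v / pi) * (LBINT r=0..ereal t. exp (v * r\<^sup>2)))) \<partial>lborel)"
    and "Re (mixchar s {0..} t) = (1 + t\<^sup>2) powr (- s) / 2"
    and "(\<lambda>v. gamma_dens s v * (exp (- (v * t\<^sup>2)) * (sqrt (v / pi) * (LBINT r=0..ereal t. exp (v * r\<^sup>2))))) \<in> borel_measurable lborel"
proof -
  let ?f = "\<lambda>v. complex_of_real (gamma_dens s v) * gchar {0..} v t"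
  have int: "integrable lborel ?f" using integrable_mixchar_integrand[OF s, of 0 0 t] by (simp add: sign_set_def)
  have Im_f: "Im (?f v) = gamma_dens s v * (exp (- (v * t\<^sup>2)) * (sqrt (v / pi) * (LBINT r=0..ereal t. exp (v * r\<^sup>2))))" for v
    by (cases "0 < v") (simp_all add: gchar_half gamma_dens_def)
  have Re_f: "Re (?f v) = gamma_dens s v * exp (- (t\<^sup>2 * v)) / 2" for v
    by (cases "0 < v") (simp_all add: gchar_half gamma_dens_def mult.commute)
  show "Im (mixchar s {0..} t) =
      (\<integral>v. gamma_dens s v * (exp (- (v * t\<^sup>2)) * (sqrt (v / pi) * (LBINT r=0..ereal t. exp (v * r\<^sup>2)))) \<partial>lborel)"
    unfolding mixchar_def Im_f[symmetric] using int by (rule integral_Im[symmetric])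
  have "Re (mixchar s {0..} t) = (\<integral>v. gamma_dens s v * exp (- (t\<^sup>2 * v)) / 2 \<partial>lborel)"
    unfolding mixchar_def Re_f[symmetric] using int by (rule integral_Re[symmetric])
  then show "Re (mixchar s {0..} t) = (1 + t\<^sup>2) powr (- s) / 2"
    using integral_gamma_dens_exp[OF s, of "t\<^sup>2"] by simp
  have "(\<lambda>v. Im (?f v)) \<in> borel_measurable lborel" using int by measurable
  then show "(\<lambda>v. gamma_dens s v * (exp (- (v * t\<^sup>2)) * (sqrt (v / pi) * (LBINT r=0..ereal t. exp (v * r\<^sup>2))))) \<in> borel_measurable lborel"
    by (simp only: Im_f)
qed

abbreviation (input) cos_integral :: "real \<Rightarrow> real \<Rightarrow> real" where
  "cos_integral \<alpha> x \<equiv> LBINT y=0..ereal x. c_tilde ((\<alpha> + 1) / 2) * cos y powr (- \<alpha>)"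

text \<open>For t \<ge> 0 everything is nonnegative, so by Tonelli the integral over v may be taken
  before that over r. The exponentials combine to exp(-(t^2 - r^2) v) with t^2 - r^2 \<ge> 0, a
  gamma integral, and the remaining integral over r reduces to the cosine integral.\<close>

lemma Im_mixchar_half_nonneg:
  assumes a: "0 < \<alpha>" and t: "0 \<le> t"
  shows "Im (mixchar (\<alpha> / 2) {0..} t) =
    (1 + t\<^sup>2) powr (- (\<alpha> / 2)) * cos_integral \<alpha> (arctan t)"
proof -
  let ?s = "\<alpha> / 2"
  let ?R = "\<lambda>v. gamma_dens ?s v * (exp (- (v * t\<^sup>2)) * (sqrt (v / pi) * (LBINT r=0..ereal t. exp (v * r\<^sup>2))))"
  have s: "0 < ?s" using a by simp
  have s2: "?s + 1 / 2 = (\<alpha> + 1) / 2" by (simp add: add_divide_distrib)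
  have ct: "0 \<le> c_tilde ((\<alpha> + 1) / 2)"
    using a unfolding c_tilde_def by (intro divide_nonneg_nonneg mult_nonneg_nonneg less_imp_le[OF Gamma_real_pos]) (auto simp: add_divide_distrib)
  have R: "ennreal (?R v) = (\<integral>\<^sup>+r. ennreal (indicator {0..t} r * (gamma_dens ?s v * (sqrt (v / pi) * exp (- ((t\<^sup>2 - r\<^sup>2) * v))))) \<partial>lborel)"
    and R0: "0 \<le> ?R v" for v
  proof -
    have "(LBINT r=0..ereal t. gamma_dens ?s v * (sqrt (v / pi) * exp (- ((t\<^sup>2 - r\<^sup>2) * v)))) =
      (LBINT r=0..ereal t. (gamma_dens ?s v * (sqrt (v / pi) * exp (- (v * t\<^sup>2)))) * exp (v * r\<^sup>2))"
    proof (rule interval_integral_cong)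
      fix r
      have "exp (- ((t\<^sup>2 - r\<^sup>2) * v)) = exp (- (v * t\<^sup>2)) * exp (v * r\<^sup>2)"
        by (simp add: mult_exp_exp algebra_simps)
      then show "gamma_dens ?s v * (sqrt (v / pi) * exp (- ((t\<^sup>2 - r\<^sup>2) * v))) =
        (gamma_dens ?s v * (sqrt (v / pi) * exp (- (v * t\<^sup>2)))) * exp (v * r\<^sup>2)"
        by (simp only: mult.assoc)
    qed
    also have "\<dots> = ?R v" by (simp add: mult_ac)
    finally have eq: "(LBINT r=0..ereal t. gamma_dens ?s v * (sqrt (v / pi) * exp (- ((t\<^sup>2 - r\<^sup>2) * v)))) = ?R v" .
    have nn: "0 \<le> gamma_dens ?s v * (sqrt (v / pi) * exp (- ((t\<^sup>2 - r\<^sup>2) * v)))" for r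
    proof (cases "0 < v")
      case True
      then show ?thesis by (intro mult_nonneg_nonneg gamma_dens_nonneg[OF s]) auto
    qed (simp add: gamma_dens_def)
    show "ennreal (?R v) = (\<integral>\<^sup>+r. ennreal (indicator {0..t} r * (gamma_dens ?s v * (sqrt (v / pi) * exp (- ((t\<^sup>2 - r\<^sup>2) * v))))) \<partial>lborel)"
      unfolding eq[symmetric]
      by (rule nn_integral_Icc_eq_interval_integral[of 0 t, folded zero_ereal_def, symmetric]) (use t nn in \<open>auto intro!: continuous_intros\<close>)
    have "0 \<le> (LBINT r=0..ereal t. gamma_dens ?s v * (sqrt (v / pi) * exp (- ((t\<^sup>2 - r\<^sup>2) * v))))"
      unfolding interval_integral_Icc[of 0 t, folded zero_ereal_def, OF t] set_lebesgue_integral_def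
      by (intro integral_nonneg_AE AE_I2 scaleR_nonneg_nonneg nn) simp
    then show "0 \<le> ?R v" by (simp only: eq)
  qed
  have "(\<integral>\<^sup>+v. ennreal (?R v) \<partial>lborel) =
    (\<integral>\<^sup>+v. \<integral>\<^sup>+r. ennreal (indicator {0..t} r * (gamma_dens ?s v * (sqrt (v / pi) * exp (- ((t\<^sup>2 - r\<^sup>2) * v))))) \<partial>lborel \<partial>lborel)"
    by (simp only: R)
  also have "\<dots> = (\<integral>\<^sup>+r. \<integral>\<^sup>+v. ennreal (indicator {0..t} r * (gamma_dens ?s v * (sqrt (v / pi) * exp (- ((t\<^sup>2 - r\<^sup>2) * v))))) \<partial>lborel \<partial>lborel)"
    by (rule lborel_pair.Fubini'[symmetric]) measurable
  also have "\<dots> = (\<integral>\<^sup>+r. ennreal (indicator {0..t} r * (c_tilde ((\<alpha> + 1) / 2) * (1 + t\<^sup>2 - r\<^sup>2) powr (- ((\<alpha> + 1) / 2)))) \<partial>lborel)"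
  proof (intro nn_integral_cong)
    fix r :: real
    show "(\<integral>\<^sup>+v. ennreal (indicator {0..t} r * (gamma_dens ?s v * (sqrt (v / pi) * exp (- ((t\<^sup>2 - r\<^sup>2) * v))))) \<partial>lborel) =
      ennreal (indicator {0..t} r * (c_tilde ((\<alpha> + 1) / 2) * (1 + t\<^sup>2 - r\<^sup>2) powr (- ((\<alpha> + 1) / 2))))"
    proof (cases "r \<in> {0..t}")
      case True
      then have "0 \<le> t\<^sup>2 - r\<^sup>2" by (simp add: power_mono)
      from nn_integral_gamma_dens_sqrt_exp[OF s this] True show ?thesis
        unfolding s2 by (simp add: add_diff_eq)
    qed simp
  qed
  also have "\<dots> = ennreal (LBINT r=0..ereal t. c_tilde ((\<alpha> + 1) / 2) * (1 + t\<^sup>2 - r\<^sup>2) powr (- ((\<alpha> + 1) / 2)))"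
    unfolding zero_ereal_def
  proof (rule nn_integral_Icc_eq_interval_integral[OF t])
    have "1 + t\<^sup>2 - r\<^sup>2 \<noteq> 0" if "r \<in> {0..t}" for r
    proof -
      have "r\<^sup>2 \<le> t\<^sup>2" using that by (intro power_mono) auto
      then show ?thesis by linarith
    qed
    then show "continuous_on {0..t} (\<lambda>r. c_tilde ((\<alpha> + 1) / 2) * (1 + t\<^sup>2 - r\<^sup>2) powr (- ((\<alpha> + 1) / 2)))"
      by (intro continuous_intros) auto
  qed (use ct in simp)
  also have "(LBINT r=0..ereal t. c_tilde ((\<alpha> + 1) / 2) * (1 + t\<^sup>2 - r\<^sup>2) powr (- ((\<alpha> + 1) / 2))) =
    (1 + t\<^sup>2) powr (- (\<alpha> / 2)) * cos_integral \<alpha> (arctan t)"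
    by (simp add: interval_integral_one_plus_square_diff[OF t])
  finally have nn: "(\<integral>\<^sup>+v. ennreal (?R v) \<partial>lborel) =
    ennreal ((1 + t\<^sup>2) powr (- (\<alpha> / 2)) * cos_integral \<alpha> (arctan t))" .
  have "0 \<le> cos_integral \<alpha> (arctan t)"
    unfolding zero_ereal_def using t ct by (subst interval_integral_Icc) (auto simp: set_lebesgue_integral_def)
  then have nn0: "0 \<le> (1 + t\<^sup>2) powr (- (\<alpha> / 2)) * cos_integral \<alpha> (arctan t)"
    by simp
  have "Im (mixchar ?s {0..} t) = enn2real (\<integral>\<^sup>+v. ennreal (?R v) \<partial>lborel)"
    unfolding Im_mixchar_half(1)[OF s] by (rule integral_eq_nn_integral[OF Im_mixchar_half(3)[OF s]]) (intro AE_I2 R0)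
  then show ?thesis unfolding nn using nn0 by (simp only: enn2real_ennreal)
qed

lemma mixchar_half:
  assumes a: "0 < \<alpha>"
  shows "mixchar (\<alpha> / 2) {0..} t = complex_of_real ((1 + t\<^sup>2) powr (- (\<alpha> / 2))) *
    (1 / 2 + \<i> * complex_of_real (cos_integral \<alpha> (arctan t)))"
proof -
  have s: "0 < \<alpha> / 2" using a by simp
  have "Im (mixchar (\<alpha> / 2) {0..} t) =
    (1 + t\<^sup>2) powr (- (\<alpha> / 2)) * cos_integral \<alpha> (arctan t)"
  proof (cases "0 \<le> t")
    case False
    \<comment> \<open>The inner integral from 0 to t of an even function is odd in t, and so is the
      cosine integral at arctan t; both sides change sign.\<close>
    define u where "u = - t"
    have u: "0 \<le> u" "t = - u" using False by (auto simp: u_def)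
    have "Im (mixchar (\<alpha> / 2) {0..} t) = - Im (mixchar (\<alpha> / 2) {0..} u)"
      unfolding Im_mixchar_half(1)[OF s] u(2) integral_minus[symmetric]
      by (intro Bochner_Integration.integral_cong refl) (simp add: interval_integral_even)
    also have "\<dots> = - ((1 + u\<^sup>2) powr (- (\<alpha> / 2)) * cos_integral \<alpha> (arctan u))"
      by (simp only: Im_mixchar_half_nonneg[OF a u(1)])
    also have "\<dots> = (1 + t\<^sup>2) powr (- (\<alpha> / 2)) * cos_integral \<alpha> (arctan t)"
      unfolding u(2) arctan_minus by (subst interval_integral_even) auto
    finally show ?thesis .
  qed (rule Im_mixchar_half_nonneg[OF a])
  then show ?thesis using Im_mixchar_half(2)[OF s, of t] by (intro complex_eqI) simp_all
qed

text \<open>The substitution rule for a complex integrand asks for integrability on both sides. On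
  the bounded interval, where f may blow up at the ends, it comes from the rule for nonnegative
  functions applied to the norm of f.\<close>

lemma integral_substitution_arctan:
  fixes f :: "real \<Rightarrow> complex"
  assumes cont: "\<And>x. - (pi / 2) < x \<Longrightarrow> x < pi / 2 \<Longrightarrow> isCont f x"
    and int: "integrable lborel (\<lambda>t. inverse (1 + t\<^sup>2) *\<^sub>R f (arctan t))"
  shows "(LBINT x=ereal (- (pi / 2))..ereal (pi / 2). f x) = (\<integral>t. inverse (1 + t\<^sup>2) *\<^sub>R f (arctan t) \<partial>lborel)"
proof -
  have lims: "((ereal \<circ> arctan \<circ> real_of_ereal) \<longlongrightarrow> ereal (- (pi / 2))) (at_right (- \<infinity>))"
    "((ereal \<circ> arctan \<circ> real_of_ereal) \<longlongrightarrow> ereal (pi / 2)) (at_left \<infinity>)"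
    using tendsto_arctan_at_bot tendsto_arctan_at_top
    by (simp_all only: comp_assoc[symmetric] ereal_tendsto_simps1 ereal_tendsto_simps2)
  have cf: "isCont f (arctan t)" for t using arctan_bounded[of t] by (intro cont) auto
  have ci: "isCont (\<lambda>t. inverse (1 + t\<^sup>2)) (t::real)" for t
    by (intro continuous_intros) (simp add: add_nonneg_eq_0_iff)
  have d: "DERIV arctan t :> inverse (1 + t\<^sup>2)" for t by (rule DERIV_arctan)
  have "set_integrable lborel (einterval (ereal (- (pi / 2))) (ereal (pi / 2))) (\<lambda>x. norm (f x))"
  proof (rule interval_integral_substitution_nonneg(1)[OF _ d _ ci _ _ lims])
    show "set_integrable lborel (einterval (- \<infinity>) \<infinity>) (\<lambda>t. norm (f (arctan t)) * inverse (1 + t\<^sup>2))"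
      using integrable_norm[OF int] by (simp add: set_integrable_def einterval_eq mult.commute)
    show "isCont (\<lambda>x. norm (f x)) (arctan t)" for t by (intro continuous_intros cf)
  qed auto
  then have f_int: "set_integrable lborel (einterval (ereal (- (pi / 2))) (ereal (pi / 2))) f"
  proof -
    assume A: "set_integrable lborel (einterval (ereal (- (pi / 2))) (ereal (pi / 2))) (\<lambda>x. norm (f x))"
    have "continuous_on {- (pi / 2)<..<pi / 2} f" by (intro continuous_at_imp_continuous_on) (auto intro: cont)
    then have "(\<lambda>x. indicator {- (pi / 2)<..<pi / 2} x *\<^sub>R f x) \<in> borel_measurable borel"
      by (intro borel_measurable_continuous_on_indicator) auto
    then show ?thesis unfolding set_integrable_def einterval_eq
      using A unfolding set_integrable_def einterval_eq
      by (intro Bochner_Integration.integrable_bound[OF A[unfolded set_integrable_def einterval_eq]]) auto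
  qed
  have "(LBINT x=ereal (- (pi / 2))..ereal (pi / 2). f x) = (LBINT t=-\<infinity>..\<infinity>. inverse (1 + t\<^sup>2) *\<^sub>R f (arctan t))"
    by (rule interval_integral_substitution_integrable[OF _ d cf ci _ lims _ f_int])
       (use int in \<open>auto simp: set_integrable_def einterval_eq\<close>)
  also have "\<dots> = (\<integral>t. inverse (1 + t\<^sup>2) *\<^sub>R f (arctan t) \<partial>lborel)"
    by (simp add: interval_lebesgue_integral_def set_lebesgue_integral_def einterval_eq)
  finally show ?thesis .
qed


lemma isCont_interval_integral_cos_powr:
  assumes x: "- (pi / 2) < x" "x < pi / 2"
  shows "isCont (\<lambda>u. LBINT y=0..ereal u. C * cos y powr (- \<alpha>)) x"
proof -
  \<comment> \<open>A compact interval containing 0 and x that avoids the zeros of the cosine at the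
    ends, so that the integrand is continuous on it.\<close>
  obtain e where e: "\<bar>x\<bar> < e" "e < pi / 2" using dense[of "\<bar>x\<bar>" "pi / 2"] x abs_less_iff[of x "pi / 2"] by fastforce
  have cont: "continuous_on {- e..e} (\<lambda>y. C * cos y powr (- \<alpha>))"
  proof -
    have "0 < cos y" if "y \<in> {- e..e}" for y using that e by (intro cos_gt_zero_pi) auto
    then have "\<forall>y\<in>{- e..e}. cos y \<noteq> 0" by (metis less_irrefl)
    then show ?thesis by (intro continuous_intros) auto
  qed
  have "((\<lambda>u. LBINT y=ereal 0..ereal u. C * cos y powr (- \<alpha>)) has_vector_derivative C * cos x powr (- \<alpha>)) (at x within {- e..e})"
    by (rule interval_integral_FTC2[OF _ _ cont]) (use e in auto)
  then have "((\<lambda>u. LBINT y=ereal 0..ereal u. C * cos y powr (- \<alpha>)) has_vector_derivative C * cos x powr (- \<alpha>)) (at x)"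
    using e by (simp add: at_within_Icc_at)
  then show ?thesis unfolding zero_ereal_def by (rule has_vector_derivative_continuous)
qed

text \<open>For x = arctan t one has cos x = (1 + t^2)^(-1/2) and dx = dt / (1 + t^2); the second
  factor accounts for the exponent N - 2 in place of N.\<close>

lemma cos_powr_integral_eq:
  fixes c :: real and \<alpha> C N :: real and m :: nat
  defines "h \<equiv> \<lambda>x. 1 / 2 + \<i> * complex_of_real (LBINT y=0..ereal x. C * cos y powr (- \<alpha>))"
  assumes int: "integrable lborel (\<lambda>t. complex_of_real ((1 + t\<^sup>2) powr (- (N / 2))) * h (arctan t) ^ m)"
  shows "(LBINT x=ereal (- (pi / 2))..ereal (pi / 2). complex_of_real (c * cos x powr (N - 2)) * h x ^ m) =
    complex_of_real c * (\<integral>t. complex_of_real ((1 + t\<^sup>2) powr (- (N / 2))) * h (arctan t) ^ m \<partial>lborel)"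
proof -
  let ?f = "\<lambda>x. complex_of_real (c * cos x powr (N - 2)) * h x ^ m"
  have eq: "inverse (1 + t\<^sup>2) *\<^sub>R ?f (arctan t) =
    complex_of_real c * (complex_of_real ((1 + t\<^sup>2) powr (- (N / 2))) * h (arctan t) ^ m)" for t
  proof -
    have p: "0 < 1 + t\<^sup>2" by (simp add: add_pos_nonneg)
    have c: "cos (arctan t) = (1 + t\<^sup>2) powr (- (1 / 2))"
      using p by (simp add: cos_arctan powr_minus_divide powr_half_sqrt)
    have i: "inverse (1 + t\<^sup>2) = (1 + t\<^sup>2) powr (- 1)" using p by (simp add: powr_minus)
    have "inverse (1 + t\<^sup>2) * cos (arctan t) powr (N - 2) = (1 + t\<^sup>2) powr (- 1) * (1 + t\<^sup>2) powr (- (1 / 2) * (N - 2))"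
      unfolding i c powr_powr ..
    also have "\<dots> = (1 + t\<^sup>2) powr (- (N / 2))"
      unfolding powr_add[symmetric] by (rule arg_cong[where f = "(powr) (1 + t\<^sup>2)"]) (simp add: field_simps)
    finally have fin: "inverse (1 + t\<^sup>2) * cos (arctan t) powr (N - 2) = (1 + t\<^sup>2) powr (- (N / 2))" .
    have "inverse (1 + t\<^sup>2) *\<^sub>R ?f (arctan t) =
      complex_of_real (c * (inverse (1 + t\<^sup>2) * cos (arctan t) powr (N - 2))) * h (arctan t) ^ m"
      by (simp only: scaleR_conv_of_real of_real_mult mult_ac)
    then show ?thesis unfolding fin by (simp only: of_real_mult mult.assoc)
  qed
  have "(LBINT x=ereal (- (pi / 2))..ereal (pi / 2). ?f x) = (\<integral>t. inverse (1 + t\<^sup>2) *\<^sub>R ?f (arctan t) \<partial>lborel)"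
  proof (rule integral_substitution_arctan)
    fix x :: real assume x: "- (pi / 2) < x" "x < pi / 2"
    have "0 < cos x" using x by (intro cos_gt_zero_pi) auto
    then show "isCont ?f x" unfolding h_def using isCont_interval_integral_cos_powr[OF x, of C \<alpha>]
      by (intro continuous_intros) auto
  next
    show "integrable lborel (\<lambda>t. inverse (1 + t\<^sup>2) *\<^sub>R ?f (arctan t))"
      unfolding eq using int by (rule integrable_mult_right)
  qed
  then show ?thesis unfolding eq by (simp only: integral_mult_right_zero)
qed

lemma prod_mixchar_sign_set:
  assumes a: "0 < \<alpha>"
  shows "(\<Prod>j<n. mixchar (\<alpha> / 2) (sign_set k j) t) = complex_of_real ((1 + t\<^sup>2) powr (- (\<alpha> * real n / 2))) *
    (1 / 2 + \<i> * complex_of_real (cos_integral \<alpha> (arctan t))) ^ (n - k)"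
proof -
  let ?A = "(1 + t\<^sup>2) powr (- (\<alpha> / 2))"
  let ?B = "1 / 2 + \<i> * complex_of_real (cos_integral \<alpha> (arctan t))"
  have "mixchar (\<alpha> / 2) (sign_set k j) t = complex_of_real ?A * (if j < k then 1 else ?B)" for j
    using a by (simp add: sign_set_def mixchar_UNIV mixchar_half)
  then have "(\<Prod>j<n. mixchar (\<alpha> / 2) (sign_set k j) t) = complex_of_real (?A ^ n) * (\<Prod>j<n. if j < k then 1 else ?B)"
    by (simp add: prod.distrib)
  also have "(\<Prod>j<n. if j < k then 1 else ?B) = ?B ^ (n - k)"
    by (induction n) (auto simp: Suc_diff_le not_less mult.commute)
  also have "?A ^ n = (1 + t\<^sup>2) powr (- (\<alpha> * real n / 2))"
    by (subst powr_realpow[symmetric]) (auto simp: powr_powr add_nonneg_eq_0_iff)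
  finally show ?thesis .
qed

theorem theorem1p6:
  fixes \<alpha> :: real and n k :: nat
  assumes "\<alpha> > 0" and "1 \<le> k" and "k \<le> n" and "\<alpha> * real n > 1"
  shows "complex_of_real (J_tilde n k ((\<alpha> + real n - 1) / 2)) =
    of_nat (n choose k) *
    (LBINT x=-(pi/2)..pi/2.
       complex_of_real (c_tilde (\<alpha> * real n / 2) * cos x powr (\<alpha> * real n - 2)) *
       (1/2 + \<i> * complex_of_real
          (LBINT y=0..x. c_tilde ((\<alpha> + 1) / 2) * cos y powr (- \<alpha>))) ^ (n - k))"
proof (cases "k = n")
  case True
  \<comment> \<open>Here \<open>J_tilde\<close> is 1 by convention, so the claim is that the
    normalized power of the cosine has total mass 1. The case n = 1 falls under this branch.\<close>
  define s where "s = \<alpha> * real n / 2"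
  have s: "1 / 2 < s" using assms(4) by (simp add: s_def)
  have G: "0 < Gamma s" "0 < Gamma (s - 1 / 2)" using s by (auto intro!: Gamma_real_pos)
  have nn: "(\<integral>\<^sup>+t. ennreal ((1 + t\<^sup>2) powr (- s)) \<partial>lborel) = ennreal (sqrt pi * Gamma (s - 1 / 2) / Gamma s)"
    by (rule nn_integral_one_plus_square_powr[OF s])
  then have int: "integrable lborel (\<lambda>t. (1 + t\<^sup>2) powr (- s))"
    by (intro integrableI_bounded) auto
  have val: "(\<integral>t. (1 + t\<^sup>2) powr (- s) \<partial>lborel) = sqrt pi * Gamma (s - 1 / 2) / Gamma s"
    using G by (subst integral_eq_nn_integral) (auto simp: nn)
  have "(LBINT x=-(pi/2)..pi/2.
       complex_of_real (c_tilde (\<alpha> * real n / 2) * cos x powr (\<alpha> * real n - 2)) *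
       (1/2 + \<i> * complex_of_real
          (LBINT y=0..x. c_tilde ((\<alpha> + 1) / 2) * cos y powr (- \<alpha>))) ^ 0) =
    complex_of_real (c_tilde (\<alpha> * real n / 2)) * (\<integral>t. complex_of_real ((1 + t\<^sup>2) powr (- (\<alpha> * real n / 2))) *
       (1/2 + \<i> * complex_of_real
          (cos_integral \<alpha> (arctan t))) ^ 0 \<partial>lborel)"
    by (rule cos_powr_integral_eq) (use int in \<open>simp add: s_def\<close>)
  also have "\<dots> = complex_of_real (c_tilde s * (sqrt pi * Gamma (s - 1 / 2) / Gamma s))"
    by (simp add: val flip: s_def)
  also have "c_tilde s * (sqrt pi * Gamma (s - 1 / 2) / Gamma s) = 1"
    using G by (simp add: c_tilde_def)
  finally show ?thesis using True by (simp add: J_tilde_def)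
next
  case False
  \<comment> \<open>The ambient dimension. From k < n one gets k \<le> d, so d is at least 1 as the
    earlier results require.\<close>
  define d where "d = n - 1"
  have n: "n = Suc d" and k: "k \<le> d" using False assms(2,3) by (auto simp: d_def)
  have N: "1 < \<alpha> * real (Suc d)" using assms(4) by (simp only: n)
  have "integrable lborel (\<lambda>t. \<Prod>j<Suc d. mixchar (\<alpha> / 2) (sign_set k j) t)"
    by (rule integral_prod_mixchar(1)) (use assms k N in auto)
  then have int: "integrable lborel (\<lambda>t. complex_of_real ((1 + t\<^sup>2) powr (- (\<alpha> * real n / 2))) *
       (1/2 + \<i> * complex_of_real (cos_integral \<alpha> (arctan t))) ^ (n - k))"
    by (simp only: n prod_mixchar_sign_set[OF assms(1)])
  have "(\<alpha> + real n - 1) / 2 = (\<alpha> + real d) / 2" by (simp add: n)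
  then have "complex_of_real (J_tilde n k ((\<alpha> + real n - 1) / 2)) = of_nat (n choose k) *
    complex_of_real (\<integral>X. internal_angle d X {..<k} {..<Suc d} \<partial>PiM {..<Suc d} (\<lambda>_. beta'_distr d ((\<alpha> + real d) / 2)))"
    using False by (simp add: J_tilde_def n)
  also have "complex_of_real (\<integral>X. internal_angle d X {..<k} {..<Suc d} \<partial>PiM {..<Suc d} (\<lambda>_. beta'_distr d ((\<alpha> + real d) / 2))) =
    complex_of_real (c_tilde (\<alpha> * real (Suc d) / 2)) * (\<integral>t. (\<Prod>j<Suc d. mixchar (\<alpha> / 2) (sign_set k j) t) \<partial>lborel)"
    by (rule integral_prod_mixchar_eq_expected_angle[OF assms(1,2) k N])
  also have "\<dots> = (LBINT x=-(pi/2)..pi/2.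
       complex_of_real (c_tilde (\<alpha> * real n / 2) * cos x powr (\<alpha> * real n - 2)) *
       (1/2 + \<i> * complex_of_real
          (LBINT y=0..x. c_tilde ((\<alpha> + 1) / 2) * cos y powr (- \<alpha>))) ^ (n - k))"
    unfolding prod_mixchar_sign_set[OF assms(1)] n by (rule cos_powr_integral_eq[OF int[unfolded n], symmetric])
  finally show ?thesis .
qed

end
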